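(* Baumslag's metabelian group $$G_\infty=\langle a,s,t\mid a^s=a^ta,\ [a^t,a]=1,\ [s,t]=1\rangle$$ is algorithmically stackable, and for every integer $p\ge 2$ the Diestel–Leader torsion analog $$G_p=\langle a,s,t\mid a^s=a^ta,\ [a^t,a]=1,\ [s,t]=1,\ a^p=1\rangle$$ is autostackable.
   Context: Here $g^h:=hgh^{-1}$ for group elements $g,h$, and $[g,h]$ is the commutator. Let $G$ be a group with a finite inverse-closed generating set $X$, no element of which represents the identity. Let $\Gamma=\Gamma(G,X)$ be the Cayley graph, $\vec E$ its set of directed edges and $\vec P$ its set of directed edge paths. For $g\in G$, $x\in X$, $e_{g,x}$ is the directed edge from $g$ to $gx$ labeled $x$; $e_{g,x}$ and $e_{gx,x^{-1}}$ have the same underlying undirected edge. A flow function associated to a maximal tree $\mathcal T$ in $\Gamma$ is a function $\Phi:\vec E\to\vec P$ such that: (F1) $\Phi(e)$ has the same initial and terminal vertices as $e$; (F2d) if the undirected edge underlying $e$ lies in $\mathcal T$, then $\Phi(e)=e$; (F2r) the transitive closure of the relation $<$ on $\vec E$, where $e'<e$ whenever $e'$ lies on $\Phi(e)$ and the undirected edges underlying both $e$ and $e'$ do not lie in $\mathcal T$, is a well-founded strict partial ordering. It is bounded if there is a constant $k$ such that every path $\Phi(e)$ has length at most $k$. For $g\in G$, $\mathsf{nf}(g)\in X^*$ is the label of the unique path without backtracking in $\mathcal T$ from the identity to $g$, and $\mathcal N_{\mathcal T}=\{\mathsf{nf}(g)\mid g\in G\}$. The stacking map $\phi:\mathcal N_{\mathcal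 T}\times X\to X^*$ sends $(\mathsf{nf}(g),x)$ to the label of $\Phi(e_{g,x})$, and $\mathsf{graph}(\phi)=\{(\mathsf{nf}(g),x,\phi(\mathsf{nf}(g),x))\mid g\in G,x\in X\}\subseteq (X^* )^3$. A subset $L\subseteq (X^* )^n$ is synchronously regular if the set of padded words $\{\mathsf{pad}(w)\mid w\in L\}$ is a regular language over the alphabet $(X\cup\{\$\})^n$, where $\$\notin X$ and $\mathsf{pad}(w_1,\dots,w_n)$ is obtained by appending letters $\$$ to the ends of the shorter $w_i$ so that all have the same length $N=\max_i l(w_i)$, and reading the result as a word of length $N$ of $n$-tuples. $G$ is algorithmically stackable (respectively, autostackable) over $X$ if there is a bounded flow function on a maximal tree of $\Gamma(G,X)$ for which $\mathsf{graph}(\phi)$ is decidable, i.e. recursive (respectively, synchronously regular). $G$ is algorithmically stackable (respectively, autostackable) if this holds for some finite inverse-closed generating set. *)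

theory Defs
  imports
    "HOL-Algebra.Generated_Groups"
    "HOL-Library.Nat_Bijection"
    "Graph_Theory.Digraph_Component"
begin

section \<open>Cayley graphs, maximal trees and flow functions\<close>

definition inverse_closed_gens :: "('a, 'b) monoid_scheme \<Rightarrow> 'a set \<Rightarrow> bool" where
  "inverse_closed_gens G X \<longleftrightarrow>
     group G \<and> finite X \<and> X \<subseteq> carrier G \<and> \<one>\<^bsub>G\<^esub> \<notin> X \<and>
     (\<forall>x\<in>X. inv\<^bsub>G\<^esub> x \<in> X) \<and> generate G X = carrier G"

text \<open>The directed edge from \<open>g\<close> to \<open>gx\<close> labelled \<open>x\<close> is the pair \<open>(g, x)\<close>. Directed edge
  paths are the walks \<^term>\<open>pre_digraph.awalk\<close> of the library.\<close>

definition cayley_graph :: "('a, 'b) monoid_scheme \<Rightarrow> 'a set \<Rightarrow> ('a, 'a \<times> 'a) pre_digraph" where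
  "cayley_graph G X =
     \<lparr>verts = carrier G, arcs = carrier G \<times> X, tail = fst, head = (\<lambda>(g, x). g \<otimes>\<^bsub>G\<^esub> x)\<rparr>"

definition edge_rev :: "('a, 'b) monoid_scheme \<Rightarrow> 'a \<times> 'a \<Rightarrow> 'a \<times> 'a" where
  "edge_rev G e = (case e of (g, x) \<Rightarrow> (g \<otimes>\<^bsub>G\<^esub> x, inv\<^bsub>G\<^esub> x))"

definition without_backtracking :: "('a, 'b) monoid_scheme \<Rightarrow> ('a \<times> 'a) list \<Rightarrow> bool" where
  "without_backtracking G p \<longleftrightarrow> successively (\<lambda>e e'. e' \<noteq> edge_rev G e) p"

text \<open>An undirected subgraph is encoded as a subgraph of the digraph \<^const>\<open>cayley_graph\<close> whose set
  of arcs is closed under reversal; the undirected edge underlying \<open>e\<close> lies in it iff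
  \<open>e\<close> is one of its arcs. The library's \<^term>\<open>spanning_tree\<close> is not suitable: it only
  excludes directed cycles, but these include every edge followed by its reverse. A circuit of
  the undirected graph is a directed cycle without backtracking.\<close>

definition maximal_tree ::
  "('a, 'b) monoid_scheme \<Rightarrow> 'a set \<Rightarrow> ('a, 'a \<times> 'a) pre_digraph \<Rightarrow> bool" where
  "maximal_tree G X T \<longleftrightarrow>
     spanning T (cayley_graph G X) \<and>
     (\<forall>e\<in>arcs T. edge_rev G e \<in> arcs T) \<and>
     Digraph_Component.connected T \<and>
     \<not> (\<exists>p. pre_digraph.cycle T p \<and> without_backtracking G p)"

definition flow_less :: "('a, 'b) monoid_scheme \<Rightarrow> 'a set \<Rightarrow> ('a, 'a \<times> 'a) pre_digraph \<Rightarrow>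
    ('a \<times> 'a \<Rightarrow> ('a \<times> 'a) list) \<Rightarrow> (('a \<times> 'a) \<times> ('a \<times> 'a)) set" where
  "flow_less G X T \<Phi> =
     {(e', e). e \<in> arcs (cayley_graph G X) \<and> e' \<in> set (\<Phi> e) \<and> e \<notin> arcs T \<and> e' \<notin> arcs T}"

definition flow_function :: "('a, 'b) monoid_scheme \<Rightarrow> 'a set \<Rightarrow> ('a, 'a \<times> 'a) pre_digraph \<Rightarrow>
    ('a \<times> 'a \<Rightarrow> ('a \<times> 'a) list) \<Rightarrow> bool" where
  "flow_function G X T \<Phi> \<longleftrightarrow>
     (\<forall>e\<in>arcs (cayley_graph G X).
        pre_digraph.awalk (cayley_graph G X)
          (tail (cayley_graph G X) e) (\<Phi> e) (head (cayley_graph G X) e)) \<and>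
     (\<forall>e\<in>arcs T. \<Phi> e = [e]) \<and>
     (let R = (flow_less G X T \<Phi>)\<^sup>+ in wf R \<and> irrefl R \<and> trans R)"

definition bounded_flow :: "('a, 'b) monoid_scheme \<Rightarrow> 'a set \<Rightarrow>
    ('a \<times> 'a \<Rightarrow> ('a \<times> 'a) list) \<Rightarrow> bool" where
  "bounded_flow G X \<Phi> \<longleftrightarrow> (\<exists>k. \<forall>e\<in>arcs (cayley_graph G X). length (\<Phi> e) \<le> k)"

abbreviation path_label :: "('a \<times> 'a) list \<Rightarrow> 'a list" where
  "path_label \<equiv> map snd"

definition nf :: "('a, 'b) monoid_scheme \<Rightarrow> ('a, 'a \<times> 'a) pre_digraph \<Rightarrow> 'a \<Rightarrow> 'a list" where
  "nf G T g =
     path_label (THE p. pre_digraph.awalk T \<one>\<^bsub>G\<^esub> p g \<and> without_backtracking G p)"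

text \<open>Only the values at normal forms \<open>w\<close> are relevant; there \<^term>\<open>inv_into (carrier G) (nf G T) w\<close>
  is the group element with normal form \<open>w\<close>.\<close>

definition stacking_map :: "('a, 'b) monoid_scheme \<Rightarrow> ('a, 'a \<times> 'a) pre_digraph \<Rightarrow>
    ('a \<times> 'a \<Rightarrow> ('a \<times> 'a) list) \<Rightarrow> 'a list \<Rightarrow> 'a \<Rightarrow> 'a list" where
  "stacking_map G T \<Phi> w x = path_label (\<Phi> (inv_into (carrier G) (nf G T) w, x))"

text \<open>An \<open>n\<close>-tuple of words is encoded as a list of words of length \<open>n\<close>.\<close>

definition stacking_graph :: "('a, 'b) monoid_scheme \<Rightarrow> 'a set \<Rightarrow> ('a, 'a \<times> 'a) pre_digraph \<Rightarrow>
    ('a \<times> 'a \<Rightarrow> ('a \<times> 'a) list) \<Rightarrow> 'a list list set" where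
  "stacking_graph G X T \<Phi> =
     {[nf G T g, [x], stacking_map G T \<Phi> (nf G T g) x] | g x. g \<in> carrier G \<and> x \<in> X}"

definition word_tuples :: "'a set \<Rightarrow> nat \<Rightarrow> 'a list list set" where
  "word_tuples X n = {ws. length ws = n \<and> set ws \<subseteq> lists X}"


section \<open>Synchronously regular sets\<close>

text \<open>Acceptance by a complete deterministic finite automaton with input alphabet \<open>A\<close>.\<close>

definition regular_language :: "'c set \<Rightarrow> 'c list set \<Rightarrow> bool" where
  "regular_language A L \<longleftrightarrow>
     (\<exists>(Q :: nat set) \<delta> q0 F. finite Q \<and> q0 \<in> Q \<and> F \<subseteq> Q \<and> (\<forall>q\<in>Q. \<forall>c\<in>A. \<delta> q c \<in> Q) \<and>
        L = {w \<in> lists A. foldl \<delta> q0 w \<in> F})"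

text \<open>The padding letter is \<^const>\<open>None\<close>.\<close>

definition pad :: "'a list list \<Rightarrow> 'a option list list" where
  "pad ws = map (\<lambda>i. map (\<lambda>w. if i < length w then Some (w ! i) else None) ws)
              [0..<Max (insert 0 (length ` set ws))]"

definition padded_alphabet :: "'a set \<Rightarrow> nat \<Rightarrow> 'a option list set" where
  "padded_alphabet X n = {c. length c = n \<and> set c \<subseteq> insert None (Some ` X)}"

definition synchronously_regular :: "'a set \<Rightarrow> nat \<Rightarrow> 'a list list set \<Rightarrow> bool" where
  "synchronously_regular X n L \<longleftrightarrow>
     L \<subseteq> word_tuples X n \<and> regular_language (padded_alphabet X n) (pad ` L)"


section \<open>Decidable sets\<close>

text \<open>The total recursive functions of \<open>n\<close> arguments in the sense of Goedel and Kleene: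
  minimisation is only applied to functions that always have a zero. The value
  on a list of length other than \<open>n\<close> is irrelevant.\<close>

inductive recursive_function :: "nat \<Rightarrow> (nat list \<Rightarrow> nat) \<Rightarrow> bool" where
  zero: "recursive_function n (\<lambda>xs. 0)"
| succ: "recursive_function 1 (\<lambda>xs. Suc (xs ! 0))"
| proj: "i < n \<Longrightarrow> recursive_function n (\<lambda>xs. xs ! i)"
| comp: "recursive_function m f \<Longrightarrow> length gs = m \<Longrightarrow> (\<forall>g\<in>set gs. recursive_function n g) \<Longrightarrow>
    recursive_function n (\<lambda>xs. f (map (\<lambda>g. g xs) gs))"
| prim_rec: "recursive_function n f \<Longrightarrow> recursive_function (Suc (Suc n)) g \<Longrightarrow>
    recursive_function (Suc n) (\<lambda>xs. rec_nat (f (tl xs)) (\<lambda>k r. g (k # r # tl xs)) (hd xs))"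
| minim: "recursive_function (Suc n) f \<Longrightarrow> (\<forall>xs. length xs = n \<longrightarrow> (\<exists>y. f (y # xs) = 0)) \<Longrightarrow>
    recursive_function n (\<lambda>xs. LEAST y. f (y # xs) = 0)"

text \<open>Words are coded by numbers via a numbering \<open>c\<close> of the alphabet. For finite \<open>X\<close> the choice
  of \<open>c\<close> does not matter.\<close>

definition decidable_tuples :: "'a set \<Rightarrow> nat \<Rightarrow> 'a list list set \<Rightarrow> bool" where
  "decidable_tuples X n L \<longleftrightarrow>
     L \<subseteq> word_tuples X n \<and>
     (\<exists>(c :: 'a \<Rightarrow> nat) \<chi>. inj_on c X \<and> recursive_function n \<chi> \<and>
        (\<forall>ws\<in>word_tuples X n.
           \<chi> (map (\<lambda>w. list_encode (map c w)) ws) = (if ws \<in> L then 1 else 0)))"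


section \<open>Algorithmically stackable and autostackable groups\<close>

definition algorithmically_stackable_over :: "('a, 'b) monoid_scheme \<Rightarrow> 'a set \<Rightarrow> bool" where
  "algorithmically_stackable_over G X \<longleftrightarrow>
     (\<exists>T \<Phi>. maximal_tree G X T \<and> flow_function G X T \<Phi> \<and> bounded_flow G X \<Phi> \<and>
        decidable_tuples X 3 (stacking_graph G X T \<Phi>))"

definition autostackable_over :: "('a, 'b) monoid_scheme \<Rightarrow> 'a set \<Rightarrow> bool" where
  "autostackable_over G X \<longleftrightarrow>
     (\<exists>T \<Phi>. maximal_tree G X T \<and> flow_function G X T \<Phi> \<and> bounded_flow G X \<Phi> \<and>
        synchronously_regular X 3 (stacking_graph G X T \<Phi>))"

definition algorithmically_stackable :: "('a, 'b) monoid_scheme \<Rightarrow> bool" where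
  "algorithmically_stackable G \<longleftrightarrow>
     (\<exists>X. inverse_closed_gens G X \<and> algorithmically_stackable_over G X)"

definition autostackable :: "('a, 'b) monoid_scheme \<Rightarrow> bool" where
  "autostackable G \<longleftrightarrow> (\<exists>X. inverse_closed_gens G X \<and> autostackable_over G X)"


section \<open>Groups given by presentations\<close>

text \<open>The letter \<open>(x, True)\<close> is the generator \<open>x\<close> and \<open>(x, False)\<close> its formal inverse. The
  generators are all elements of the type, and a relation \<open>l = r\<close> is the pair \<open>(l, r)\<close>.\<close>

type_synonym 'g gword = "('g \<times> bool) list"

inductive pres_eq :: "('g gword \<times> 'g gword) set \<Rightarrow> 'g gword \<Rightarrow> 'g gword \<Rightarrow> bool"
  for R :: "('g gword \<times> 'g gword) set" where
  refl: "pres_eq R u u"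
| sym: "pres_eq R u v \<Longrightarrow> pres_eq R v u"
| trans: "pres_eq R u v \<Longrightarrow> pres_eq R v w \<Longrightarrow> pres_eq R u w"
| cancel: "pres_eq R (u @ [(x, b), (x, \<not> b)] @ v) (u @ v)"
| rel: "(l, r) \<in> R \<Longrightarrow> pres_eq R (u @ l @ v) (u @ r @ v)"

definition pres_class :: "('g gword \<times> 'g gword) set \<Rightarrow> 'g gword \<Rightarrow> 'g gword set" where
  "pres_class R u = {v. pres_eq R u v}"

definition presented_group :: "('g gword \<times> 'g gword) set \<Rightarrow> 'g gword set monoid" where
  "presented_group R =
     \<lparr>carrier = range (pres_class R),
      monoid.mult = (\<lambda>A B. \<Union>u\<in>A. \<Union>v\<in>B. pres_class R (u @ v)),
      monoid.one = pres_class R []\<rparr>"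

definition gword_inv :: "'g gword \<Rightarrow> 'g gword" where
  "gword_inv w = rev (map (\<lambda>(x, b). (x, \<not> b)) w)"

text \<open>The conjugate \<open>g\<^sup>h = h g h\<^sup>-\<^sup>1\<close>.\<close>

definition gword_conj :: "'g gword \<Rightarrow> 'g gword \<Rightarrow> 'g gword" where
  "gword_conj g h = h @ g @ gword_inv h"

definition gword_comm :: "'g gword \<Rightarrow> 'g gword \<Rightarrow> 'g gword" where
  "gword_comm g h = g @ h @ gword_inv g @ gword_inv h"

lemma pres_eq_append_left: "pres_eq R u v \<Longrightarrow> pres_eq R (w @ u) (w @ v)"
proof (induction rule: pres_eq.induct)
  case (cancel u x b v)
  then show ?case using pres_eq.cancel[of R "w @ u" x b v] by simp
next
  case (rel l r u v)
  then show ?case using pres_eq.rel[of l r R "w @ u" v] by simp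
qed (blast intro: pres_eq.intros)+

lemma pres_eq_append_right: "pres_eq R u v \<Longrightarrow> pres_eq R (u @ w) (v @ w)"
proof (induction rule: pres_eq.induct)
  case (cancel u x b v)
  then show ?case using pres_eq.cancel[of R u x b "v @ w"] by simp
next
  case (rel l r u v)
  then show ?case using pres_eq.rel[of l r R u "v @ w"] by simp
qed (blast intro: pres_eq.intros)+

lemma pres_class_eq_iff: "pres_class R u = pres_class R v \<longleftrightarrow> pres_eq R u v"
  by (auto simp: pres_class_def set_eq_iff intro: pres_eq.refl pres_eq.sym pres_eq.trans)

lemma presented_group_mult:
  "pres_class R u \<otimes>\<^bsub>presented_group R\<^esub> pres_class R v = pres_class R (u @ v)"
proof -
  have "pres_class R (u' @ v') = pres_class R (u @ v)"
    if "u' \<in> pres_class R u" "v' \<in> pres_class R v" for u' v'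
  proof -
    have "pres_eq R (u @ v) (u' @ v)" "pres_eq R (u' @ v) (u' @ v')"
      using that
      by (simp_all add: pres_class_def pres_eq_append_left pres_eq_append_right)
    then show ?thesis
      unfolding pres_class_eq_iff by (rule pres_eq.sym[OF pres_eq.trans])
  qed
  moreover have "u \<in> pres_class R u" "v \<in> pres_class R v"
    by (auto simp: pres_class_def intro: pres_eq.refl)
  ultimately have "(\<Union>u'\<in>pres_class R u. \<Union>v'\<in>pres_class R v. pres_class R (u' @ v')) =
      pres_class R (u @ v)"
    by blast
  then show ?thesis
    by (simp add: presented_group_def)
qed

lemma pres_eq_inv_left: "pres_eq R (gword_inv w @ w) []"
proof (induction w)
  case Nil
  then show ?case by (simp add: gword_inv_def pres_eq.refl)
next
  case (Cons p w)
  obtain x b where p: "p = (x, b)" by (cases p)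
  have "pres_eq R (gword_inv (p # w) @ p # w) (gword_inv w @ w)"
    using pres_eq.cancel[of R "gword_inv w" x "\<not> b" w] by (simp add: p gword_inv_def)
  then show ?case using Cons pres_eq.trans by blast
qed

lemma group_presented_group: "group (presented_group R)"
proof (rule groupI)
  show "\<one>\<^bsub>presented_group R\<^esub> \<in> carrier (presented_group R)"
    by (simp add: presented_group_def)
next
  fix A B assume "A \<in> carrier (presented_group R)" "B \<in> carrier (presented_group R)"
  then obtain u v where "A = pres_class R u" "B = pres_class R v"
    by (auto simp: presented_group_def)
  then show "A \<otimes>\<^bsub>presented_group R\<^esub> B \<in> carrier (presented_group R)"
    by (simp only: presented_group_mult) (simp add: presented_group_def)
next
  fix A B C assume "A \<in> carrier (presented_group R)" "B \<in> carrier (presented_group R)"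
    "C \<in> carrier (presented_group R)"
  then obtain u v w where "A = pres_class R u" "B = pres_class R v" "C = pres_class R w"
    by (auto simp: presented_group_def)
  then show "A \<otimes>\<^bsub>presented_group R\<^esub> B \<otimes>\<^bsub>presented_group R\<^esub> C =
    A \<otimes>\<^bsub>presented_group R\<^esub> (B \<otimes>\<^bsub>presented_group R\<^esub> C)"
    by (simp add: presented_group_mult)
next
  fix A assume "A \<in> carrier (presented_group R)"
  then obtain u where A: "A = pres_class R u" by (auto simp: presented_group_def)
  have one: "\<one>\<^bsub>presented_group R\<^esub> = pres_class R []" by (simp add: presented_group_def)
  show "\<one>\<^bsub>presented_group R\<^esub> \<otimes>\<^bsub>presented_group R\<^esub> A = A"
    unfolding one A presented_group_mult by simp
  have "pres_class R (gword_inv u) \<in> carrier (presented_group R)"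
    by (simp add: presented_group_def)
  moreover have "pres_class R (gword_inv u) \<otimes>\<^bsub>presented_group R\<^esub> A = \<one>\<^bsub>presented_group R\<^esub>"
    unfolding one A presented_group_mult pres_class_eq_iff by (rule pres_eq_inv_left)
  ultimately show "\<exists>B\<in>carrier (presented_group R).
      B \<otimes>\<^bsub>presented_group R\<^esub> A = \<one>\<^bsub>presented_group R\<^esub>"
    by blast
qed


section \<open>Baumslag's metabelian group and its torsion analogs\<close>

datatype gen = gen_a | gen_s | gen_t

definition baumslag_relations :: "(gen gword \<times> gen gword) set" where
  "baumslag_relations =
    (let a = [(gen_a, True)]; s = [(gen_s, True)]; t = [(gen_t, True)]
     in {(gword_conj a s, gword_conj a t @ a),
         (gword_comm (gword_conj a t) a, []),
         (gword_comm s t, [])})"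

definition baumslag_group :: "gen gword set monoid" where
  "baumslag_group = presented_group baumslag_relations"

definition diestel_leader_group :: "nat \<Rightarrow> gen gword set monoid" where
  "diestel_leader_group p =
     presented_group (insert (replicate p (gen_a, True), []) baumslag_relations)"

end

theory Submission
  imports Defs
begin

text \<open>Both groups act on triples \<open>(f, i, j)\<close>, where \<open>f\<close> is the expansion at infinity of an element of
  \<open>\<int>\<^sub>p[x, x\<^sup>-\<^sup>1, (1 + x)\<^sup>-\<^sup>1]\<close> (with \<open>p = 0\<close> for Baumslag's group): \<open>a\<close> adds the monomial
  \<open>x\<^sup>i (1 + x)\<^sup>j\<close> to \<open>f\<close>, and \<open>t\<close>, \<open>s\<close> increase \<open>i\<close>, \<open>j\<close>. With the further generator \<open>u = t\<^sup>-\<^sup>1 s\<close>,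
  the normal form of \<open>f\<close> peels off leading terms, first at the pole \<open>x = -1\<close> and then at
  infinity, and within a plane of constant \<open>f\<close> it follows straight lines.

  The relation \<open>x\<^sup>i (1 + x)\<^sup>j + x\<^sup>i\<^sup>+\<^sup>1 (1 + x)\<^sup>j = x\<^sup>i (1 + x)\<^sup>j\<^sup>+\<^sup>1\<close> turns the edges labelled by powers of \<open>a\<close> at
  three neighbouring positions into a triangle, and the flow pushes each such edge across one
  triangle. An edge that keeps the leading coefficient of \<open>f\<close> moves towards positions where it
  changes this coefficient; an edge that changes it moves towards the position used by the normal
  form. The third side of the triangle can be chosen such that it only meets leading coefficients of
  smaller norm, or moves to the next column, so the process terminates. Which triangle to use
  depends on a bounded amount of information that a finite automaton extracts from the normal form.
  This gives a regular stacking for all \<open>p\<close>, and decidability follows from regularity.\<close>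

text \<open>The action is never shown to be faithful, so no solution of the word problem precedes
  the stacking. It only attaches a state to each group element, while the identities behind the flow
  labels are checked in the presentation. This suffices. The state of an element names the last
  letter of its normal form, so two normal forms of one element can be compared from the end; and as
  a label consists of tree edges and smaller edges, termination of the flow already shows that the
  tree spans. The letter \<open>u\<close> fixes \<open>i + j\<close>, the degree of the monomial at
  \<open>(i, j)\<close>, and so preserves the sign of \<open>i + j - fdeg f\<close>, which decides
  whether an edge labelled by a power of \<open>a\<close> meets the leading term at infinity. Along
  powers of \<open>s\<close> this sign would depend on an unbounded counter. Powers of the inverse
  of \<open>s\<close> fix the column \<open>i\<close>, which must equal \<open>fdeg f\<close> where
  the normal form creates a pole. In the column \<open>i = fdeg f\<close> a monomial with
  \<open>j < 0\<close> has degree below \<open>fdeg f\<close>. Hence a pole is added or removed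
  there without moving that column, which is why poles are peeled off before the terms at
  infinity.\<close>

primrec edge_path :: "('a, 'b) monoid_scheme \<Rightarrow> 'a \<Rightarrow> 'a list \<Rightarrow> ('a \<times> 'a) list" where
  "edge_path G g [] = []"
| "edge_path G g (x # w) = (g, x) # edge_path G (g \<otimes>\<^bsub>G\<^esub> x) w"

lemma path_label_edge_path [simp]: "path_label (edge_path G g w) = w"
  by (induction w arbitrary: g) auto

lemma length_edge_path [simp]: "length (edge_path G g w) = length w"
  by (induction w arbitrary: g) auto

lemma edge_path_append:
  "edge_path G g (v @ w) = edge_path G g v @ edge_path G (foldl (\<otimes>\<^bsub>G\<^esub>) g v) w"
  by (induction v arbitrary: g) auto

text \<open>These are the words of a partial automaton all of whose states accept.
  \<open>child s x\<close> is meant to say that a vertex of state \<open>s\<close> has a tree edge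
  labelled \<open>x\<close> leading away from the root; \<open>step s x\<close> is then the state of
  its other end.\<close>

primrec admissible :: "'x set \<Rightarrow> ('s \<Rightarrow> 'x \<Rightarrow> bool) \<Rightarrow> ('s \<Rightarrow> 'x \<Rightarrow> 's) \<Rightarrow> 's \<Rightarrow> 'x list \<Rightarrow> bool" where
  "admissible X child step s [] \<longleftrightarrow> True"
| "admissible X child step s (x # w) \<longleftrightarrow>
     x \<in> X \<and> child s x \<and> admissible X child step (step s x) w"

lemma admissible_append:
  "admissible X child step s (v @ w) \<longleftrightarrow>
     admissible X child step s v \<and> admissible X child step (foldl step s v) w"
  by (induction v arbitrary: s) auto

lemma admissible_lists: "admissible X child step s w \<Longrightarrow> w \<in> lists X"
  by (induction w arbitrary: s) auto

lemma admissible_foldl_in: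
  assumes "admissible X child step s w" "s \<in> S"
    and "\<And>s x. s \<in> S \<Longrightarrow> x \<in> X \<Longrightarrow> child s x \<Longrightarrow> step s x \<in> S"
  shows "foldl step s w \<in> S"
  using assms(1,2) by (induction w arbitrary: s) (auto intro: assms(3))

section \<open>Regularity of the graph of a finite-state map\<close>

text \<open>\<open>regular_language\<close> insists on natural numbers as states; numbering a finite
  set transports an automaton with states of any type.\<close>

lemma regular_languageI:
  assumes Q: "finite Q" "q0 \<in> Q" "F \<subseteq> Q" "\<And>q c. q \<in> Q \<Longrightarrow> c \<in> A \<Longrightarrow> \<delta> q c \<in> Q"
  shows "regular_language A {w \<in> lists A. foldl \<delta> q0 w \<in> F}"
proof -
  obtain f :: "'a \<Rightarrow> nat" where f: "inj_on f Q"
    using finite_imp_inj_to_nat_seg[OF Q(1)] by auto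
  define \<delta>' where "\<delta>' n c = f (\<delta> (inv_into Q f n) c)" for n c
  have run: "foldl \<delta>' (f q) w = f (foldl \<delta> q w) \<and> foldl \<delta> q w \<in> Q" if "q \<in> Q" "w \<in> lists A" for q w
    using that
  proof (induction w arbitrary: q)
    case (Cons c w)
    have "\<delta>' (f q) c = f (\<delta> q c)" using f Cons.prems by (simp add: \<delta>'_def)
    then show ?case using Cons Q(4) by simp
  qed simp
  have "foldl \<delta> q0 w \<in> F \<longleftrightarrow> foldl \<delta>' (f q0) w \<in> f ` F" if "w \<in> lists A" for w
    using run[OF Q(2) that] inj_on_image_mem_iff[OF f _ Q(3)] by simp
  then have "{w \<in> lists A. foldl \<delta> q0 w \<in> F} = {w \<in> lists A. foldl \<delta>' (f q0) w \<in> f ` F}"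
    by auto
  moreover have "finite (f ` Q)" "f q0 \<in> f ` Q" "f ` F \<subseteq> f ` Q"
    "\<forall>q\<in>f ` Q. \<forall>c\<in>A. \<delta>' q c \<in> f ` Q"
    using Q f by (auto simp: \<delta>'_def)
  ultimately show ?thesis unfolding regular_language_def by blast
qed

lemma regular_language_empty: "regular_language A {}"
  using regular_languageI[of "{0 :: nat}" 0 "{}" A "\<lambda>_ _. 0"] by simp

lemma regular_language_Un:
  assumes "regular_language A K" "regular_language A L"
  shows "regular_language A (K \<union> L)"
proof -
  obtain Q \<delta> q0 F where K: "finite (Q :: nat set)" "q0 \<in> Q" "F \<subseteq> Q" "\<forall>q\<in>Q. \<forall>c\<in>A. \<delta> q c \<in> Q"
      "K = {w \<in> lists A. foldl \<delta> q0 w \<in> F}"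
    using assms(1) unfolding regular_language_def by blast
  obtain Q' \<delta>' q0' F' where L: "finite (Q' :: nat set)" "q0' \<in> Q'" "F' \<subseteq> Q'"
      "\<forall>q\<in>Q'. \<forall>c\<in>A. \<delta>' q c \<in> Q'" "L = {w \<in> lists A. foldl \<delta>' q0' w \<in> F'}"
    using assms(2) unfolding regular_language_def by blast
  define d where "d p c = (\<delta> (fst p) c, \<delta>' (snd p) c)" for p c
  have run: "foldl d (q, q') w = (foldl \<delta> q w, foldl \<delta>' q' w)" for q q' w
    by (induction w arbitrary: q q') (auto simp: d_def)
  have "foldl \<delta> q w \<in> Q" if "q \<in> Q" "w \<in> lists A" for q w
    using that K(4) by (induction w arbitrary: q) auto
  moreover have "foldl \<delta>' q w \<in> Q'" if "q \<in> Q'" "w \<in> lists A" for q w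
    using that L(4) by (induction w arbitrary: q) auto
  ultimately have "K \<union> L = {w \<in> lists A. foldl d (q0, q0') w \<in> F \<times> Q' \<union> Q \<times> F'}"
    using K(2,5) L(2,5) by (auto simp: run)
  moreover have "regular_language A {w \<in> lists A. foldl d (q0, q0') w \<in> F \<times> Q' \<union> Q \<times> F'}"
    using K(1-4) L(1-4) by (intro regular_languageI[of "Q \<times> Q'"]) (auto simp: d_def)
  ultimately show ?thesis by simp
qed

lemma regular_language_UN:
  assumes "finite I" "\<And>i. i \<in> I \<Longrightarrow> regular_language A (L i)"
  shows "regular_language A (\<Union>i\<in>I. L i)"
  using assms by (induction I) (auto simp: regular_language_empty regular_language_Un)

section \<open>Automata for padded triples with two fixed components\<close>

definition letter_at :: "'a list \<Rightarrow> nat \<Rightarrow> 'a option" where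
  "letter_at w i = (if i < length w then Some (w ! i) else None)"

lemma letter_at_append:
  "letter_at (w @ [x]) i = (if i < length w then letter_at w i else if i = length w then Some x else None)"
  by (auto simp: letter_at_def nth_append)

lemma pad_triple:
  "pad [w, u, v] = map (\<lambda>i. [letter_at w i, letter_at u i, letter_at v i])
     [0..<max (length w) (max (length u) (length v))]"
proof -
  have "Max (insert 0 (length ` set [w, u, v])) = max (length w) (max (length u) (length v))"
    by (simp add: max_def)
  then show ?thesis by (simp only: pad_def) (simp add: letter_at_def)
qed

text \<open>The automaton reads the padded word of a triple whose second and third components are fixed
  words \<open>u\<close>, \<open>v\<close>. It remembers the state of the automaton reading the first component, whether
  that component has ended, and its position up to the maximum \<open>K\<close> of the lengths of \<open>u\<close> and \<open>v\<close>.\<close>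

fun triple_step :: "'x set \<Rightarrow> ('s \<Rightarrow> 'x \<Rightarrow> bool) \<Rightarrow> ('s \<Rightarrow> 'x \<Rightarrow> 's) \<Rightarrow> nat \<Rightarrow> 'x list \<Rightarrow> 'x list \<Rightarrow>
    ('s \<times> bool \<times> nat) option \<Rightarrow> 'x option list \<Rightarrow> ('s \<times> bool \<times> nat) option" where
  "triple_step X child step K u v (Some (s, e, i)) [c, d, d'] =
     (if d = letter_at u i \<and> d' = letter_at v i then
        (case c of
           Some x \<Rightarrow> if \<not> e \<and> x \<in> X \<and> child s x then Some (step s x, False, min K (Suc i)) else None
         | None \<Rightarrow> if i < K then Some (s, True, Suc i) else None)
      else None)"
| "triple_step X child step K u v _ _ = None"

text \<open>Invariant of the run: \<open>w\<close> is the part of the first component read so far.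
  The bound \<open>length W \<le> K\<close> once \<open>w\<close> has ended excludes rows made of
  padding only, which no padded word contains.\<close>

lemma foldl_triple_step:
  assumes K: "K = max (length u) (length v)"
  shows "foldl (triple_step X child step K u v) (Some (s0, False, 0)) W = Some (s, e, i) \<longleftrightarrow>
    (\<exists>w. admissible X child step s0 w \<and> s = foldl step s0 w \<and> e = (length w < length W) \<and>
       i = min K (length W) \<and> length w \<le> length W \<and> (length w < length W \<longrightarrow> length W \<le> K) \<and>
       W = map (\<lambda>i. [letter_at w i, letter_at u i, letter_at v i]) [0..<length W])"
proof (induction W arbitrary: s e i rule: rev_induct)
  case Nil
  then show ?case by (auto intro: exI[of _ "[]"])
next
  case (snoc c W)
  let ?t = "triple_step X child step K u v"
  let ?r = "foldl ?t (Some (s0, False, 0)) W"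
  let ?n = "length W"
  let ?row = "\<lambda>w i. [letter_at w i, letter_at u i, letter_at v i]"
  \<comment> \<open>The counter stops at \<open>K\<close>, where \<open>u\<close> and
    \<open>v\<close> have both ended, so stopping does not change the letters that it
    expects.\<close>
  have beyond: "letter_at u (min K ?n) = letter_at u ?n" "letter_at v (min K ?n) = letter_at v ?n"
    by (auto simp: letter_at_def K)
  show ?case
  proof
    assume "foldl ?t (Some (s0, False, 0)) (W @ [c]) = Some (s, e, i)"
    then have step: "?t ?r c = Some (s, e, i)" by simp
    then obtain s' e' i' d1 d2 d3 where r: "?r = Some (s', e', i')" and c: "c = [d1, d2, d3]"
      by (cases "(X, child, step, K, u, v, ?r, c)" rule: triple_step.cases) auto
    obtain w where w: "admissible X child step s0 w" "s' = foldl step s0 w" "e' = (length w < ?n)"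
        "i' = min K ?n" "length w \<le> ?n" "length w < ?n \<longrightarrow> ?n \<le> K" "W = map (?row w) [0..<?n]"
      using snoc.IH[of s' e' i'] r by blast
    have d: "d2 = letter_at u ?n" "d3 = letter_at v ?n"
      using step r c w(4) beyond by (auto split: if_splits)
    show "\<exists>w. admissible X child step s0 w \<and> s = foldl step s0 w \<and> e = (length w < length (W @ [c])) \<and>
       i = min K (length (W @ [c])) \<and> length w \<le> length (W @ [c]) \<and>
       (length w < length (W @ [c]) \<longrightarrow> length (W @ [c]) \<le> K) \<and>
       W @ [c] = map (?row w) [0..<length (W @ [c])]"
    proof (cases d1)
      case None
      have "i' < K" "s = s'" "e" "i = Suc i'" using step r c None by (auto split: if_splits)
      moreover have "letter_at w ?n = None" using w(5) by (simp add: letter_at_def)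
      ultimately show ?thesis
        using w c d None by (intro exI[of _ w]) auto
    next
      case (Some x)
      have x: "\<not> e'" "x \<in> X" "child s' x" "s = step s' x" "\<not> e" "i = min K (Suc i')"
        using step r c Some by (auto split: if_splits)
      then have len: "length w = ?n" using w by simp
      have "map (?row (w @ [x])) [0..<?n] = map (?row w) [0..<?n]"
        using len by (auto simp: letter_at_append)
      then show ?thesis
        using w c d x len Some
        by (intro exI[of _ "w @ [x]"]) (auto simp: admissible_append letter_at_append)
    qed
  next
    assume "\<exists>w. admissible X child step s0 w \<and> s = foldl step s0 w \<and> e = (length w < length (W @ [c])) \<and>
       i = min K (length (W @ [c])) \<and> length w \<le> length (W @ [c]) \<and>
       (length w < length (W @ [c]) \<longrightarrow> length (W @ [c]) \<le> K) \<and>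
       W @ [c] = map (?row w) [0..<length (W @ [c])]"
    then obtain w where w: "admissible X child step s0 w" "s = foldl step s0 w" "e = (length w < Suc ?n)"
        "i = min K (Suc ?n)" "length w \<le> Suc ?n" "length w < Suc ?n \<longrightarrow> Suc ?n \<le> K"
        "W = map (?row w) [0..<?n]" "c = ?row w ?n"
      by auto
    show "foldl ?t (Some (s0, False, 0)) (W @ [c]) = Some (s, e, i)"
    proof (cases "length w = Suc ?n")
      case True
      then obtain w' x where w': "w = w' @ [x]" "length w' = ?n"
        by (metis length_Suc_conv_rev)
      have eq: "map (?row w) [0..<?n] = map (?row w') [0..<?n]"
        using w' by (auto simp: letter_at_append)
      have "W = map (?row w') [0..<?n]" by (rule HOL.trans[OF w(7) eq])
      moreover have "admissible X child step s0 w'" using w(1) w' by (simp add: admissible_append)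
      ultimately have "?r = Some (foldl step s0 w', False, min K ?n)"
        using w' unfolding snoc.IH by (intro exI[of _ w'] conjI) auto
      then show ?thesis
        using w w' beyond by (auto simp: admissible_append letter_at_append)
    next
      case False
      then have len: "length w \<le> ?n" "Suc ?n \<le> K" using w by auto
      then have "?r = Some (s, length w < ?n, ?n)"
        using w by (subst snoc.IH) (intro exI[of _ w], auto)
      then show ?thesis
        using w len by (auto simp: letter_at_def)
    qed
  qed
qed

lemma regular_language_pad_triple:
  assumes S: "finite S" "s0 \<in> S" "\<And>s x. s \<in> S \<Longrightarrow> x \<in> X \<Longrightarrow> child s x \<Longrightarrow> step s x \<in> S"
    and uv: "u \<in> lists X" "v \<in> lists X"
  shows "regular_language (padded_alphabet X 3)
    {pad [w, u, v] | w. admissible X child step s0 w \<and> foldl step s0 w \<in> F}"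
proof -
  define K where "K = max (length u) (length v)"
  let ?t = "triple_step X child step K u v"
  let ?Q = "insert None (Some ` (S \<times> UNIV \<times> {..K}))"
  \<comment> \<open>The final counter value \<open>K\<close> ensures that \<open>u\<close> and
    \<open>v\<close> have been read completely.\<close>
  let ?F = "Some ` ((F \<inter> S) \<times> UNIV \<times> {K})"
  let ?A = "padded_alphabet X 3"
  have letter: "letter_at w i \<in> insert None (Some ` X)" if "w \<in> lists X" for w i
    using that nth_mem by (fastforce simp: letter_at_def lists_eq_set)
  have row: "[letter_at w i, letter_at u i, letter_at v i] \<in> ?A" if "w \<in> lists X" for w i
    using letter[OF that] letter[OF uv(1)] letter[OF uv(2)] by (simp add: padded_alphabet_def)
  have "?t q c \<in> ?Q" if "q \<in> ?Q" for q c
  proof (cases "?t q c")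
    case (Some r)
    then obtain s e i d1 d2 d3 where "q = Some (s, e, i)" "c = [d1, d2, d3]"
      by (cases "(X, child, step, K, u, v, q, c)" rule: triple_step.cases) auto
    then show ?thesis using that S(3) Some by (auto split: if_splits option.splits)
  qed simp
  then have "regular_language ?A {W \<in> lists ?A. foldl ?t (Some (s0, False, 0)) W \<in> ?F}"
    using S by (intro regular_languageI[of ?Q]) auto
  moreover have "{W \<in> lists ?A. foldl ?t (Some (s0, False, 0)) W \<in> ?F} =
      {pad [w, u, v] | w. admissible X child step s0 w \<and> foldl step s0 w \<in> F}"
  proof (intro equalityI subsetI)
    fix W assume W: "W \<in> {W \<in> lists ?A. foldl ?t (Some (s0, False, 0)) W \<in> ?F}"
    then obtain s e where s: "s \<in> F" "foldl ?t (Some (s0, False, 0)) W = Some (s, e, K)" by auto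
    then obtain w where w: "admissible X child step s0 w" "s = foldl step s0 w" 
        "K = min K (length W)" "length w \<le> length W" "length w < length W \<longrightarrow> length W \<le> K"
        "W = map (\<lambda>i. [letter_at w i, letter_at u i, letter_at v i]) [0..<length W]"
      using foldl_triple_step[OF K_def, of X child step s0 W s e K] by blast
    have "length W = max (length w) K" using w(3-5) by (auto simp: max_def min_def split: if_splits)
    then have "W = pad [w, u, v]" using w(6) by (simp add: pad_triple K_def)
    then show "W \<in> {pad [w, u, v] | w. admissible X child step s0 w \<and> foldl step s0 w \<in> F}"
      using w s by blast
  next
    fix W assume "W \<in> {pad [w, u, v] | w. admissible X child step s0 w \<and> foldl step s0 w \<in> F}"
    then obtain w where w: "W = pad [w, u, v]" "admissible X child step s0 w" "foldl step s0 w \<in> F" by auto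
    have W: "W = map (\<lambda>i. [letter_at w i, letter_at u i, letter_at v i]) [0..<length W]"
      "length W = max (length w) K"
      using w(1) by (auto simp: pad_triple K_def)
    have "foldl ?t (Some (s0, False, 0)) W = Some (foldl step s0 w, length w < length W, K)"
      using w(2) W by (subst foldl_triple_step[OF K_def]) (auto intro!: exI[of _ w])
    moreover have "W \<in> lists ?A"
      using row[OF admissible_lists[OF w(2)]] by (subst W(1)) auto
    ultimately show "W \<in> {W \<in> lists ?A. foldl ?t (Some (s0, False, 0)) W \<in> ?F}"
      using w(3) admissible_foldl_in[OF w(2) S(2,3)] by auto
  qed
  ultimately show ?thesis by simp
qed

text \<open>The second and third components depend on the first only through its final state and on
  the letter \<open>x\<close>, so the graph is a finite union of languages with two fixed
  components.\<close>

theorem synchronously_regular_finite_state: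
  assumes X: "finite X"
    and S: "finite S" "s0 \<in> S" "\<And>s x. s \<in> S \<Longrightarrow> x \<in> X \<Longrightarrow> child s x \<Longrightarrow> step s x \<in> S"
    and fl: "\<And>s x. s \<in> S \<Longrightarrow> x \<in> X \<Longrightarrow> fl s x \<in> lists X"
  shows "synchronously_regular X 3
    {[w, [x], fl (foldl step s0 w) x] | w x. admissible X child step s0 w \<and> x \<in> X}"
proof -
  let ?L = "{[w, [x], fl (foldl step s0 w) x] | w x. admissible X child step s0 w \<and> x \<in> X}"
  let ?K = "\<lambda>(s, x). {pad [w, [x], fl s x] | w. admissible X child step s0 w \<and> foldl step s0 w \<in> {s}}"
  have in_S: "foldl step s0 w \<in> S" if "admissible X child step s0 w" for w
    by (rule admissible_foldl_in[OF that S(2,3)])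
  have "pad ` ?L = (\<Union>p\<in>S \<times> X. ?K p)"
  proof (intro equalityI subsetI)
    fix W assume "W \<in> pad ` ?L"
    then obtain w x where "W = pad [w, [x], fl (foldl step s0 w) x]" "admissible X child step s0 w" "x \<in> X"
      by auto
    then show "W \<in> (\<Union>p\<in>S \<times> X. ?K p)"
      using in_S by (intro UN_I[of "(foldl step s0 w, x)"]) auto
  qed auto
  moreover have "regular_language (padded_alphabet X 3) (?K p)" if mem: "p \<in> S \<times> X" for p
  proof -
    obtain s x where p: "p = (s, x)" "s \<in> S" "x \<in> X" using mem by auto
    show ?thesis
      unfolding p(1) prod.case
      by (rule regular_language_pad_triple[OF S(1,2)]) (use S(3) fl p in auto)
  qed
  ultimately have "regular_language (padded_alphabet X 3) (pad ` ?L)"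
    using regular_language_UN[of "S \<times> X" "padded_alphabet X 3" ?K] S(1) X by simp
  moreover have "?L \<subseteq> word_tuples X 3"
    using in_S fl admissible_lists by (fastforce simp: word_tuples_def)
  ultimately show ?thesis by (simp add: synchronously_regular_def)
qed

section \<open>Decidability of the graph of a finite-state map\<close>

text \<open>Since \<^const>\<open>recursive_function\<close> also fixes the values on lists of the wrong length, it is
  relaxed to agreement on the lists of length \<open>n\<close>.\<close>

definition computable :: "nat \<Rightarrow> (nat list \<Rightarrow> nat) \<Rightarrow> bool" where
  "computable n f \<longleftrightarrow> (\<exists>f'. recursive_function n f' \<and> (\<forall>xs. length xs = n \<longrightarrow> f' xs = f xs))"

lemma computable_cong:
  "\<lbrakk>computable n f; \<And>xs. length xs = n \<Longrightarrow> f xs = g xs\<rbrakk> \<Longrightarrow> computable n g"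
  unfolding computable_def by metis

lemma computable_zero: "computable n (\<lambda>xs. 0)"
  unfolding computable_def using recursive_function.zero by blast

lemma computable_proj: "i < n \<Longrightarrow> computable n (\<lambda>xs. xs ! i)"
  unfolding computable_def using recursive_function.proj by blast

lemma computable_comp:
  assumes f: "computable (length gs) f" and gs: "\<And>g. g \<in> set gs \<Longrightarrow> computable n g"
  shows "computable n (\<lambda>xs. f (map (\<lambda>g. g xs) gs))"
proof -
  obtain f' where f': "recursive_function (length gs) f'" "\<And>xs. length xs = length gs \<Longrightarrow> f' xs = f xs"
    using f unfolding computable_def by blast
  have "\<forall>g\<in>set gs. \<exists>g'. recursive_function n g' \<and> (\<forall>xs. length xs = n \<longrightarrow> g' xs = g xs)"
    using gs unfolding computable_def by blast
  then obtain h where h: "\<And>g. g \<in> set gs \<Longrightarrow> recursive_function n (h g)"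
      "\<And>g xs. g \<in> set gs \<Longrightarrow> length xs = n \<Longrightarrow> h g xs = g xs"
    by metis
  have "recursive_function n (\<lambda>xs. f' (map (\<lambda>g. g xs) (map h gs)))"
    using f'(1) h(1) by (intro recursive_function.comp) auto
  moreover have "f' (map (\<lambda>g. g xs) (map h gs)) = f (map (\<lambda>g. g xs) gs)" if "length xs = n" for xs
    using that f'(2) h(2) by (simp add: o_def cong: map_cong)
  ultimately show ?thesis unfolding computable_def by blast
qed

lemma computable_comp1:
  assumes "computable 1 (\<lambda>ys. f (ys ! 0))" "computable n a"
  shows "computable n (\<lambda>xs. f (a xs))"
  using computable_comp[of "[a]" "\<lambda>ys. f (ys ! 0)" n] assms by simp

lemma computable_comp2:
  assumes "computable 2 (\<lambda>ys. f (ys ! 0) (ys ! 1))" "computable n a" "computable n b"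
  shows "computable n (\<lambda>xs. f (a xs) (b xs))"
  using computable_comp[of "[a, b]" "\<lambda>ys. f (ys ! 0) (ys ! 1)" n] assms
  by (auto simp: numeral_2_eq_2)

lemma computable_comp3:
  assumes "computable 3 (\<lambda>ys. f (ys ! 0) (ys ! 1) (ys ! 2))" "computable n a" "computable n b"
    "computable n c"
  shows "computable n (\<lambda>xs. f (a xs) (b xs) (c xs))"
  using computable_comp[of "[a, b, c]" "\<lambda>ys. f (ys ! 0) (ys ! 1) (ys ! 2)" n] assms
  by (auto simp: numeral_3_eq_3 numeral_2_eq_2)

lemma computable_Suc: "computable n a \<Longrightarrow> computable n (\<lambda>xs. Suc (a xs))"
  by (rule computable_comp1) (use recursive_function.succ in \<open>auto simp: computable_def\<close>)

lemma computable_const: "computable n (\<lambda>xs. c)"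
  by (induction c) (auto intro: computable_zero computable_Suc)

lemma computable_rec:
  assumes a: "computable n a" and f: "computable n f"
    and g: "computable (Suc (Suc n)) (\<lambda>ys. g (ys ! 0) (ys ! 1) (drop 2 ys))"
  shows "computable n (\<lambda>xs. rec_nat (f xs) (\<lambda>k r. g k r xs) (a xs))"
proof -
  obtain f' where f': "recursive_function n f'" "\<And>xs. length xs = n \<Longrightarrow> f' xs = f xs"
    using f unfolding computable_def by blast
  obtain g' where g': "recursive_function (Suc (Suc n)) g'"
      "\<And>ys. length ys = Suc (Suc n) \<Longrightarrow> g' ys = g (ys ! 0) (ys ! 1) (drop 2 ys)"
    using g unfolding computable_def by blast
  let ?h = "\<lambda>ys. rec_nat (f' (tl ys)) (\<lambda>k r. g' (k # r # tl ys)) (hd ys)"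
  let ?gs = "a # map (\<lambda>i xs. xs ! i) [0..<n]"
  have "computable (length ?gs) ?h"
    using recursive_function.prim_rec[OF f'(1) g'(1)] by (auto simp: computable_def)
  then have "computable n (\<lambda>xs. ?h (map (\<lambda>g. g xs) ?gs))"
    by (rule computable_comp) (use a computable_proj in auto)
  then show ?thesis
  proof (rule computable_cong)
    fix xs :: "nat list" assume xs: "length xs = n"
    have m: "map (\<lambda>g. g xs) (map (\<lambda>i xs. xs ! i) [0..<n]) = xs"
      using xs by (auto intro: nth_equalityI)
    have "rec_nat (f' xs) (\<lambda>k r. g' (k # r # xs)) m = rec_nat (f xs) (\<lambda>k r. g k r xs) m" for m
      using xs f'(2) g'(2) by (induction m) auto
    then show "?h (map (\<lambda>g. g xs) ?gs) = rec_nat (f xs) (\<lambda>k r. g k r xs) (a xs)"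
      using m by simp
  qed
qed

lemma computable_Least:
  assumes f: "computable (Suc n) (\<lambda>ys. f (ys ! 0) (tl ys))"
    and ex: "\<And>xs. length xs = n \<Longrightarrow> \<exists>y. f y xs = 0"
  shows "computable n (\<lambda>xs. LEAST y. f y xs = 0)"
proof -
  obtain f' where f': "recursive_function (Suc n) f'"
      "\<And>ys. length ys = Suc n \<Longrightarrow> f' ys = f (ys ! 0) (tl ys)"
    using f unfolding computable_def by blast
  have eq: "f' (y # xs) = f y xs" if "length xs = n" for y xs using f'(2) that by simp
  have "recursive_function n (\<lambda>xs. LEAST y. f' (y # xs) = 0)"
    using f'(1) ex eq by (intro recursive_function.minim) auto
  then show ?thesis using eq unfolding computable_def by (intro exI conjI) auto
qed

lemma computable_add:
  assumes "computable n a" "computable n b"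
  shows "computable n (\<lambda>xs. a xs + b xs)"
proof -
  have "computable n (\<lambda>xs. rec_nat (a xs) (\<lambda>k r. Suc r) (b xs))"
    by (intro computable_rec assms computable_Suc computable_proj) simp
  moreover have "rec_nat m (\<lambda>k r. Suc r) k = m + k" for m k by (induction k) auto
  ultimately show ?thesis by simp
qed

lemma computable_mult:
  assumes "computable n a" "computable n b"
  shows "computable n (\<lambda>xs. a xs * b xs)"
proof -
  have "computable 2 (\<lambda>ys. rec_nat 0 (\<lambda>k r. r + ys ! 0) (ys ! 1))"
  proof (intro computable_rec computable_zero computable_proj)
    have "computable 4 (\<lambda>ys. ys ! 1 + ys ! 2)"
      by (intro computable_add computable_proj) auto
    then show "computable (Suc (Suc 2)) (\<lambda>ys. ys ! 1 + drop 2 ys ! 0)"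
      by (rule_tac computable_cong) auto
  qed simp
  moreover have "rec_nat 0 (\<lambda>k r. r + m) k = m * k" for m k by (induction k) auto
  ultimately have "computable 2 (\<lambda>ys. ys ! 0 * ys ! 1)" by simp
  then show ?thesis using assms by (rule computable_comp2)
qed

lemma computable_diff:
  assumes "computable n a" "computable n b"
  shows "computable n (\<lambda>xs. a xs - b xs)"
proof -
  have "computable 1 (\<lambda>ys. rec_nat 0 (\<lambda>k r. k) (ys ! 0))"
    by (intro computable_rec computable_zero computable_proj) simp_all
  moreover have "rec_nat 0 (\<lambda>k r. k) m = m - 1" for m by (cases m) auto
  ultimately have pred: "computable 1 (\<lambda>ys. ys ! 0 - 1)" by simp
  have "computable n (\<lambda>xs. rec_nat (a xs) (\<lambda>k r. r - 1) (b xs))"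
    by (intro computable_rec assms computable_comp1[OF pred] computable_proj) simp
  moreover have "rec_nat m (\<lambda>k r. r - 1) k = m - k" for m k by (induction k) auto
  ultimately show ?thesis by simp
qed

lemma computable_if_eq:
  assumes "computable n a" "computable n b" "computable n c" "computable n d"
  shows "computable n (\<lambda>xs. if a xs = b xs then c xs else d xs)"
proof -
  \<comment> \<open>Truncated subtraction makes this the indicator of
    \<open>a xs = b xs\<close>.\<close>
  let ?e = "\<lambda>xs. (1 - ((a xs - b xs) + (b xs - a xs)))"
  have "computable n (\<lambda>xs. ?e xs * c xs + (1 - ?e xs) * d xs)"
    by (intro computable_add computable_mult computable_diff assms computable_const)
  then show ?thesis by (rule computable_cong) auto
qed

text \<open>A finite table is a nesting of case distinctions; the inner claim compares the argument
  with one row \<open>y\<close> entry by entry. It serves for the transition table and for the table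
  of accepted triples.\<close>

lemma computable_finite_support:
  assumes "finite B" "\<And>ys. ys \<in> B \<Longrightarrow> length ys = n"
  shows "computable n (\<lambda>xs. if xs \<in> B then c xs else 0)"
  using assms
proof (induction B)
  case empty
  then show ?case by (simp add: computable_zero)
next
  case (insert y B)
  have "computable n (\<lambda>xs. if take k xs = take k y then d else e xs)"
    if "computable n e" "k \<le> n" for d e k
    using that
  proof (induction k arbitrary: e)
    case 0
    then show ?case by (simp add: computable_const)
  next
    case (Suc k)
    have "computable n (\<lambda>xs. if xs ! k = y ! k then (if take k xs = take k y then d else e xs) else e xs)"
      using Suc by (intro computable_if_eq computable_proj computable_const) auto
    then show ?case
      by (rule computable_cong) (use Suc insert.prems in \<open>auto simp: take_Suc_conv_app_nth\<close>)
  qed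
  from this[of "\<lambda>xs. if xs \<in> B then c xs else 0" n "c y"]
  have "computable n (\<lambda>xs. if take n xs = take n y then c y else if xs \<in> B then c xs else 0)"
    using insert by auto
  then show ?case
    by (rule computable_cong) (use insert.prems in auto)
qed

section \<open>Running an automaton on the code of a word\<close>

definition code_hd :: "nat \<Rightarrow> nat" where "code_hd n = fst (prod_decode (n - 1))"
definition code_tl :: "nat \<Rightarrow> nat" where "code_tl n = snd (prod_decode (n - 1))"

text \<open>The empty word needs \<open>prod_decode 0 = (0, 0)\<close>: its code 0 is then fixed by
  \<open>code_tl\<close>, so taking tails past the end of a word is harmless.\<close>

lemma code_tl_list_encode: "code_tl (list_encode ws) = list_encode (tl ws)"
proof -
  have "prod_encode (0, 0) = 0" by (simp add: prod_encode_def)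
  then have "prod_decode 0 = (0, 0)" by (metis prod_encode_inverse)
  then show ?thesis by (cases ws) (simp_all add: code_tl_def)
qed

lemma code_hd_list_encode: "ws \<noteq> [] \<Longrightarrow> code_hd (list_encode ws) = hd ws"
  by (cases ws) (simp_all add: code_hd_def)

lemma computable_triangle: "computable n a \<Longrightarrow> computable n (\<lambda>xs. triangle (a xs))"
proof -
  assume a: "computable n a"
  have "computable n (\<lambda>xs. rec_nat 0 (\<lambda>k r. r + Suc k) (a xs))"
    by (intro computable_rec computable_zero a computable_add computable_Suc computable_proj) simp_all
  moreover have "rec_nat 0 (\<lambda>k r. r + Suc k) m = triangle m" for m by (induction m) auto
  ultimately show ?thesis by simp
qed

lemma prod_decode_triangle:
  "m = triangle (fst (prod_decode m) + snd (prod_decode m)) + fst (prod_decode m)"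
  using prod_decode_inverse[of m] by (simp add: prod_encode_def case_prod_unfold)

text \<open>The sum of the two components of \<open>prod_decode m\<close> is the number of the diagonal of \<open>m\<close>.\<close>

lemma Least_triangle:
  "(LEAST s. Suc m - triangle (Suc s) = 0) = fst (prod_decode m) + snd (prod_decode m)"
proof -
  obtain x y where xy: "prod_decode m = (x, y)" by (cases "prod_decode m")
  then have m: "m = triangle (x + y) + x"
    using prod_decode_triangle[of m] by simp
  have mono: "triangle i \<le> triangle j" if "i \<le> j" for i j
    using that by (induction rule: dec_induct) auto
  have "(LEAST s. Suc m - triangle (Suc s) = 0) = x + y"
  proof (rule Least_equality)
    show "Suc m - triangle (Suc (x + y)) = 0" using m by simp
  next
    fix s assume s: "Suc m - triangle (Suc s) = 0"
    show "x + y \<le> s"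
    proof (rule ccontr)
      assume "\<not> x + y \<le> s"
      then have "triangle (Suc s) \<le> triangle (x + y)" by (intro mono) simp
      then show False using s m by simp
    qed
  qed
  then show ?thesis using xy by simp
qed

lemma computable_prod_decode:
  assumes "computable n a"
  shows "computable n (\<lambda>xs. fst (prod_decode (a xs)))" "computable n (\<lambda>xs. snd (prod_decode (a xs)))"
proof -
  let ?s = "\<lambda>m. LEAST s. Suc m - triangle (Suc s) = 0"
  have "computable 1 (\<lambda>xs. LEAST s. Suc (xs ! 0) - triangle (Suc s) = 0)"
  proof (rule computable_Least)
    have "computable 2 (\<lambda>ys. Suc (ys ! 1) - triangle (Suc (ys ! 0)))"
      by (intro computable_diff computable_Suc computable_triangle computable_proj) auto
    then show "computable (Suc 1) (\<lambda>ys. Suc (tl ys ! 0) - triangle (Suc (ys ! 0)))"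
      by (rule_tac computable_cong) (auto simp: nth_tl numeral_2_eq_2)
    show "\<exists>y. Suc (xs ! 0) - triangle (Suc y) = 0" for xs
      \<comment> \<open>A triangular number is at least its index, so the search for the diagonal of
        \<open>m\<close> ends at \<open>m\<close> at the latest.\<close>
      by (rule exI[of _ "xs ! 0"]) (simp add: triangle_def)
  qed
  then have s: "computable n (\<lambda>xs. ?s (a xs))"
    using assms by (rule computable_comp1)
  have fst_eq: "fst (prod_decode m) = m - triangle (?s m)" and
    snd_eq: "snd (prod_decode m) = ?s m - fst (prod_decode m)" for m
    unfolding Least_triangle using prod_decode_triangle[of m] by linarith simp
  have "computable n (\<lambda>xs. a xs - triangle (?s (a xs)))"
    by (intro computable_diff computable_triangle s assms)
  then show 1: "computable n (\<lambda>xs. fst (prod_decode (a xs)))" unfolding fst_eq .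
  show "computable n (\<lambda>xs. snd (prod_decode (a xs)))"
    unfolding snd_eq by (intro computable_diff s 1)
qed

lemma computable_code_hd: "computable n a \<Longrightarrow> computable n (\<lambda>xs. code_hd (a xs))"
  and computable_code_tl: "computable n a \<Longrightarrow> computable n (\<lambda>xs. code_tl (a xs))"
  unfolding code_hd_def code_tl_def
  by (intro computable_prod_decode computable_diff computable_const; assumption)+

text \<open>The code of a word exceeds its length, so \<open>c\<close> rounds suffice.\<close>

definition code_fold :: "(nat \<Rightarrow> nat \<Rightarrow> nat) \<Rightarrow> nat \<Rightarrow> nat \<Rightarrow> nat" where
  "code_fold \<Delta> q c = rec_nat q
     (\<lambda>k r. if rec_nat c (\<lambda>_. code_tl) k = 0 then r else \<Delta> r (code_hd (rec_nat c (\<lambda>_. code_tl) k))) c"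

lemma length_le_list_encode: "length ws \<le> list_encode ws"
  by (induction ws) (auto intro: order_trans[OF _ le_prod_encode_2])

lemma code_fold_list_encode: "code_fold \<Delta> q (list_encode ws) = foldl \<Delta> q ws"
proof -
  have tails: "rec_nat (list_encode ws) (\<lambda>_. code_tl) k = list_encode (drop k ws)" for k
    by (induction k) (simp_all add: code_tl_list_encode drop_Suc tl_drop)
  have zero: "list_encode vs = 0 \<longleftrightarrow> vs = []" for vs by (cases vs) auto
  have "rec_nat q (\<lambda>k r. if rec_nat (list_encode ws) (\<lambda>_. code_tl) k = 0 then r
      else \<Delta> r (code_hd (rec_nat (list_encode ws) (\<lambda>_. code_tl) k))) n = foldl \<Delta> q (take n ws)" for n
    by (induction n) (auto simp: tails zero code_hd_list_encode take_Suc_conv_app_nth hd_drop_conv_nth)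
  then show ?thesis using length_le_list_encode[of ws] by (simp add: code_fold_def)
qed

lemma computable_code_fold:
  assumes \<Delta>: "computable 2 (\<lambda>ys. \<Delta> (ys ! 0) (ys ! 1))" and a: "computable n a"
  shows "computable n (\<lambda>xs. code_fold \<Delta> q (a xs))"
proof -
  have tails: "computable m (\<lambda>xs. rec_nat (b xs) (\<lambda>_. code_tl) (d xs))"
    if "computable m b" "computable m d" for m b d
    using that by (intro computable_rec computable_code_tl computable_proj) simp_all
  have "computable 1 (\<lambda>ys. code_fold \<Delta> q (ys ! 0))"
    unfolding code_fold_def
  proof (intro computable_rec computable_const computable_proj)
    have "computable (Suc (Suc 1)) (\<lambda>ys. if rec_nat (ys ! 2) (\<lambda>_. code_tl) (ys ! 0) = 0 then ys ! 1
        else \<Delta> (ys ! 1) (code_hd (rec_nat (ys ! 2) (\<lambda>_. code_tl) (ys ! 0))))"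
      by (intro computable_if_eq computable_comp2[OF \<Delta>] computable_code_hd tails computable_proj
          computable_const) simp_all
    then show "computable (Suc (Suc 1)) (\<lambda>ys. if rec_nat (drop 2 ys ! 0) (\<lambda>_. code_tl) (ys ! 0) = 0
        then ys ! 1 else \<Delta> (ys ! 1) (code_hd (rec_nat (drop 2 ys ! 0) (\<lambda>_. code_tl) (ys ! 0))))"
      by (rule computable_cong) simp
  qed simp
  then show ?thesis using a by (rule computable_comp1)
qed

theorem decidable_tuples_finite_state:
  assumes X: "finite X"
    and S: "finite S" "s0 \<in> S" "\<And>s x. s \<in> S \<Longrightarrow> x \<in> X \<Longrightarrow> child s x \<Longrightarrow> step s x \<in> S"
    and fl: "\<And>s x. s \<in> S \<Longrightarrow> x \<in> X \<Longrightarrow> fl s x \<in> lists X"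
  shows "decidable_tuples X 3
    {[w, [x], fl (foldl step s0 w) x] | w x. admissible X child step s0 w \<and> x \<in> X}"
proof -
  let ?L = "{[w, [x], fl (foldl step s0 w) x] | w x. admissible X child step s0 w \<and> x \<in> X}"
  have in_S: "foldl step s0 w \<in> S" if "admissible X child step s0 w" for w
    by (rule admissible_foldl_in[OF that S(2,3)])
  obtain c :: "'a \<Rightarrow> nat" where c: "inj_on c X"
    using finite_imp_inj_to_nat_seg[OF X] by auto
  obtain e0 :: "'b \<Rightarrow> nat" where e0: "inj_on e0 S"
    using finite_imp_inj_to_nat_seg[OF S(1)] by auto
  \<comment> \<open>The shift keeps 0 free for a dead state, entered when a word leaves the
    tree.\<close>
  define e where "e s = Suc (e0 s)" for s
  have e: "e s = e s' \<longleftrightarrow> s = s'" if "s \<in> S" "s' \<in> S" for s s'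
    using that inj_onD[OF e0] by (auto simp: e_def)
  let ?code = "\<lambda>w. list_encode (map c w)"
  have code_inj: "?code v = ?code w \<longleftrightarrow> v = w" if "v \<in> lists X" "w \<in> lists X" for v w
    using that by (metis c inj_on_map_eq_map inj_on_subset le_sup_iff list_encode_eq lists_eq_set
        mem_Collect_eq)
  define D where "D = {[e s, c x] | s x. s \<in> S \<and> x \<in> X \<and> child s x}"
  define dv where "dv ys = e (step (inv_into S e (ys ! 0)) (inv_into X c (ys ! 1)))" for ys
  define \<Delta> where "\<Delta> r a = (if [r, a] \<in> D then dv [r, a] else 0)" for r a
  have inv_e: "inv_into S e (e s) = s" if "s \<in> S" for s
    using that e by (intro inv_into_f_f) (auto simp: inj_on_def)
  have \<Delta>: "\<Delta> (e s) (c x) = (if child s x then e (step s x) else 0)" if "s \<in> S" "x \<in> X" for s x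
  proof -
    have "child s x" if "[e s, c x] \<in> D"
      using that e[OF \<open>s \<in> S\<close>] inj_on_eq_iff[OF c \<open>x \<in> X\<close>] by (auto simp: D_def)
    moreover have "[e s, c x] \<in> D" if "child s x"
      using that \<open>s \<in> S\<close> \<open>x \<in> X\<close> by (auto simp: D_def)
    ultimately show ?thesis using that inv_e c by (auto simp: \<Delta>_def dv_def)
  qed
  have \<Delta>0: "\<Delta> 0 a = 0" for a by (auto simp: \<Delta>_def D_def e_def)
  have run: "foldl \<Delta> (e s0) (map c w) =
      (if admissible X child step s0 w then e (foldl step s0 w) else 0)" if "w \<in> lists X" for w
    using that
  proof (induction w rule: rev_induct)
    case (snoc x w)
    then show ?case using in_S[of w] by (auto simp: admissible_append \<Delta> \<Delta>0)
  qed simp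
  have "D \<subseteq> (\<lambda>(s, x). [e s, c x]) ` (S \<times> X)"
  proof
    fix d assume "d \<in> D"
    then obtain s x where "d = [e s, c x]" "s \<in> S" "x \<in> X" unfolding D_def by blast
    then show "d \<in> (\<lambda>(s, x). [e s, c x]) ` (S \<times> X)" by (intro image_eqI[of _ _ "(s, x)"]) simp_all
  qed
  then have "finite D" by (rule finite_subset) (use S(1) X in simp)
  then have "computable 2 (\<lambda>ys. if ys \<in> D then dv ys else 0)"
    by (rule computable_finite_support) (auto simp: D_def)
  then have comp_\<Delta>: "computable 2 (\<lambda>ys. \<Delta> (ys ! 0) (ys ! 1))"
    by (rule computable_cong) (auto simp: \<Delta>_def numeral_2_eq_2 length_Suc_conv)
  \<comment> \<open>Once the first word is replaced by its final state, membership in the graph is a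
    finite table.\<close>
  define B where "B = (\<lambda>(s, x). [e s, ?code [x], ?code (fl s x)]) ` (S \<times> X)"
  have "finite B" using S(1) X by (simp add: B_def)
  then have "computable 3 (\<lambda>ys. if ys \<in> B then 1 else 0)"
    by (rule computable_finite_support) (auto simp: B_def)
  then have "computable 3 (\<lambda>ys. if [ys ! 0, ys ! 1, ys ! 2] \<in> B then 1 else 0)"
    by (rule computable_cong) (auto simp: numeral_3_eq_3 numeral_2_eq_2 length_Suc_conv)
  then have "computable 3 (\<lambda>xs. if [code_fold \<Delta> (e s0) (xs ! 0), xs ! 1, xs ! 2] \<in> B then 1 else 0)"
    by (rule computable_comp3) (intro computable_code_fold comp_\<Delta> computable_proj, simp_all add: computable_proj)
  then obtain \<chi> where \<chi>: "recursive_function 3 \<chi>"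
      "\<And>xs. length xs = 3 \<Longrightarrow>
         \<chi> xs = (if [code_fold \<Delta> (e s0) (xs ! 0), xs ! 1, xs ! 2] \<in> B then 1 else 0)"
    unfolding computable_def by blast
  have "\<chi> (map ?code ws) = (if ws \<in> ?L then 1 else 0)" if mem: "ws \<in> word_tuples X 3" for ws
  proof -
    obtain w u v where ws: "ws = [w, u, v]" and wuv: "w \<in> lists X" "u \<in> lists X" "v \<in> lists X"
      using mem by (auto simp: word_tuples_def numeral_3_eq_3 length_Suc_conv)
    have "[code_fold \<Delta> (e s0) (?code w), ?code u, ?code v] \<in> B \<longleftrightarrow> ws \<in> ?L"
    proof
      assume "[code_fold \<Delta> (e s0) (?code w), ?code u, ?code v] \<in> B"
      then obtain s x where sx: "s \<in> S" "x \<in> X" "code_fold \<Delta> (e s0) (?code w) = e s"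
          "?code u = ?code [x]" "?code v = ?code (fl s x)"
        by (auto simp: B_def)
      have w: "admissible X child step s0 w" "e (foldl step s0 w) = e s"
        using sx(3) run[OF wuv(1)] by (auto simp: code_fold_list_encode e_def split: if_splits)
      then have s: "s = foldl step s0 w" using e sx(1) in_S by simp
      have "u = [x]" "v = fl s x"
        using code_inj[of u "[x]"] code_inj[of v "fl s x"] wuv sx fl by auto
      then show "ws \<in> ?L" using ws w(1) s sx(2) by blast
    next
      assume "ws \<in> ?L"
      then obtain x where x: "admissible X child step s0 w" "x \<in> X" "u = [x]"
          "v = fl (foldl step s0 w) x"
        using ws by auto
      then show "[code_fold \<Delta> (e s0) (?code w), ?code u, ?code v] \<in> B"
        using run[OF wuv(1)] in_S[OF x(1)] by (auto simp: code_fold_list_encode B_def)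
    qed
    then show ?thesis using ws \<chi>(2)[of "map ?code ws"] by simp
  qed
  moreover have "?L \<subseteq> word_tuples X 3"
    using in_S fl admissible_lists by (fastforce simp: word_tuples_def)
  ultimately show ?thesis
    unfolding decidable_tuples_def using c \<chi>(1) by blast
qed

section \<open>Stackings from cone types\<close>

text \<open>No assumption says that the tree spans or has no circuits. \<open>wf_r\<close>,
  \<open>fl_less\<close> and \<open>fl_value\<close> give the first; \<open>last_letter_step\<close>
  and \<open>step_not_root\<close>, which let the state of a vertex determine how its branch ends,
  give the second.\<close>

locale cone_types = group G for G :: "('a, 'b) monoid_scheme" (structure) +
  fixes X :: "'a set" and st :: "'a \<Rightarrow> 's" and child :: "'s \<Rightarrow> 'a \<Rightarrow> bool"
    and step :: "'s \<Rightarrow> 'a \<Rightarrow> 's" and last_letter :: "'s \<Rightarrow> 'a"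
    and fl :: "'s \<Rightarrow> 'a \<Rightarrow> 'a list" and r :: "(('a \<times> 'a) \<times> ('a \<times> 'a)) set"
  assumes gens: "inverse_closed_gens G X"
    and finite_states: "finite (st ` carrier G)"
    and step_st: "\<lbrakk>g \<in> carrier G; x \<in> X; child (st g) x\<rbrakk> \<Longrightarrow> st (g \<otimes> x) = step (st g) x"
    and last_letter_step: "\<lbrakk>g \<in> carrier G; x \<in> X; child (st g) x\<rbrakk> \<Longrightarrow> last_letter (step (st g) x) = x"
    and step_not_root: "\<lbrakk>g \<in> carrier G; x \<in> X; child (st g) x\<rbrakk> \<Longrightarrow> step (st g) x \<noteq> st \<one>"
    and fl_lists: "\<lbrakk>g \<in> carrier G; x \<in> X\<rbrakk> \<Longrightarrow> fl (st g) x \<in> lists X"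
    and fl_value: "\<lbrakk>g \<in> carrier G; x \<in> X\<rbrakk> \<Longrightarrow> foldl (\<otimes>) g (fl (st g) x) = g \<otimes> x"
    and fl_tree: "\<lbrakk>g \<in> carrier G; x \<in> X; child (st g) x \<or> child (st (g \<otimes> x)) (inv x)\<rbrakk> \<Longrightarrow> fl (st g) x = [x]"
    and fl_less: "\<lbrakk>g \<in> carrier G; x \<in> X; \<not> child (st g) x; \<not> child (st (g \<otimes> x)) (inv x);
        (h, y) \<in> set (edge_path G g (fl (st g) x)); \<not> child (st h) y; \<not> child (st (h \<otimes> y)) (inv y)\<rbrakk>
        \<Longrightarrow> ((h, y), (g, x)) \<in> r"
    and wf_r: "wf r"
begin

lemma X_carrier: "x \<in> X \<Longrightarrow> x \<in> carrier G"
  and X_inv: "x \<in> X \<Longrightarrow> inv x \<in> X"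
  and finite_X: "finite X"
  and generate_X: "generate G X = carrier G"
  using gens by (auto simp: inverse_closed_gens_def)

definition tree_arcs :: "('a \<times> 'a) set" where
  "tree_arcs = {(g, x). g \<in> carrier G \<and> x \<in> X \<and> (child (st g) x \<or> child (st (g \<otimes> x)) (inv x))}"

definition the_tree :: "('a, 'a \<times> 'a) pre_digraph" where
  "the_tree = (cayley_graph G X)\<lparr>arcs := tree_arcs\<rparr>"

definition the_flow :: "'a \<times> 'a \<Rightarrow> ('a \<times> 'a) list" where
  "the_flow e = edge_path G (fst e) (fl (st (fst e)) (snd e))"

lemma the_tree_simps [simp]:
  "verts the_tree = carrier G" "arcs the_tree = tree_arcs" "tail the_tree = fst"
  "head the_tree = (\<lambda>(g, x). g \<otimes> x)"
  by (auto simp: the_tree_def cayley_graph_def)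

lemma cayley_graph_simps [simp]:
  "verts (cayley_graph G X) = carrier G" "arcs (cayley_graph G X) = carrier G \<times> X"
  "tail (cayley_graph G X) = fst" "head (cayley_graph G X) = (\<lambda>(g, x). g \<otimes> x)"
  by (auto simp: cayley_graph_def)

lemma right_cancel_inv: "\<lbrakk>g \<in> carrier G; x \<in> X\<rbrakk> \<Longrightarrow> g \<otimes> x \<otimes> inv x = g"
  using X_carrier by (simp add: m_assoc)

lemma right_cancel_inv': "\<lbrakk>g \<in> carrier G; x \<in> X\<rbrakk> \<Longrightarrow> g \<otimes> inv x \<otimes> x = g"
  using X_carrier by (simp add: m_assoc)

lemma tree_arcs_rev: "e \<in> tree_arcs \<Longrightarrow> edge_rev G e \<in> tree_arcs"
  using X_carrier X_inv by (auto simp: tree_arcs_def edge_rev_def right_cancel_inv)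

lemma tree_arcs_subset: "tree_arcs \<subseteq> carrier G \<times> X"
  by (auto simp: tree_arcs_def)

section \<open>The tree spans because the flow terminates\<close>

definition tree_conn :: "('a \<times> 'a) set" where
  "tree_conn = {(g, g \<otimes> x) |g x. (g, x) \<in> tree_arcs}\<^sup>*"

lemma tree_conn_trans: "\<lbrakk>(g, h) \<in> tree_conn; (h, k) \<in> tree_conn\<rbrakk> \<Longrightarrow> (g, k) \<in> tree_conn"
  unfolding tree_conn_def by (rule rtrancl_trans)

lemma foldl_carrier: "\<lbrakk>g \<in> carrier G; w \<in> lists X\<rbrakk> \<Longrightarrow> foldl (\<otimes>) g w \<in> carrier G"
  using X_carrier by (induction w arbitrary: g) auto

lemma edge_path_conn:
  assumes "\<And>h y. (h, y) \<in> set (edge_path G g w) \<Longrightarrow> (h, h \<otimes> y) \<in> tree_conn"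
  shows "(g, foldl (\<otimes>) g w) \<in> tree_conn"
  using assms
proof (induction w arbitrary: g)
  case Nil
  then show ?case by (simp add: tree_conn_def)
next
  case (Cons x w)
  have "(g, g \<otimes> x) \<in> tree_conn" "(g \<otimes> x, foldl (\<otimes>) (g \<otimes> x) w) \<in> tree_conn"
    using Cons by auto
  then show ?case
    using tree_conn_trans by simp
qed

lemma edge_path_arcs:
  "\<lbrakk>g \<in> carrier G; w \<in> lists X\<rbrakk> \<Longrightarrow> set (edge_path G g w) \<subseteq> carrier G \<times> X"
  using X_carrier by (induction w arbitrary: g) auto

text \<open>Induction along \<open>r\<close>: the flow label of a non-tree edge joins the same
  vertices and consists of tree edges and smaller edges.\<close>

lemma edge_conn: "\<lbrakk>g \<in> carrier G; x \<in> X\<rbrakk> \<Longrightarrow> (g, g \<otimes> x) \<in> tree_conn"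
proof (induction "(g, x)" arbitrary: g x rule: wf_induct_rule[OF wf_r])
  case 1
  show ?case
  proof (cases "(g, x) \<in> tree_arcs")
    case True
    then show ?thesis by (auto simp: tree_conn_def)
  next
    case False
    have "(h, h \<otimes> y) \<in> tree_conn" if hy: "(h, y) \<in> set (edge_path G g (fl (st g) x))" for h y
    proof (cases "(h, y) \<in> tree_arcs")
      case True
      then show ?thesis by (auto simp: tree_conn_def)
    next
      case hy': False
      have c: "h \<in> carrier G" "y \<in> X"
        using hy edge_path_arcs[OF 1(2) fl_lists[OF 1(2,3)]] by auto
      have "((h, y), (g, x)) \<in> r"
        using fl_less[OF 1(2,3) _ _ hy] False hy' c 1(2,3) by (auto simp: tree_arcs_def)
      then show ?thesis using 1(1) c by blast
    qed
    then show ?thesis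
      using edge_path_conn[of g "fl (st g) x"] fl_value[OF 1(2,3)] by simp
  qed
qed

lemma conn_from_one: "g \<in> carrier G \<Longrightarrow> (\<one>, g) \<in> tree_conn"
proof -
  have "(g, g \<otimes> h) \<in> tree_conn" if "h \<in> generate G X" "g \<in> carrier G" for g h
    using that
  proof (induction arbitrary: g rule: generate.induct)
    case one
    then show ?case by (simp add: tree_conn_def)
  next
    case (incl h)
    then show ?case using edge_conn by simp
  next
    case (inv h)
    then show ?case using edge_conn X_inv by simp
  next
    case (eng h1 h2)
    have "h1 \<in> carrier G" "h2 \<in> carrier G" using eng generate_X by auto
    then have "(g, g \<otimes> h1) \<in> tree_conn" "g \<otimes> h1 \<in> carrier G" "g \<otimes> h1 \<otimes> h2 = g \<otimes> (h1 \<otimes> h2)"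
      using eng by (simp_all add: m_assoc)
    moreover have "(g \<otimes> h1, g \<otimes> h1 \<otimes> h2) \<in> tree_conn"
      by (rule eng.IH(2)[OF calculation(2)])
    ultimately show ?case using tree_conn_trans by metis
  qed
  from this[of g \<one>] show "g \<in> carrier G \<Longrightarrow> (\<one>, g) \<in> tree_conn"
    using generate_X by simp
qed

section \<open>Branches of the tree as normal forms\<close>

abbreviation desc :: "'a list \<Rightarrow> bool" where
  "desc \<equiv> admissible X child step (st \<one>)"

abbreviation val :: "'a list \<Rightarrow> 'a" where
  "val w \<equiv> foldl (\<otimes>) \<one> w"

lemma val_carrier: "desc w \<Longrightarrow> val w \<in> carrier G"
  by (rule foldl_carrier[OF one_closed admissible_lists])

lemma st_val: "desc w \<Longrightarrow> st (val w) = foldl step (st \<one>) w"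
proof (induction w rule: rev_induct)
  case (snoc x w)
  then show ?case
    using val_carrier[of w] step_st[of "val w" x] by (simp add: admissible_append)
qed simp

lemma desc_snoc: "desc (w @ [x]) \<longleftrightarrow> desc w \<and> x \<in> X \<and> child (st (val w)) x"
  using st_val by (auto simp: admissible_append)

lemma last_letter_val: "desc (w @ [x]) \<Longrightarrow> last_letter (st (val (w @ [x]))) = x"
  using val_carrier[of w] step_st[of "val w" x] last_letter_step[of "val w" x]
  by (simp add: desc_snoc)

lemma st_val_not_root: "desc (w @ [x]) \<Longrightarrow> st (val (w @ [x])) \<noteq> st \<one>"
  using val_carrier[of w] step_st[of "val w" x] step_not_root[of "val w" x]
  by (simp add: desc_snoc)

text \<open>The state of the common value decides whether a word is empty and what its last letter
  is. So both words end alike, and the last letter is cancelled in the group.\<close>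

lemma desc_inj: "\<lbrakk>desc v; desc w; val v = val w\<rbrakk> \<Longrightarrow> v = w"
proof (induction v arbitrary: w rule: rev_induct)
  case Nil
  show ?case
  proof (cases w rule: rev_cases)
    case (snoc w' y)
    then show ?thesis using Nil st_val_not_root[of w' y] by auto
  qed simp
next
  case (snoc x v)
  show ?case
  proof (cases w rule: rev_cases)
    case Nil
    then show ?thesis using snoc st_val_not_root[of v x] by auto
  next
    case w: (snoc w' y)
    have y: "y = x"
      using snoc.prems last_letter_val[of v x] last_letter_val[of w' y] w by simp
    have d: "desc v" "desc w'" "x \<in> X" using snoc.prems w by (auto simp: desc_snoc)
    have "val v \<otimes> x = val w' \<otimes> x" using snoc.prems w y by simp
    then have "val v = val w'"
      using d val_carrier X_carrier by (metis right_cancel)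
    then show ?thesis using snoc.IH d w y by blast
  qed
qed

text \<open>Follow a tree path from the root. An edge away from the root appends a letter; an edge
  towards the root removes one, since the state of its start forces the current word to end with the
  inverse letter.\<close>

lemma desc_surj: "g \<in> carrier G \<Longrightarrow> \<exists>w. desc w \<and> val w = g"
proof -
  assume g: "g \<in> carrier G"
  have "(\<one>, g) \<in> {(g, g \<otimes> x) |g x. (g, x) \<in> tree_arcs}\<^sup>*"
    using conn_from_one[OF g] by (simp add: tree_conn_def)
  then show ?thesis
  proof (induction rule: rtrancl_induct)
    case base
    show ?case by (rule exI[of _ "[]"]) simp
  next
    case (step g h)
    then obtain x w where x: "(g, x) \<in> tree_arcs" "h = g \<otimes> x" and w: "desc w" "val w = g" by blast
    then have gx: "g \<in> carrier G" "x \<in> X" by (auto simp: tree_arcs_def)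
    consider "child (st g) x" | "child (st h) (inv x)"
      using x by (auto simp: tree_arcs_def)
    then show ?case
    proof cases
      case 1
      then show ?thesis
        using x w by (intro exI[of _ "w @ [x]"]) (auto simp: desc_snoc tree_arcs_def)
    next
      case 2
      have gh: "h \<in> carrier G" "h \<otimes> inv x = g"
        using gx x X_carrier by (auto simp: right_cancel_inv)
      have s: "st g = step (st h) (inv x)"
        using step_st[of h "inv x"] 2 gh gx X_inv by simp
      have "w \<noteq> []"
        using step_not_root[OF gh(1), of "inv x"] s 2 gx X_inv w by auto
      then obtain w' y where w': "w = w' @ [y]" by (metis rev_exhaust)
      have "y = inv x"
        using last_letter_val[of w' y] w w' s last_letter_step[OF gh(1), of "inv x"] 2 gx X_inv by simp
      then have "val w' \<otimes> inv x = h \<otimes> inv x" using w w' gh by simp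
      moreover have "desc w'" using w w' by (simp add: desc_snoc)
      ultimately have "val w' = h"
        using gh gx X_inv X_carrier val_carrier by (metis right_cancel)
      then show ?thesis using \<open>desc w'\<close> by blast
    qed
  qed
qed

definition word_of :: "'a \<Rightarrow> 'a list" where
  "word_of g = (THE w. desc w \<and> val w = g)"

lemma word_of: "g \<in> carrier G \<Longrightarrow> desc (word_of g) \<and> val (word_of g) = g"
  unfolding word_of_def using desc_surj desc_inj by (rule_tac theI') blast

lemma word_of_val: "desc w \<Longrightarrow> word_of (val w) = w"
  using word_of[OF val_carrier] desc_inj by blast

lemma word_of_snoc:
  assumes "g \<in> carrier G" "x \<in> X" "child (st g) x"
  shows "word_of (g \<otimes> x) = word_of g @ [x]"
  using word_of_val[of "word_of g @ [x]"] word_of[OF assms(1)] assms by (simp add: desc_snoc)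

lemma word_of_asc:
  assumes "g \<in> carrier G" "x \<in> X" "child (st (g \<otimes> x)) (inv x)"
  shows "word_of g = word_of (g \<otimes> x) @ [inv x]"
  using word_of_snoc[of "g \<otimes> x" "inv x"] assms X_inv X_carrier by (simp add: right_cancel_inv)

lemma word_of_one: "word_of \<one> = []"
  using word_of_val[of "[]"] by simp

lemma wf_cayley_graph: "wf_digraph (cayley_graph G X)"
  using X_carrier by unfold_locales auto

lemma wf_the_tree: "wf_digraph the_tree"
  using X_carrier by unfold_locales (auto simp: tree_arcs_def)

section \<open>Walks without backtracking in the tree\<close>

abbreviation tree_walk :: "'a \<Rightarrow> ('a \<times> 'a) list \<Rightarrow> 'a \<Rightarrow> bool" where
  "tree_walk \<equiv> pre_digraph.awalk the_tree"

abbreviation (input) child_arc :: "'a \<times> 'a \<Rightarrow> bool" where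
  "child_arc e \<equiv> child (st (fst e)) (snd e)"

lemma cas_append_the_tree:
  "pre_digraph.cas the_tree u (p @ [e]) v \<longleftrightarrow> pre_digraph.cas the_tree u p (fst e) \<and> fst e \<otimes> snd e = v"
  by (induction p arbitrary: u) (auto simp: pre_digraph.cas.simps split: prod.splits)

lemma awalk_the_tree_snoc:
  assumes "tree_walk u (p @ [(h, x)]) v"
  shows "tree_walk u p h" "(h, x) \<in> tree_arcs" "v = h \<otimes> x"
  using assms by (auto simp: pre_digraph.awalk_def cas_append_the_tree)

lemma without_backtracking_snoc:
  "without_backtracking G (p @ [e]) \<longleftrightarrow>
     without_backtracking G p \<and> (p \<noteq> [] \<longrightarrow> e \<noteq> edge_rev G (last p))"
  by (auto simp: without_backtracking_def successively_append_iff)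

lemma awalk_edge_path_word_of:
  assumes "g \<in> carrier G"
  shows "tree_walk \<one> (edge_path G \<one> (word_of g)) g"
    "without_backtracking G (edge_path G \<one> (word_of g))"
proof -
  have main: "tree_walk \<one> (edge_path G \<one> w) (val w) \<and>
    without_backtracking G (edge_path G \<one> w)" if "desc w" for w
    using that
  proof (induction w rule: rev_induct)
    case Nil
    then show ?case
      by (auto simp: pre_digraph.awalk_def pre_digraph.cas.simps without_backtracking_def)
  next
    case (snoc x w)
    let ?p = "edge_path G \<one> w"
    have x: "desc w" "x \<in> X" "child (st (val w)) x" using snoc.prems by (auto simp: desc_snoc)
    have IH: "tree_walk \<one> ?p (val w)" "without_backtracking G ?p"
      using snoc.IH x by auto
    have "(val w, x) \<in> tree_arcs" using x val_carrier by (auto simp: tree_arcs_def)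
    then have "tree_walk \<one> (?p @ [(val w, x)]) (val w \<otimes> x)"
      using IH by (auto simp: pre_digraph.awalk_def cas_append_the_tree)
    moreover have "(val w, x) \<noteq> edge_rev G (last ?p)" if "?p \<noteq> []"
    proof
      assume rev: "(val w, x) = edge_rev G (last ?p)"
      obtain w' y where w': "w = w' @ [y]"
        using \<open>?p \<noteq> []\<close> by (cases w rule: rev_cases) auto
      have y: "x = inv y" "y \<in> X" "desc w'"
        using rev w' x by (auto simp: edge_path_append edge_rev_def desc_snoc)
      have "word_of (val w \<otimes> x) = w @ [x]"
        using word_of_snoc[OF val_carrier] x word_of_val by simp
      moreover have "val w \<otimes> x = val w'"
        using w' y val_carrier[of w'] by (simp add: right_cancel_inv)
      ultimately have "w' = w @ [x]" using word_of_val y by simp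
      then show False using w' by simp
    qed
    ultimately show ?case
      using IH by (simp add: edge_path_append without_backtracking_snoc)
  qed
  show "tree_walk \<one> (edge_path G \<one> (word_of g)) g"
    "without_backtracking G (edge_path G \<one> (word_of g))"
    using word_of[OF assms] main[of "word_of g"] by simp_all
qed

text \<open>By induction the walk without its last edge is the branch to \<open>h\<close>. If the
  last edge led towards the root, that branch would end with its reverse, which is a
  backtrack.\<close>

lemma awalk_without_backtracking_unique:
  assumes "tree_walk \<one> p g" "without_backtracking G p"
  shows "p = edge_path G \<one> (word_of g)"
  using assms
proof (induction p arbitrary: g rule: rev_induct)
  case Nil
  then have "g = \<one>" by (auto simp: pre_digraph.awalk_def pre_digraph.cas.simps)
  then show ?case by (simp add: word_of_one)
next
  case (snoc e p)
  obtain h x where e: "e = (h, x)" by (cases e)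
  note a = awalk_the_tree_snoc[OF snoc.prems(1)[unfolded e]]
  have p: "p = edge_path G \<one> (word_of h)"
    using snoc.IH[OF a(1)] snoc.prems(2) by (simp add: without_backtracking_snoc)
  have hx: "h \<in> carrier G" "x \<in> X" using a(2) by (auto simp: tree_arcs_def)
  have "child (st h) x"
  proof (rule ccontr)
    assume "\<not> child (st h) x"
    then have c: "child (st g) (inv x)" using a by (auto simp: tree_arcs_def)
    then have w: "word_of h = word_of g @ [inv x]" using word_of_asc hx a(3) by simp
    have g: "g \<in> carrier G" using hx a(3) X_carrier by simp
    have "last p = (g, inv x)" "p \<noteq> []" using p w word_of[OF g] by (auto simp: edge_path_append)
    then have "e \<noteq> (g \<otimes> inv x, inv (inv x))"
      using snoc.prems(2) by (simp add: without_backtracking_snoc edge_rev_def)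
    then show False using e a(3) hx X_carrier by (simp add: right_cancel_inv)
  qed
  then have "word_of g = word_of h @ [x]" using word_of_snoc hx a(3) by simp
  then show ?case using p e word_of[OF hx(1)] by (simp add: edge_path_append)
qed

lemma nf_the_tree: "g \<in> carrier G \<Longrightarrow> nf G the_tree g = word_of g"
proof -
  assume g: "g \<in> carrier G"
  have "(THE p. tree_walk \<one> p g \<and> without_backtracking G p) =
      edge_path G \<one> (word_of g)"
    by (intro the_equality conjI awalk_edge_path_word_of[OF g])
      (simp add: awalk_without_backtracking_unique)
  then show ?thesis by (simp add: nf_def)
qed

text \<open>Two arcs of the tree that end in the same vertex and lead away from the root are equal. Hence
  a walk without backtracking never turns towards the root after a step away from it.\<close>

lemma child_successor:
  assumes "g \<in> carrier G" "x \<in> X" "child (st g) x" "y \<in> X"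
    and "child (st (g \<otimes> x \<otimes> y)) (inv y)"
  shows "y = inv x"
proof -
  have "word_of g @ [x] = word_of (g \<otimes> x \<otimes> y) @ [inv y]"
    using word_of_snoc[OF assms(1-3)] word_of_asc[of "g \<otimes> x" y] assms X_carrier by simp
  then show ?thesis using assms X_carrier by auto
qed

lemma without_backtracking_Cons:
  "without_backtracking G (e # p) \<longleftrightarrow>
     without_backtracking G p \<and> (p \<noteq> [] \<longrightarrow> hd p \<noteq> edge_rev G e)"
  by (auto simp: without_backtracking_def successively_Cons)

text \<open>By \<open>child_successor\<close> a walk without backtracking that starts away from the
  root keeps moving away, and each step adds a letter to the normal form.\<close>

lemma length_descending:
  assumes "tree_walk u p v" "without_backtracking G p" "p \<noteq> []" "child_arc (hd p)"
  shows "length (word_of v) = length (word_of u) + length p"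
  using assms
proof (induction p arbitrary: u)
  case (Cons e p)
  obtain x where e: "e = (u, x)" using Cons.prems(1)
    by (cases e) (auto simp: pre_digraph.awalk_def pre_digraph.cas.simps)
  have ux: "u \<in> carrier G" "x \<in> X" "child (st u) x"
    using Cons.prems e by (auto simp: pre_digraph.awalk_def tree_arcs_def)
  have w: "word_of (u \<otimes> x) = word_of u @ [x]" using word_of_snoc ux by simp
  have aw: "tree_walk (u \<otimes> x) p v"
    using Cons.prems(1) e ux X_carrier by (auto simp: pre_digraph.awalk_def pre_digraph.cas.simps)
  show ?case
  proof (cases "p = []")
    case True
    then show ?thesis using aw w by (auto simp: pre_digraph.awalk_def pre_digraph.cas.simps)
  next
    case False
    then obtain y p' where p: "p = (u \<otimes> x, y) # p'"
      using aw by (cases p) (auto simp: pre_digraph.awalk_def pre_digraph.cas.simps)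
    have y: "(u \<otimes> x, y) \<in> tree_arcs" using aw p by (auto simp: pre_digraph.awalk_def)
    have "y \<noteq> inv x"
      using Cons.prems(2) p e by (auto simp: without_backtracking_Cons edge_rev_def)
    then have "\<not> child (st (u \<otimes> x \<otimes> y)) (inv y)"
      using child_successor ux y by (auto simp: tree_arcs_def)
    then have "child_arc (hd p)" using y p by (auto simp: tree_arcs_def)
    then show ?thesis
      using Cons.IH[OF aw _ False] Cons.prems(2) w by (simp add: without_backtracking_Cons)
  qed
qed simp

text \<open>The mirror image of \<open>length_descending\<close>, hence an induction from the end of
  the walk.\<close>

lemma length_ascending:
  assumes "tree_walk u p v" "without_backtracking G p" "p \<noteq> []" "\<not> child_arc (last p)"
  shows "length (word_of u) = length (word_of v) + length p"
  using assms
proof (induction p arbitrary: v rule: rev_induct)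
  case (snoc e p)
  obtain h x where e: "e = (h, x)" by (cases e)
  note a = awalk_the_tree_snoc[OF snoc.prems(1)[unfolded e]]
  have hx: "h \<in> carrier G" "x \<in> X" "child (st v) (inv x)"
    using a(2,3) snoc.prems(4) e by (auto simp: tree_arcs_def)
  have w: "word_of h = word_of v @ [inv x]" using word_of_asc hx a(3) by simp
  show ?case
  proof (cases p rule: rev_cases)
    case Nil
    then show ?thesis using a(1) w by (auto simp: pre_digraph.awalk_def pre_digraph.cas.simps)
  next
    case (snoc p' e')
    obtain k y where e': "e' = (k, y)" by (cases e')
    note b = awalk_the_tree_snoc[OF a(1)[unfolded snoc e']]
    have ky: "k \<in> carrier G" "y \<in> X" using b(2) by (auto simp: tree_arcs_def)
    have wb: "without_backtracking G p" "e \<noteq> edge_rev G e'"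
      using snoc.prems(2) without_backtracking_snoc[of p e] snoc by simp_all
    from wb(2) have "x \<noteq> inv y" using e e' b(3) by (auto simp: edge_rev_def)
    then have "\<not> child (st k) y"
      using child_successor[of k y x] ky hx a(3) b(3) by auto
    then show ?thesis
      using snoc.IH[OF a(1) wb(1)] snoc e' w by simp
  qed
qed simp

text \<open>By the two length lemmas a closed walk must start towards the root and end away from it,
  so both its second and its last but one vertex are the parent of \<open>u\<close>. They coincide
  only in a walk of length two, which backtracks; otherwise a vertex is repeated.\<close>

lemma cycle_backtracks: "\<not> (pre_digraph.cycle the_tree p \<and> without_backtracking G p)"
proof
  assume cyc: "pre_digraph.cycle the_tree p \<and> without_backtracking G p"
  then obtain u where u: "tree_walk u p u" "p \<noteq> []"
      "distinct (tl (pre_digraph.awalk_verts the_tree u p))"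
    by (auto simp: pre_digraph.cycle_def)
  have desc: "\<not> child_arc (hd p)" using length_descending[OF u(1) _ u(2)] cyc u(2) by auto
  have asc: "child_arc (last p)" using length_ascending[OF u(1) _ u(2)] cyc u(2) by auto
  obtain p' h y where p': "p = p' @ [(h, y)]" using u(2) by (metis rev_exhaust surj_pair)
  note a = awalk_the_tree_snoc[OF u(1)[unfolded p']]
  have hy: "h \<in> carrier G" "y \<in> X" "child (st h) y" using a(2) asc p' by (auto simp: tree_arcs_def)
  obtain x p'' where p'': "p' = (u, x) # p''"
  proof (cases p')
    case Nil
    then show ?thesis using desc asc p' by simp
  next
    case (Cons e q)
    then show ?thesis using a(1) that
      by (cases e) (auto simp: pre_digraph.awalk_def pre_digraph.cas.simps)
  qed
  have x: "u \<in> carrier G" "x \<in> X" "child (st (u \<otimes> x)) (inv x)"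
    using u(1) desc p' p'' by (auto simp: pre_digraph.awalk_def tree_arcs_def)
  have "word_of h @ [y] = word_of (u \<otimes> x) @ [inv x]"
    using word_of_asc[OF x] word_of_snoc[OF hy] a(3) by simp
  then have yx: "y = inv x" by simp
  then have h: "h = u \<otimes> x" using a(3) hy x X_carrier by (simp add: right_cancel_inv')
  show False
  proof (cases p'' rule: rev_cases)
    case Nil
    then show ?thesis using cyc p' p'' yx h
      by (simp add: without_backtracking_def edge_rev_def)
  next
    case (snoc q e)
    have "fst e \<otimes> snd e = h"
      using a(1) p'' snoc cas_append_the_tree[of u "(u, x) # q" e h] by (simp add: pre_digraph.awalk_def)
    moreover have "pre_digraph.awalk_verts the_tree v (q @ [e]) =
        map fst (q @ [e]) @ [fst e \<otimes> snd e]" for v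
      by (cases e) (simp add: pre_digraph.awalk_verts_conv)
    moreover have "tl (pre_digraph.awalk_verts the_tree u p) =
        pre_digraph.awalk_verts the_tree (u \<otimes> x) (q @ [e] @ [(h, y)])"
      using p' p'' snoc by (simp add: pre_digraph.awalk_verts.simps)
    moreover have "pre_digraph.awalk_verts the_tree (u \<otimes> x) (q @ [e] @ [(h, y)]) =
       map fst (q @ [e]) @ [h, h \<otimes> y]"
      by (simp add: pre_digraph.awalk_verts_conv)
    moreover have "hd (map fst (q @ [e])) = u \<otimes> x"
      using a(1) p'' snoc by (cases q) (auto simp: pre_digraph.awalk_def pre_digraph.cas.simps)
    then have "h \<in> set (map fst (q @ [e]))"
      using h by (metis hd_in_set map_is_Nil_conv snoc_eq_iff_butlast)
    ultimately show False using u(3) by auto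
  qed
qed

lemma connected_the_tree: "Digraph_Component.connected the_tree"
proof -
  interpret T: wf_digraph the_tree by (rule wf_the_tree)
  have adj: "g \<rightarrow>\<^sup>*\<^bsub>the_tree\<^esub> (g \<otimes> x)" if "(g, x) \<in> tree_arcs" for g x
    using that by (intro T.reachable_adjI) (force simp: arcs_ends_def arc_to_ends_def)
  have reach: "g \<rightarrow>\<^sup>*\<^bsub>the_tree\<^esub> h" if "(g, h) \<in> tree_conn" "g \<in> carrier G" for g h
    using that(1) unfolding tree_conn_def
  proof (induction rule: rtrancl_induct)
    case base
    then show ?case using that(2) by simp
  next
    case (step h k)
    then show ?case using adj T.reachable_trans by blast
  qed
  have one: "\<one> \<rightarrow>\<^sup>*\<^bsub>the_tree\<^esub> g" if "g \<in> carrier G" for g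
    using reach conn_from_one that by simp
  have sym: "symmetric the_tree"
    unfolding symmetric_def
  proof (rule symI)
    fix a b assume "(a, b) \<in> arcs_ends the_tree"
    then obtain g x where gx: "(g, x) \<in> tree_arcs" "a = g" "b = g \<otimes> x"
      by (auto simp: arcs_ends_def arc_to_ends_def)
    have "(g \<otimes> x, inv x) \<in> tree_arcs" using tree_arcs_rev[OF gx(1)] by (simp add: edge_rev_def)
    moreover have "g \<otimes> x \<otimes> inv x = g" using gx(1) by (auto simp: tree_arcs_def right_cancel_inv)
    ultimately show "(b, a) \<in> arcs_ends the_tree"
      using gx by (force simp: arcs_ends_def arc_to_ends_def)
  qed
  then have "g \<rightarrow>\<^sup>*\<^bsub>the_tree\<^esub> h" if "g \<in> carrier G" "h \<in> carrier G" for g h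
    using one that symmetric_reachable[OF sym] T.reachable_trans by metis
  then have "strongly_connected the_tree" by (auto simp: strongly_connected_def)
  then show ?thesis
    using T.reachable_mk_symmetric_eq[OF sym] by (intro T.connectedI) (auto simp: strongly_connected_def)
qed

theorem maximal_tree_the_tree: "maximal_tree G X the_tree"
  unfolding maximal_tree_def spanning_def subgraph_def compatible_def
  using wf_cayley_graph wf_the_tree tree_arcs_subset tree_arcs_rev connected_the_tree cycle_backtracks
  by simp

section \<open>The flow function and its graph\<close>

lemma awalk_edge_path_cayley:
  assumes "g \<in> carrier G" "w \<in> lists X"
  shows "pre_digraph.awalk (cayley_graph G X) g (edge_path G g w) (foldl (\<otimes>) g w)"
proof -
  have "pre_digraph.cas (cayley_graph G X) g (edge_path G g w) (foldl (\<otimes>) g w)"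
    by (induction w arbitrary: g) (auto simp: pre_digraph.cas.simps)
  then show ?thesis using assms edge_path_arcs by (simp add: pre_digraph.awalk_def)
qed

theorem flow_function_the_flow: "flow_function G X the_tree the_flow"
proof -
  have "flow_less G X the_tree the_flow \<subseteq> r"
  proof
    fix z assume "z \<in> flow_less G X the_tree the_flow"
    then obtain h y g x where z: "z = ((h, y), (g, x))" "g \<in> carrier G" "x \<in> X"
        "(h, y) \<in> set (edge_path G g (fl (st g) x))" "(g, x) \<notin> tree_arcs" "(h, y) \<notin> tree_arcs"
      by (auto simp: flow_less_def the_flow_def)
    then have "h \<in> carrier G" "y \<in> X" using edge_path_arcs[OF z(2) fl_lists] by auto
    then show "z \<in> r" using z fl_less by (auto simp: tree_arcs_def)
  qed
  then have "wf (flow_less G X the_tree the_flow)" using wf_r wf_subset by blast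
  then have "wf ((flow_less G X the_tree the_flow)\<^sup>+)" by (rule wf_trancl)
  moreover from this have "irrefl ((flow_less G X the_tree the_flow)\<^sup>+)"
    by (auto simp: irrefl_def)
  moreover have "pre_digraph.awalk (cayley_graph G X) g (the_flow (g, x)) (g \<otimes> x)"
    if "g \<in> carrier G" "x \<in> X" for g x
    using that awalk_edge_path_cayley[of g "fl (st g) x"] fl_lists fl_value
    by (simp add: the_flow_def)
  moreover have "the_flow e = [e]" if "e \<in> tree_arcs" for e
    using that fl_tree by (auto simp: the_flow_def tree_arcs_def)
  ultimately show ?thesis
    by (simp add: flow_function_def Let_def split: prod.splits)
qed

theorem bounded_flow_the_flow: "bounded_flow G X the_flow"
proof -
  let ?A = "(\<lambda>(s, x). length (fl s x)) ` (st ` carrier G \<times> X)"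
  have "finite ?A" using finite_states finite_X by simp
  then have "length (the_flow e) \<le> Max ?A" if "e \<in> carrier G \<times> X" for e
    using that by (intro Max_ge) (auto simp: the_flow_def)
  then show ?thesis by (auto simp: bounded_flow_def)
qed

theorem stacking_graph_the_flow:
  "stacking_graph G X the_tree the_flow =
     {[w, [x], fl (foldl step (st \<one>) w) x] | w x. desc w \<and> x \<in> X}"
proof -
  have inj: "inj_on (nf G the_tree) (carrier G)"
    by (rule inj_on_inverseI[where g = val]) (simp add: nf_the_tree word_of)
  have "stacking_map G the_tree the_flow (word_of g) x = fl (foldl step (st \<one>) (word_of g)) x"
    if "g \<in> carrier G" for g x
    using that inv_into_f_f[OF inj that] st_val[of "word_of g"] word_of[OF that] nf_the_tree
    by (simp add: stacking_map_def the_flow_def)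
  then have "stacking_graph G X the_tree the_flow =
    {[word_of g, [x], fl (foldl step (st \<one>) (word_of g)) x] | g x. g \<in> carrier G \<and> x \<in> X}"
    by (auto simp: stacking_graph_def nf_the_tree; metis nf_the_tree)
  also have "\<dots> = {[w, [x], fl (foldl step (st \<one>) w) x] | w x. desc w \<and> x \<in> X}"
    by (auto, metis word_of, metis val_carrier word_of_val)
  finally show ?thesis .
qed

theorem stackable_over: "autostackable_over G X" "algorithmically_stackable_over G X"
proof -
  let ?L = "{[w, [x], fl (foldl step (st \<one>) w) x] | w x. desc w \<and> x \<in> X}"
  have closed: "step s x \<in> st ` carrier G" if s: "s \<in> st ` carrier G" and x: "x \<in> X" "child s x" for s x
  proof -
    obtain g where g: "g \<in> carrier G" "s = st g" using s by (rule imageE)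
    then have "step s x = st (g \<otimes> x)" using step_st[OF g(1) x(1)] x(2) by simp
    then show ?thesis using g(1) X_carrier[OF x(1)] by simp
  qed
  have fl: "fl s x \<in> lists X" if "s \<in> st ` carrier G" "x \<in> X" for s x
    using that(1) fl_lists[OF _ that(2)] by (elim imageE) simp
  have one: "st \<one> \<in> st ` carrier G" by simp
  have "synchronously_regular X 3 ?L"
    by (rule synchronously_regular_finite_state[OF finite_X finite_states one]) (rule closed fl; assumption)+
  then show "autostackable_over G X"
    unfolding autostackable_over_def stacking_graph_the_flow[symmetric]
    using maximal_tree_the_tree flow_function_the_flow bounded_flow_the_flow by blast
  have "decidable_tuples X 3 ?L"
    by (rule decidable_tuples_finite_state[OF finite_X finite_states one]) (rule closed fl; assumption)+
  then show "algorithmically_stackable_over G X"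
    unfolding algorithmically_stackable_over_def stacking_graph_the_flow[symmetric]
    using maximal_tree_the_tree flow_function_the_flow bounded_flow_the_flow by blast
qed

end

section \<open>Expansions at infinity\<close>

text \<open>The binomial coefficient with arbitrary integer upper index, by upper negation for
  negative \<open>j\<close>.\<close>

definition bin :: "int \<Rightarrow> nat \<Rightarrow> int" where
  "bin j k = (if 0 \<le> j then int (nat j choose k) else (-1) ^ k * int ((nat (- j) + k - 1) choose k))"

lemma bin_0 [simp]: "bin j 0 = 1"
  by (simp add: bin_def)

lemma bin_Pascal: "bin j (Suc k) + bin j k = bin (j + 1) (Suc k)"
proof -
  consider "0 \<le> j" | "j = -1" | "j \<le> -2" by linarith
  then show ?thesis
  proof cases
    case 1
    then have "nat (j + 1) = Suc (nat j)" by simp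
    then show ?thesis using 1 by (simp add: bin_def)
  next
    case 2
    then show ?thesis by (simp add: bin_def)
  next
    case 3
    define n where "n = nat (- j) - 2"
    have n: "nat (- j) = Suc (Suc n)" "nat (- (j + 1)) = Suc n" using 3 by (auto simp: n_def)
    have "bin j (Suc k) + bin j k = (-1) ^ k * (int (Suc n + k choose k) - int (Suc (Suc n + k) choose Suc k))"
      using 3 n by (simp add: bin_def algebra_simps)
    also have "\<dots> = (-1) ^ Suc k * int (Suc n + k choose Suc k)" by (simp add: algebra_simps)
    also have "\<dots> = bin (j + 1) (Suc k)" using 3 n by (simp add: bin_def)
    finally show ?thesis .
  qed
qed

text \<open>The coefficient of \<open>x\<^sup>n\<close> in the expansion of \<open>x\<^sup>i (1 + x)\<^sup>j\<close> at infinity.\<close>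

definition mono_coeff :: "int \<Rightarrow> int \<Rightarrow> int \<Rightarrow> int" where
  "mono_coeff i j n = (if n \<le> i + j then bin j (nat (i + j - n)) else 0)"

lemma mono_coeff_above: "i + j < n \<Longrightarrow> mono_coeff i j n = 0"
  by (simp add: mono_coeff_def)

lemma mono_coeff_top [simp]: "mono_coeff i j (i + j) = 1"
  by (simp add: mono_coeff_def)

text \<open>Pascal's rule for integer upper index. This is the relation between the conjugates of
  \<open>a\<close> by \<open>s\<close> and \<open>t\<close>, seen in the coefficients.\<close>

lemma mono_coeff_triangle: "mono_coeff i j n + mono_coeff (i + 1) j n = mono_coeff i (j + 1) n"
proof (cases "n \<le> i + j")
  case True
  then have "nat (i + 1 + j - n) = Suc (nat (i + j - n))" "nat (i + (j + 1) - n) = Suc (nat (i + j - n))"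
    by auto
  then show ?thesis using True bin_Pascal[of j "nat (i + j - n)"] by (simp add: mono_coeff_def)
next
  case False
  then show ?thesis by (auto simp: mono_coeff_def)
qed

lemma mono_coeff_shift: "mono_coeff (i + 1) j n = mono_coeff i j (n - 1)"
  by (auto simp: mono_coeff_def algebra_simps)

definition mult_1x :: "(int \<Rightarrow> int) \<Rightarrow> int \<Rightarrow> int" where
  "mult_1x f n = f n + f (n - 1)"

lemma mult_1x_mono: "mult_1x (mono_coeff i j) = mono_coeff i (j + 1)"
  by (rule ext) (simp add: mult_1x_def mono_coeff_triangle flip: mono_coeff_shift)

lemma mult_1x_pow_mono: "(mult_1x ^^ q) (mono_coeff i j) = mono_coeff i (j + int q)"
  by (induction q) (simp_all add: mult_1x_mono algebra_simps)

lemma mult_1x_pow_lin: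
  "(mult_1x ^^ q) (\<lambda>n. f n + c * g n) n = (mult_1x ^^ q) f n + c * (mult_1x ^^ q) g n"
  by (induction q arbitrary: n) (simp_all add: mult_1x_def algebra_simps)

definition alt :: "int \<Rightarrow> int" where
  "alt n = (if even n then 1 else -1)"

lemma alt_diff: "alt (m - n) = alt m * alt n"
  and alt_sq [simp]: "alt n * alt n = 1" "alt n * (alt n * c) = c"
  and alt_0 [simp]: "alt 0 = 1" and alt_1 [simp]: "alt 1 = -1"
  by (auto simp: alt_def)

lemma neg_one_power_nat: "0 \<le> k \<Longrightarrow> (-1) ^ nat k = alt k"
  by (auto simp: alt_def even_nat_iff minus_one_power_iff)

lemma eventually_mono_coeff_0: "0 \<le> j \<Longrightarrow> eventually (\<lambda>n. mono_coeff i j n = 0) at_bot"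
  unfolding eventually_at_bot_linorder
  by (rule exI[of _ "i - 1"]) (auto simp: mono_coeff_def bin_def nat_diff_distrib' binomial_eq_0)

text \<open>The geometric series x^i / (1 + x) = x^(i-1) - x^(i-2) + ..., which fixes the signs in
  the definition of \<open>polar\<close>.\<close>

lemma eventually_mono_coeff_neg1: "eventually (\<lambda>n. mono_coeff i (-1) n = - alt i * alt n) at_bot"
  unfolding eventually_at_bot_linorder
  by (rule exI[of _ "i - 1"])
    (auto simp: mono_coeff_def bin_def neg_one_power_nat alt_diff)

section \<open>Coefficients modulo \<open>p\<close>\<close>

text \<open>For \<open>p = 0\<close> the coefficients are integers, since \<open>c mod 0 = c\<close>. The generators are then only
  \<open>a\<close> and its inverse, whereas for \<open>p > 0\<close> all nontrivial powers of \<open>a\<close> are used.\<close>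

locale modulus = fixes p :: nat
begin

abbreviation md :: "int \<Rightarrow> int" where "md c \<equiv> c mod int p"

definition torsion_free :: bool where
  "torsion_free \<longleftrightarrow> p = 0"

definition digits :: "int set" where
  "digits = (if torsion_free then {1, -1} else {1..<int p})"

text \<open>The number of letters that the normal form spends on a leading coefficient
  \<open>c\<close>.\<close>

definition cnorm :: "int \<Rightarrow> nat" where
  "cnorm c = (if torsion_free then nat \<bar>c\<bar> else if md c = 0 then 0 else 1)"

text \<open>The letter with which the normal form builds the coefficient \<open>c\<close>. Over the
  integers this letter is repeated, and the state can keep only the sign.\<close>

definition dig :: "int \<Rightarrow> int" where
  "dig c = (if torsion_free then sgn c else c)"

lemma md_torsion_free: "torsion_free \<Longrightarrow> md c = c"
  by (simp add: torsion_free_def)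

lemma md_bounds: "\<not> torsion_free \<Longrightarrow> 0 \<le> md c \<and> md c < int p"
  by (simp add: torsion_free_def)

lemma cnorm_md [simp]: "cnorm (md c) = cnorm c"
  by (simp add: cnorm_def md_torsion_free)

lemma cnorm_neg [simp]: "cnorm (- c) = cnorm c"
  by (simp add: cnorm_def mod_eq_0_iff_dvd)

lemma cnorm_alt [simp]: "cnorm (alt n * c) = cnorm c"
  by (simp add: alt_def)

lemma cnorm_eq_0: "cnorm c = 0 \<longleftrightarrow> md c = 0"
  by (auto simp: cnorm_def md_torsion_free)

lemma digit_nonzero: "e \<in> digits \<Longrightarrow> md e \<noteq> 0"
  and digit_md: "e \<in> digits \<Longrightarrow> md e = e"
  and cnorm_digit: "e \<in> digits \<Longrightarrow> cnorm e = 1"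
  and dig_digit: "e \<in> digits \<Longrightarrow> dig e = e"
  by (auto simp: digits_def cnorm_def dig_def md_torsion_free split: if_splits)

lemma digit_neg: "e \<in> digits \<Longrightarrow> md (- e) \<in> digits"
proof (cases torsion_free)
  case False
  then show "e \<in> digits \<Longrightarrow> md (- e) \<in> digits" by (auto simp: digits_def zmod_zminus1_eq_if)
qed (auto simp: digits_def md_torsion_free)

lemma dig_in_digits: "\<lbrakk>md c = c; c \<noteq> 0\<rbrakk> \<Longrightarrow> dig c \<in> digits"
proof -
  assume c: "md c = c" "c \<noteq> 0"
  show ?thesis
  proof (cases torsion_free)
    case True
    then show ?thesis using c by (auto simp: dig_def digits_def sgn_if)
  next
    case False
    then show ?thesis using c md_bounds[of c] by (simp add: dig_def digits_def)
  qed
qed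

text \<open>Such a letter \<open>e\<close> undoes the last letter spent on the coefficient
  \<open>c\<close>.\<close>

lemma down:
  assumes "md c = c" "c \<noteq> 0" "e \<in> digits" "e = md (- dig c)"
  shows "cnorm (c + e) < cnorm c"
    "md (c + e) = 0 \<or> torsion_free \<and> c + e \<noteq> 0 \<and> dig (c + e) = dig c"
proof -
  have "cnorm (c + e) < cnorm c \<and> (md (c + e) = 0 \<or> torsion_free \<and> c + e \<noteq> 0 \<and> dig (c + e) = dig c)"
  proof (cases torsion_free)
    case True
    then show ?thesis using assms by (auto simp: cnorm_def dig_def sgn_if digits_def md_torsion_free)
  next
    case False
    then have "md (c + e) = 0" using assms by (simp add: dig_def mod_simps)
    then show ?thesis using False assms by (simp add: cnorm_def)
  qed
  then show "cnorm (c + e) < cnorm c"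
    "md (c + e) = 0 \<or> torsion_free \<and> c + e \<noteq> 0 \<and> dig (c + e) = dig c"
    by blast+
qed

text \<open>Over the integers the only other letter is the sign of \<open>c\<close>, so the norm
  grows; modulo a positive \<open>p\<close> the sum is again a nonzero residue. The bound on
  \<open>c - e\<close> is for triangles that first subtract \<open>e\<close> from the leading
  coefficient.\<close>

lemma not_down:
  assumes "md c = c" "c \<noteq> 0" "e \<in> digits" "e \<noteq> md (- dig c)"
  shows "cnorm (c - e) \<le> cnorm c"
    "torsion_free \<Longrightarrow> cnorm c < cnorm (c + e) \<and> c + e \<noteq> 0 \<and> dig (c + e) = e \<and> dig c = e"
    "\<not> torsion_free \<Longrightarrow> cnorm c = 1 \<and> cnorm (c + e) = 1"
proof -
  show "cnorm (c - e) \<le> cnorm c"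
    using assms by (auto simp: cnorm_def dig_def sgn_if digits_def md_torsion_free split: if_splits)
  show "torsion_free \<Longrightarrow> cnorm c < cnorm (c + e) \<and> c + e \<noteq> 0 \<and> dig (c + e) = e \<and> dig c = e"
    using assms by (auto simp: cnorm_def dig_def sgn_if digits_def md_torsion_free split: if_splits)
  show "cnorm c = 1 \<and> cnorm (c + e) = 1" if "\<not> torsion_free"
  proof -
    have "md (c + e) \<noteq> 0"
    proof
      assume "md (c + e) = 0"
      then have "md e = md (- c)"
        by (metis add_diff_cancel_left' diff_0 mod_diff_left_eq)
      then show False using assms that digit_md by (simp add: dig_def)
    qed
    then show ?thesis using assms that by (simp add: cnorm_def)
  qed
qed

section \<open>Poles at \<open>x = -1\<close>\<close>

text \<open>A function that vanishes near \<open>+\<infinity>\<close> is the expansion at infinity of a Laurent polynomial in \<open>x\<close>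
  iff it also vanishes near \<open>-\<infinity>\<close>. Multiplication by \<open>1 + x\<close> lowers the pole order at \<open>-1\<close>; a simple
  pole there shows as an eventually alternating function.\<close>

definition pole_le :: "(int \<Rightarrow> int) \<Rightarrow> nat \<Rightarrow> bool" where
  "pole_le f q \<longleftrightarrow> eventually (\<lambda>n. md ((mult_1x ^^ q) f n) = 0) at_bot"

text \<open>\<open>k\<close> is the coefficient of \<open>f\<close> at the pole of order \<open>q + 1\<close>, relative to \<open>x\<^sup>i (1 + x)\<^sup>-\<^sup>q\<^sup>-\<^sup>1\<close>.\<close>

definition polar :: "(int \<Rightarrow> int) \<Rightarrow> nat \<Rightarrow> int \<Rightarrow> int \<Rightarrow> bool" where
  "polar f q i k \<longleftrightarrow> eventually (\<lambda>n. md ((mult_1x ^^ q) f n) = md (- k * alt i * alt n)) at_bot"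

lemma polar_0: "polar f q i 0 \<longleftrightarrow> pole_le f q"
  by (simp add: polar_def pole_le_def)

lemma polar_cong: "md k = md k' \<Longrightarrow> polar f q i k \<Longrightarrow> polar f q i k'"
proof -
  assume "md k = md k'"
  then have "md (- k * alt i * alt n) = md (- k' * alt i * alt n)" for n
    by (metis (no_types) mod_minus_eq mod_mult_left_eq)
  then show "polar f q i k \<Longrightarrow> polar f q i k'" by (simp add: polar_def)
qed

lemma polar_unique: "polar f q i k \<Longrightarrow> polar f q i k' \<Longrightarrow> md k = md k'"
proof -
  assume "polar f q i k" "polar f q i k'"
  then have "eventually (\<lambda>n. md (- k * alt i * alt n) = md (- k' * alt i * alt n)) at_bot"
    unfolding polar_def by eventually_elim simp
  then obtain n where "md (- k * alt i * alt n) = md (- k' * alt i * alt n)"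
    by (auto simp: eventually_at_bot_linorder)
  then have "md (- k * alt i * alt n * (- alt i * alt n)) = md (- k' * alt i * alt n * (- alt i * alt n))"
    by (metis mod_mult_left_eq)
  then show ?thesis by (simp add: mult.assoc mult.left_commute)
qed

text \<open>At the pole \<open>x\<close> has the value -1, so shifting the reference column by one
  changes the sign of the coefficient.\<close>

lemma polar_column: "polar f q i k \<Longrightarrow> polar f q i' (alt (i' - i) * k)"
  by (simp add: polar_def alt_diff mult_ac)

lemma polar_pole_le_Suc: "polar f q i k \<Longrightarrow> pole_le f (Suc q)"
proof -
  assume "polar f q i k"
  then obtain N where N: "\<And>n. n \<le> N \<Longrightarrow> md ((mult_1x ^^ q) f n) = md (- k * alt i * alt n)"
    unfolding polar_def eventually_at_bot_linorder by blast
  have "md ((mult_1x ^^ Suc q) f n) = 0" if "n \<le> N" for n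
  proof -
    have "md ((mult_1x ^^ Suc q) f n) = md ((mult_1x ^^ q) f n + (mult_1x ^^ q) f (n - 1))"
      by (simp add: mult_1x_def)
    also have "\<dots> = md (- k * alt i * alt n + - k * alt i * alt (n - 1))"
      using that by (intro mod_add_cong N) simp_all
    finally show ?thesis by (simp add: alt_diff)
  qed
  then show ?thesis by (auto simp: pole_le_def eventually_at_bot_linorder)
qed

lemma pole_le_mono: "pole_le f q \<Longrightarrow> q \<le> q' \<Longrightarrow> pole_le f q'"
proof -
  assume f: "pole_le f q" and "q \<le> q'"
  from this(2) show ?thesis
    by (induction rule: dec_induct) (use f polar_pole_le_Suc polar_0[of f _ 0] in blast)+
qed

text \<open>If (1 + x) g vanishes near minus infinity, then \<open>g (n - 1) = - g n\<close> there.
  So \<open>g\<close> alternates, and one value of it determines \<open>k\<close>.\<close>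

lemma ex_polar: "pole_le f (Suc q) \<Longrightarrow> \<exists>k. md k = k \<and> polar f q i k"
proof -
  assume "pole_le f (Suc q)"
  then obtain N where N: "\<And>n. n \<le> N \<Longrightarrow> md ((mult_1x ^^ Suc q) f n) = 0"
    by (auto simp: pole_le_def eventually_at_bot_linorder)
  let ?g = "(mult_1x ^^ q) f"
  define k where "k = md (- ?g N * alt N * alt i)"
  have "md (?g n) = md (?g N * alt N * alt n)" if "n \<le> N" for n
    using that
  proof (induction n rule: int_le_induct)
    case base
    then show ?case by (simp add: mult.assoc)
  next
    case (step n)
    have "md (?g n + ?g (n - 1)) = 0" using N[of n] step by (simp add: mult_1x_def)
    then have "md (?g (n - 1)) = md (- ?g n)"
      by (metis add_diff_cancel_left' diff_0 mod_diff_left_eq)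
    also have "\<dots> = md (- (?g N * alt N * alt n))" using step by (metis mod_minus_eq)
    finally show ?case by (simp add: alt_diff)
  qed
  moreover have "md (- k * alt i * alt n) = md (?g N * alt N * alt n)" for n
  proof -
    have "md (- k * alt i * alt n) = md (- (- ?g N * alt N * alt i) * alt i * alt n)"
      unfolding k_def by (metis (no_types) mod_minus_eq mod_mult_left_eq)
    then show ?thesis by (simp add: mult_ac)
  qed
  ultimately have "polar f q i k" by (auto simp: polar_def eventually_at_bot_linorder)
  moreover have "md k = k" by (simp add: k_def)
  ultimately show ?thesis by blast
qed

definition add_mono :: "(int \<Rightarrow> int) \<Rightarrow> int \<Rightarrow> int \<Rightarrow> int \<Rightarrow> int \<Rightarrow> int" where
  "add_mono f e i j = (\<lambda>n. md (f n + e * mono_coeff i j n))"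

lemma mult_1x_pow_cong:
  "(\<And>n. md (f n) = md (g n)) \<Longrightarrow> md ((mult_1x ^^ q) f n) = md ((mult_1x ^^ q) g n)"
  by (induction q arbitrary: n) (auto simp: mult_1x_def intro: mod_add_cong)

lemma mult_1x_pow_add_mono:
  "md ((mult_1x ^^ q) (add_mono f e i j) n) = md ((mult_1x ^^ q) f n + e * mono_coeff i (j + int q) n)"
proof -
  have "md ((mult_1x ^^ q) (add_mono f e i j) n) = md ((mult_1x ^^ q) (\<lambda>n. f n + e * mono_coeff i j n) n)"
    by (rule mult_1x_pow_cong) (simp add: add_mono_def)
  then show ?thesis by (simp add: mult_1x_pow_lin mult_1x_pow_mono)
qed

text \<open>The added monomial has pole order at most \<open>q\<close>, so the coefficient at order
  \<open>q + 1\<close> does not see it.\<close>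

lemma polar_add_inner:
  assumes "polar f q i k" "- int q \<le> j"
  shows "polar (add_mono f e i' j) q i k"
proof -
  have "eventually (\<lambda>n. mono_coeff i' (j + int q) n = 0) at_bot"
    using assms by (intro eventually_mono_coeff_0) simp
  with assms(1) show ?thesis
    unfolding polar_def by eventually_elim (simp add: mult_1x_pow_add_mono)
qed

lemma polar_add_line:
  assumes "polar f q i k" "j = - int q - 1"
  shows "polar (add_mono f e i' j) q i (k + e * alt (i' - i))"
proof -
  have "j + int q = -1" using assms by simp
  from assms(1) eventually_mono_coeff_neg1[of i'] show ?thesis
    unfolding polar_def
  proof eventually_elim
    case (elim n)
    have "md ((mult_1x ^^ q) (add_mono f e i' j) n) = md (- k * alt i * alt n + e * (- alt i' * alt n))"
      using elim \<open>j + int q = -1\<close> by (metis mod_add_left_eq mult_1x_pow_add_mono)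
    moreover define z where "z = k + e * alt (i' - i)"
    have "alt (i' - i) * alt i = alt i'" by (simp add: alt_diff)
    then have "k * alt i * alt n + e * (alt i' * alt n) = z * alt i * alt n"
      unfolding z_def by (metis (no_types) distrib_right mult.assoc)
    then have "- k * alt i * alt n + e * (- alt i' * alt n) = - z * alt i * alt n"
      by simp
    ultimately show ?case by (simp only: z_def)
  qed
qed

lemma pole_le_add: "\<lbrakk>pole_le f q; - int q \<le> j\<rbrakk> \<Longrightarrow> pole_le (add_mono f e i j) q"
  using polar_add_inner[of f q 0 0 j e i] by (simp add: polar_0)

definition pole_order :: "(int \<Rightarrow> int) \<Rightarrow> nat" where
  "pole_order f = (LEAST q. pole_le f q)"

definition polar_coeff :: "(int \<Rightarrow> int) \<Rightarrow> nat \<Rightarrow> int \<Rightarrow> int" where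
  "polar_coeff f q i = (THE k. md k = k \<and> polar f q i k)"

lemma polar_coeff_eq: "polar f q i k \<Longrightarrow> polar_coeff f q i = md k"
  unfolding polar_coeff_def
  by (rule the_equality) (auto intro: polar_cong[of k "md k"] dest: polar_unique)

lemma polar_polar_coeff:
  assumes "pole_le f (Suc q)"
  shows "polar f q i (polar_coeff f q i)" "md (polar_coeff f q i) = polar_coeff f q i"
  using ex_polar[OF assms, of i] polar_coeff_eq by fastforce+

lemma pole_order_le: "pole_le f q \<Longrightarrow> pole_order f \<le> q"
  unfolding pole_order_def by (rule Least_le)

lemma pole_le_pole_order: "pole_le f q \<Longrightarrow> pole_le f (pole_order f)"
  unfolding pole_order_def by (rule LeastI)

lemma pole_order_eqI:
  assumes "polar f q i k" "md k \<noteq> 0"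
  shows "pole_order f = Suc q"
proof -
  have "pole_le f (Suc q)" using assms polar_pole_le_Suc by blast
  moreover have "\<not> pole_le f q'" if "q' \<le> q" for q'
  proof
    assume "pole_le f q'"
    then have "polar f q i 0" using pole_le_mono that polar_0 by blast
    then show False using polar_unique assms by fastforce
  qed
  ultimately show ?thesis
    using pole_order_le pole_le_pole_order by (metis le_antisym not_less_eq_eq)
qed

lemma polar_coeff_nonzero:
  assumes "pole_le f Q" "pole_order f = Suc q"
  shows "polar_coeff f q i \<noteq> 0"
proof
  assume "polar_coeff f q i = 0"
  then have "pole_le f q"
    using polar_polar_coeff(1)[of f q i] pole_le_pole_order[OF assms(1)] assms(2) polar_0[of f q i] by simp
  then show False using pole_order_le assms(2) by fastforce
qed

section \<open>Degrees\<close>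

definition has_deg :: "(int \<Rightarrow> int) \<Rightarrow> int \<Rightarrow> bool" where
  "has_deg f M \<longleftrightarrow> f M \<noteq> 0 \<and> (\<forall>n>M. f n = 0)"

text \<open>The default 0 matters: positions in the plane of the zero function are measured from the
  root, which thereby gets the state \<open>(0, 0, 0, 0)\<close>.\<close>

definition fdeg :: "(int \<Rightarrow> int) \<Rightarrow> int" where
  "fdeg f = (if \<exists>M. has_deg f M then THE M. has_deg f M else 0)"

lemma has_deg_unique: "has_deg f M \<Longrightarrow> has_deg f N \<Longrightarrow> M = N"
  unfolding has_deg_def by (meson linorder_neqE_linordered_idom)

lemma fdeg_eq: "has_deg f M \<Longrightarrow> fdeg f = M"
  unfolding fdeg_def using has_deg_unique by (metis the_equality)

lemma fdeg_zero: "fdeg (\<lambda>n. 0) = 0"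
  by (simp add: fdeg_def has_deg_def)

definition expansion :: "(int \<Rightarrow> int) \<Rightarrow> bool" where
  "expansion f \<longleftrightarrow> (\<forall>n. md (f n) = f n) \<and> (\<exists>M. \<forall>n>M. f n = 0) \<and> (\<exists>q. pole_le f q)"

lemma expansion_md: "expansion f \<Longrightarrow> md (f n) = f n"
  by (simp add: expansion_def)

lemma expansion_pole_le: "expansion f \<Longrightarrow> pole_le f (pole_order f)"
  using pole_le_pole_order by (auto simp: expansion_def)

lemma expansion_zero: "expansion (\<lambda>n. 0)"
proof -
  have "pole_le (\<lambda>n. 0) 0" by (simp add: pole_le_def)
  then show ?thesis by (auto simp: expansion_def)
qed

lemma pole_order_zero: "pole_order (\<lambda>n. 0) = 0"
  using pole_order_le[of "\<lambda>n. 0" 0] by (simp add: pole_le_def)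

lemma has_deg_fdeg:
  assumes "expansion f" "f \<noteq> (\<lambda>n. 0)"
  shows "has_deg f (fdeg f)"
proof -
  obtain N where N: "\<And>n. n > N \<Longrightarrow> f n = 0" using assms(1) by (auto simp: expansion_def)
  obtain m where m: "f m \<noteq> 0" using assms(2) by auto
  have "m \<le> N" using N m by (meson not_le)
  have fin: "finite {n \<in> {m..N}. f n \<noteq> 0}" by (rule finite_subset[of _ "{m..N}"]) auto
  define M where "M = Max {n \<in> {m..N}. f n \<noteq> 0}"
  have "M \<in> {n \<in> {m..N}. f n \<noteq> 0}"
    unfolding M_def using m \<open>m \<le> N\<close> by (intro Max_in fin) auto
  moreover have "f n = 0" if "n > M" for n
  proof (rule ccontr)
    assume "f n \<noteq> 0"
    then have "n \<in> {n \<in> {m..N}. f n \<noteq> 0}"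
      using N that \<open>M \<in> _\<close> by (auto simp: not_less[symmetric])
    then show False using Max_ge[OF fin] that by (fastforce simp: M_def)
  qed
  ultimately have "has_deg f M" by (simp add: has_deg_def)
  then show ?thesis using fdeg_eq by simp
qed

lemma expansion_add:
  assumes "expansion f"
  shows "expansion (add_mono f e i j)"
proof -
  obtain N where N: "\<And>n. n > N \<Longrightarrow> f n = 0" using assms by (auto simp: expansion_def)
  obtain q where q: "pole_le f q" using assms by (auto simp: expansion_def)
  have "add_mono f e i j n = 0" if "n > max N (i + j)" for n
    using that N by (simp add: add_mono_def mono_coeff_above)
  moreover have "pole_le (add_mono f e i j) (max q (nat (- j)))"
    by (rule pole_le_add[OF pole_le_mono[OF q]]) auto
  moreover have "md (add_mono f e i j n) = add_mono f e i j n" for n by (simp add: add_mono_def)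
  ultimately show ?thesis unfolding expansion_def by blast
qed

lemma add_mono_above: "\<lbrakk>expansion f; i + j < n\<rbrakk> \<Longrightarrow> add_mono f e i j n = f n"
  by (simp add: add_mono_def mono_coeff_above expansion_md)

lemma add_mono_top: "i + j = n \<Longrightarrow> add_mono f e i j n = md (f n + e)"
  by (auto simp: add_mono_def)

lemma add_mono_add_mono:
  "add_mono (add_mono f e i j) e' i' j' = (\<lambda>n. md (f n + e * mono_coeff i j n + e' * mono_coeff i' j' n))"
  by (rule ext) (simp add: add_mono_def mod_simps)

lemma add_mono_md: "add_mono f (md e) i j = add_mono f e i j"
  by (rule ext) (simp add: add_mono_def, metis mod_add_right_eq mod_mult_left_eq)


section \<open>The rank of an edge labelled by a power of \<open>a\<close>\<close>

text \<open>A maximum of degrees that disregards the default value of \<open>fdeg\<close> at the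
  zero function.\<close>

definition pair_deg :: "(int \<Rightarrow> int) \<Rightarrow> (int \<Rightarrow> int) \<Rightarrow> int" where
  "pair_deg f g = (if f = (\<lambda>n. 0) then fdeg g else if g = (\<lambda>n. 0) then fdeg f else max (fdeg f) (fdeg g))"

lemma pair_deg_props:
  assumes "expansion f" "expansion g" "f \<noteq> (\<lambda>n. 0) \<or> g \<noteq> (\<lambda>n. 0)"
  shows "f (pair_deg f g) \<noteq> 0 \<or> g (pair_deg f g) \<noteq> 0"
    "n > pair_deg f g \<Longrightarrow> f n = 0 \<and> g n = 0"
  using assms has_deg_fdeg[of f] has_deg_fdeg[of g]
  by (auto simp: pair_deg_def has_deg_def max_def split: if_splits)

lemma pair_deg_eq:
  assumes "expansion f" "expansion g" "f M \<noteq> 0 \<or> g M \<noteq> 0" "\<And>n. n > M \<Longrightarrow> f n = 0 \<and> g n = 0"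
  shows "pair_deg f g = M"
proof -
  have "f \<noteq> (\<lambda>n. 0) \<or> g \<noteq> (\<lambda>n. 0)" using assms(3) by auto
  note props = pair_deg_props[OF assms(1,2) this]
  show ?thesis using props assms(3,4) by (meson linorder_neqE_linordered_idom)
qed

text \<open>The rank of an edge between \<open>f\<close> and \<open>g\<close> at position \<open>(i, j)\<close> of the plane. The leading
  coefficient of \<open>f\<close> and \<open>g\<close>, at \<open>x = -1\<close> if one of them has a pole there and otherwise at infinity,
  either stays the same (type 2), or changes between two coefficients of the same norm (type 1), or
  its norm changes (type 0).\<close>

definition rank :: "(int \<Rightarrow> int) \<Rightarrow> (int \<Rightarrow> int) \<Rightarrow> int \<Rightarrow> int \<Rightarrow> nat \<times> nat \<times> nat \<times> nat \<times> nat" where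
  "rank f g i j =
    (let Q = max (pole_order f) (pole_order g) in
     if Q > 0 then
       let m = cnorm (polar_coeff f (Q - 1) 0); m' = cnorm (polar_coeff g (Q - 1) 0) in
       if - int Q < j then (Q, 0, max m m', 2, nat (int Q + j))
       else if m = m' then (Q, 0, max m m', 1, 0)
       else (Q, 0, max m m', 0, nat \<bar>i - fdeg (if m' < m then f else g)\<bar>)
     else
       let M = pair_deg f g; m = cnorm (f M); m' = cnorm (g M) in
       if i + j < M then (0, nat (M - i), max m m', 2, nat (M - (i + j)))
       else if m = m' then (0, nat (M - i), max m m', 1, 0)
       else (0, nat (M - i), max m m', 0, nat j))"

text \<open>By priority: pole order, columns left before the degree (only without a pole), larger
  norm, type, and the distance that a triangle shortens. The column count precedes the norm because
  a vanishing leading coefficient exposes a lower one of arbitrary norm; the drop of the degree then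
  pays for it.\<close>

definition rank_less :: "((nat \<times> nat \<times> nat \<times> nat \<times> nat) \<times> (nat \<times> nat \<times> nat \<times> nat \<times> nat)) set" where
  "rank_less = less_than <*lex*> less_than <*lex*> less_than <*lex*> less_than <*lex*> less_than"

lemma wf_rank_less: "wf rank_less"
  by (auto simp: rank_less_def)

text \<open>\<open>rank\<close> measures polar coefficients relative to column 0; any other column
  differs by a sign, which \<open>cnorm\<close> ignores.\<close>

lemma rank_pole:
  assumes "polar f q i0 k" "polar g q i0 k'" "md k \<noteq> 0 \<or> md k' \<noteq> 0"
  shows "rank f g i j =
    (if - int q \<le> j then (Suc q, 0, max (cnorm k) (cnorm k'), 2, nat (int (Suc q) + j))
     else if cnorm k = cnorm k' then (Suc q, 0, max (cnorm k) (cnorm k'), 1, 0)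
     else (Suc q, 0, max (cnorm k) (cnorm k'), 0, nat \<bar>i - fdeg (if cnorm k' < cnorm k then f else g)\<bar>))"
proof -
  have "pole_order f \<le> Suc q" "pole_order g \<le> Suc q"
    using assms polar_pole_le_Suc pole_order_le by blast+
  moreover have "pole_order f = Suc q \<or> pole_order g = Suc q"
    using assms pole_order_eqI by blast
  ultimately have Q: "max (pole_order f) (pole_order g) = Suc q" by auto
  have "cnorm (polar_coeff f q 0) = cnorm k" "cnorm (polar_coeff g q 0) = cnorm k'"
    using polar_coeff_eq[OF polar_column[OF assms(1)], of 0] polar_coeff_eq[OF polar_column[OF assms(2)], of 0]
    by simp_all
  moreover have "- int (Suc q) < j \<longleftrightarrow> - int q \<le> j" by auto
  ultimately show ?thesis unfolding rank_def Q Let_def by simp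
qed

abbreviation rank_lt :: "nat \<times> nat \<times> nat \<times> nat \<times> nat \<Rightarrow> nat \<times> nat \<times> nat \<times> nat \<times> nat \<Rightarrow> bool" (infix "\<prec>" 50) where
  "x \<prec> y \<equiv> (x, y) \<in> rank_less"

lemma rank_pole_low:
  assumes "pole_le f q" "pole_le g q"
  shows "rank f g i j \<prec> (Suc q, z)"
proof -
  have "max (pole_order f) (pole_order g) < Suc q"
    using pole_order_le[OF assms(1)] pole_order_le[OF assms(2)] by simp
  then show ?thesis by (auto simp: rank_def rank_less_def Let_def)
qed

text \<open>If both coefficients vanish, the pole order drops; otherwise it stays at
  \<open>Suc q\<close> and the norm decides.\<close>

lemma rank_pole_less_norm:
  assumes "polar f q i0 k" "polar g q i0 k'" "max (cnorm k) (cnorm k') < N"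
  shows "rank f g i j \<prec> (Suc q, 0, N, z)"
proof (cases "md k = 0 \<and> md k' = 0")
  case True
  then have "pole_le f q" "pole_le g q"
    using assms polar_cong[of k 0 f q i0] polar_cong[of k' 0 g q i0] by (auto simp: polar_0)
  then show ?thesis by (rule rank_pole_low)
next
  case False
  then have "rank f g i j = (Suc q, 0, max (cnorm k) (cnorm k'), snd (snd (snd (rank f g i j))))"
    by (subst rank_pole[OF assms(1,2)]) (auto simp: rank_pole[OF assms(1,2)])
  then show ?thesis using assms(3) by (metis in_lex_prod less_than_iff rank_less_def)
qed

section \<open>Triangles in the presence of a pole\<close>

context
  fixes f :: "int \<Rightarrow> int" and e i j k :: int and q :: nat
  assumes e: "e \<in> digits" and f: "polar f q i k"
begin

text \<open>The side in row \<open>j + 1\<close> does not touch the coefficient at the pole and so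
  sees only the smaller norm. The other side stays on the line of the pole, one column closer to the
  degree of its end with the larger norm.\<close>

lemma rank_up_pole:
  assumes j: "j = - int q - 1" and up: "cnorm k < cnorm (k + e)"
  shows "i < fdeg (add_mono f e i j) \<Longrightarrow>
      rank f (add_mono f e i (j + 1)) i (j + 1) \<prec> rank f (add_mono f e i j) i j \<and>
      rank (add_mono f e i (j + 1)) (add_mono f e i j) (i + 1) j \<prec> rank f (add_mono f e i j) i j"
    and "fdeg (add_mono f e i j) < i \<Longrightarrow>
      rank f (add_mono f e (i - 1) (j + 1)) (i - 1) (j + 1) \<prec> rank f (add_mono f e i j) i j \<and>
      rank (add_mono f e (i - 1) (j + 1)) (add_mono f e i j) (i - 1) j \<prec> rank f (add_mono f e i j) i j"
proof -
  let ?g = "add_mono f e i j"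
  have g: "polar ?g q i (k + e)" using polar_add_line[OF f j, of e i] by simp
  have nz: "md (k + e) \<noteq> 0" using up cnorm_eq_0[of "k + e"] by auto
  have f1: "polar (add_mono f e i' (j + 1)) q i k" for i'
    by (rule polar_add_inner[OF f]) (simp add: j)
  have rk: "rank f ?g i j = (Suc q, 0, cnorm (k + e), 0, nat \<bar>i - fdeg ?g\<bar>)"
    using rank_pole[OF f g] nz up j by auto
  have "rank f (add_mono f e i' (j + 1)) i' (j + 1) \<prec> rank f ?g i j" for i'
    unfolding rk by (rule rank_pole_less_norm[OF f f1]) (use up in simp)
  moreover have "rank (add_mono f e i' (j + 1)) ?g i'' j = (Suc q, 0, cnorm (k + e), 0, nat \<bar>i'' - fdeg ?g\<bar>)" for i' i''
    using rank_pole[OF f1 g] nz up j by auto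
  ultimately show "i < fdeg ?g \<Longrightarrow>
      rank f (add_mono f e i (j + 1)) i (j + 1) \<prec> rank f ?g i j \<and>
      rank (add_mono f e i (j + 1)) ?g (i + 1) j \<prec> rank f ?g i j"
    "fdeg ?g < i \<Longrightarrow>
      rank f (add_mono f e (i - 1) (j + 1)) (i - 1) (j + 1) \<prec> rank f ?g i j \<and>
      rank (add_mono f e (i - 1) (j + 1)) ?g (i - 1) j \<prec> rank f ?g i j"
    by (auto simp: rk rank_less_def)
qed

text \<open>Now \<open>f\<close> has the larger norm, so the side on the line comes first and the
  side in row \<open>j + 1\<close> sees the coefficient after its reduction.\<close>

lemma rank_down_pole:
  assumes j: "j = - int q - 1" and dn: "cnorm (k + e) < cnorm k"
  shows "i < fdeg f \<Longrightarrow>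
      rank f (add_mono f (md (- e)) (i + 1) j) (i + 1) j \<prec> rank f (add_mono f e i j) i j \<and>
      rank (add_mono f (md (- e)) (i + 1) j) (add_mono f e i j) i (j + 1) \<prec> rank f (add_mono f e i j) i j"
    and "fdeg f < i \<Longrightarrow>
      rank f (add_mono f (md (- e)) (i - 1) j) (i - 1) j \<prec> rank f (add_mono f e i j) i j \<and>
      rank (add_mono f (md (- e)) (i - 1) j) (add_mono f e i j) (i - 1) (j + 1) \<prec> rank f (add_mono f e i j) i j"
proof -
  let ?g = "add_mono f e i j"
  have g: "polar ?g q i (k + e)" using polar_add_line[OF f j, of e i] by simp
  have nz: "md k \<noteq> 0" using dn cnorm_eq_0[of k] by auto
  have f1: "polar (add_mono f (md (- e)) i' j) q i (k + e)" if "i' = i + 1 \<or> i' = i - 1" for i'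
    using polar_add_line[OF f j, of "- e" i'] that by (auto simp: add_mono_md alt_def)
  have rk: "rank f ?g i j = (Suc q, 0, cnorm k, 0, nat \<bar>i - fdeg f\<bar>)"
    using rank_pole[OF f g] nz dn j by auto
  have "rank f (add_mono f (md (- e)) i' j) i' j = (Suc q, 0, cnorm k, 0, nat \<bar>i' - fdeg f\<bar>)"
    if "i' = i + 1 \<or> i' = i - 1" for i'
    using rank_pole[OF f f1[OF that]] nz dn j by auto
  moreover have "rank (add_mono f (md (- e)) i' j) ?g i'' (j + 1) \<prec> rank f ?g i j"
    if "i' = i + 1 \<or> i' = i - 1" for i' i''
    unfolding rk by (rule rank_pole_less_norm[OF f1[OF that] g]) (use dn in simp)
  ultimately show "i < fdeg f \<Longrightarrow>
      rank f (add_mono f (md (- e)) (i + 1) j) (i + 1) j \<prec> rank f ?g i j \<and>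
      rank (add_mono f (md (- e)) (i + 1) j) ?g i (j + 1) \<prec> rank f ?g i j"
    "fdeg f < i \<Longrightarrow>
      rank f (add_mono f (md (- e)) (i - 1) j) (i - 1) j \<prec> rank f ?g i j \<and>
      rank (add_mono f (md (- e)) (i - 1) j) ?g (i - 1) (j + 1) \<prec> rank f ?g i j"
    by (auto simp: rk rank_less_def)
qed

text \<open>A change between two nonzero residues is routed through the coefficient 0; both halves
  change the norm and hence have a smaller type.\<close>

lemma rank_flat_pole:
  assumes j: "j = - int q - 1" and p: "cnorm k = 1" "cnorm (k + e) = 1"
  shows "rank f (add_mono f (md (- k)) i j) i j \<prec> rank f (add_mono f e i j) i j"
    "rank (add_mono f (md (- k)) i j) (add_mono f e i j) i j \<prec> rank f (add_mono f e i j) i j"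
proof -
  have g: "polar (add_mono f e i j) q i (k + e)" using polar_add_line[OF f j, of e i] by simp
  have f1: "polar (add_mono f (md (- k)) i j) q i 0"
    using polar_add_line[OF f j, of "- k" i] by (simp add: add_mono_md)
  have nz: "md k \<noteq> 0" "md (k + e) \<noteq> 0" using p cnorm_eq_0[of k] cnorm_eq_0[of "k + e"] by auto
  have "cnorm 0 = 0" by (simp add: cnorm_def)
  then show "rank f (add_mono f (md (- k)) i j) i j \<prec> rank f (add_mono f e i j) i j"
    "rank (add_mono f (md (- k)) i j) (add_mono f e i j) i j \<prec> rank f (add_mono f e i j) i j"
    using rank_pole[OF f g] rank_pole[OF f f1] rank_pole[OF f1 g] nz p j by (auto simp: rank_less_def)
qed

text \<open>The edge descends by one row. If that row is the line of the pole, the middle function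
  has coefficient \<open>k + e\<close> or \<open>k - e\<close>, according to whether column
  \<open>i\<close> or \<open>i + 1\<close> comes first; the order is chosen so that the norm does
  not grow.\<close>

lemma rank_inner_pole:
  assumes j: "- int q \<le> j" and k: "md k \<noteq> 0"
  shows "cnorm (k + e) \<le> cnorm k \<Longrightarrow>
      rank f (add_mono f e i (j - 1)) i (j - 1) \<prec> rank f (add_mono f e i j) i j \<and>
      rank (add_mono f e i (j - 1)) (add_mono f e i j) (i + 1) (j - 1) \<prec> rank f (add_mono f e i j) i j"
    and "cnorm (k - e) \<le> cnorm k \<Longrightarrow>
      rank f (add_mono f e (i + 1) (j - 1)) (i + 1) (j - 1) \<prec> rank f (add_mono f e i j) i j \<and>
      rank (add_mono f e (i + 1) (j - 1)) (add_mono f e i j) i (j - 1) \<prec> rank f (add_mono f e i j) i j"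
proof -
  let ?g = "add_mono f e i j"
  have g: "polar ?g q i k" by (rule polar_add_inner[OF f j])
  have rk: "rank f ?g i j = (Suc q, 0, cnorm k, 2, nat (int (Suc q) + j))"
    using rank_pole[OF f g] k j by auto
  have less: "rank f h i' (j - 1) \<prec> rank f ?g i j \<and> rank h ?g i'' (j - 1) \<prec> rank f ?g i j"
    if "polar h q i k'" "cnorm k' \<le> cnorm k" for h i' i'' k'
  proof -
    have "nat (int (Suc q) + (j - 1)) < nat (int (Suc q) + j)" using j by simp
    then show ?thesis
      unfolding rk using that rank_pole[OF f that(1)] rank_pole[OF that(1) g] k
      by (auto simp: rank_less_def)
  qed
  have f1: "\<exists>k'. polar (add_mono f e i' (j - 1)) q i k' \<and> cnorm k' \<le> cnorm k"
    if "cnorm (k + e * alt (i' - i)) \<le> cnorm k" for i'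
  proof (cases "- int q \<le> j - 1")
    case True
    then show ?thesis using polar_add_inner[OF f] by blast
  next
    case False
    then have "j - 1 = - int q - 1" using j by simp
    then show ?thesis using polar_add_line[OF f] that by blast
  qed
  show "cnorm (k + e) \<le> cnorm k \<Longrightarrow>
      rank f (add_mono f e i (j - 1)) i (j - 1) \<prec> rank f ?g i j \<and>
      rank (add_mono f e i (j - 1)) ?g (i + 1) (j - 1) \<prec> rank f ?g i j"
    using f1[of i] less by auto
  show "cnorm (k - e) \<le> cnorm k \<Longrightarrow>
      rank f (add_mono f e (i + 1) (j - 1)) (i + 1) (j - 1) \<prec> rank f ?g i j \<and>
      rank (add_mono f e (i + 1) (j - 1)) ?g i (j - 1) \<prec> rank f ?g i j"
    using f1[of "i + 1"] less by auto
qed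

end

section \<open>Triangles for Laurent polynomials\<close>

lemma rank_laurent:
  assumes "expansion f" "expansion g" "pole_le f 0" "pole_le g 0"
    and "f M \<noteq> 0 \<or> g M \<noteq> 0" "\<And>n. n > M \<Longrightarrow> f n = 0 \<and> g n = 0"
  shows "rank f g i j =
    (if i + j < M then (0, nat (M - i), max (cnorm (f M)) (cnorm (g M)), 2, nat (M - (i + j)))
     else if cnorm (f M) = cnorm (g M) then (0, nat (M - i), max (cnorm (f M)) (cnorm (g M)), 1, 0)
     else (0, nat (M - i), max (cnorm (f M)) (cnorm (g M)), 0, nat j))"
proof -
  have Q: "max (pole_order f) (pole_order g) = 0"
    using pole_order_le[OF assms(3)] pole_order_le[OF assms(4)] by simp
  have M: "pair_deg f g = M"
    by (rule pair_deg_eq[OF assms(1,2,5)]) (rule assms(6))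
  show ?thesis unfolding rank_def Q Let_def M by simp
qed

text \<open>The edge changes the coefficient at \<open>i + j \<ge> i\<close>. Thus
  \<open>nat (M - i)\<close> is not truncated when the degree \<open>M\<close> drops, and
  comparisons of column counts remain strict.\<close>

lemma pair_deg_add_mono:
  assumes "expansion f" "e \<in> digits" "0 \<le> j"
  shows "i \<le> pair_deg f (add_mono f e i j)" "f \<noteq> (\<lambda>n. 0) \<or> add_mono f e i j \<noteq> (\<lambda>n. 0)"
proof -
  let ?g = "add_mono f e i j"
  have ne: "?g (i + j) \<noteq> f (i + j)"
  proof
    assume "?g (i + j) = f (i + j)"
    then have "md (f (i + j) + e) = md (f (i + j))"
      using assms(1) by (simp add: add_mono_top expansion_md)
    then have "md (f (i + j) + e - f (i + j)) = md (f (i + j) - f (i + j))" by (rule mod_diff_cong) simp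
    then have "md e = 0" by simp
    then show False using digit_nonzero[OF assms(2)] by simp
  qed
  then show nz: "f \<noteq> (\<lambda>n. 0) \<or> ?g \<noteq> (\<lambda>n. 0)" by auto
  have "i + j \<le> pair_deg f ?g"
    using pair_deg_props(2)[OF assms(1) expansion_add[OF assms(1)] nz, of "i + j"] ne by force
  then show "i \<le> pair_deg f ?g" using assms(3) by simp
qed

lemma rank_laurent_less_norm:
  assumes f: "expansion f" "pole_le f 0" and e: "e \<in> digits" and ij: "0 \<le> j" "i + j < M"
    and g: "g = add_mono f e i j"
    and above: "\<And>n. n > M \<Longrightarrow> f n = 0" and N: "cnorm (f M) < N" 
  shows "rank f g i j \<prec> (0, nat (M - i), N, z)"
proof -
  have eg: "expansion g" "pole_le g 0" using expansion_add f pole_le_add ij by (auto simp: g)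
  have gn: "g n = f n" if "n \<ge> M" for n using add_mono_above[OF f(1)] that ij by (simp add: g)
  show ?thesis
  proof (cases "f M = 0")
    case False
    then show ?thesis
      using rank_laurent[OF f(1) eg(1) f(2) eg(2), of M] above gn N ij by (auto simp: rank_less_def)
  next
    case True
    let ?M = "pair_deg f g"
    have nz: "f \<noteq> (\<lambda>n. 0) \<or> g \<noteq> (\<lambda>n. 0)" and iM: "i \<le> ?M"
      using pair_deg_add_mono[OF f(1) e ij(1), of i] g by auto
    note props = pair_deg_props[OF f(1) eg(1) nz]
    have "?M < M" using props(1) above gn True by (metis linorder_neqE_linordered_idom order.order_iff_strict)
    then have "nat (?M - i) < nat (M - i)" using iM by simp
    then show ?thesis
      using rank_laurent[OF f(1) eg(1) f(2) eg(2) props] by (auto simp: rank_less_def)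
  qed
qed

text \<open>Moving to the next column lowers the second component of the rank, whatever happens to
  the coefficients.\<close>

lemma rank_laurent_less_column:
  assumes f: "expansion f" "pole_le f 0" and e: "e \<in> digits" and ij: "0 \<le> j" "i + 1 + j \<le> M"
    and g: "g = add_mono f e (i + 1) j"
    and above: "\<And>n. n > M \<Longrightarrow> f n = 0"
  shows "rank f g (i + 1) j \<prec> (0, nat (M - i), z)"
proof -
  have eg: "expansion g" "pole_le g 0" using expansion_add f pole_le_add ij by (auto simp: g)
  let ?M = "pair_deg f g"
  have nz: "f \<noteq> (\<lambda>n. 0) \<or> g \<noteq> (\<lambda>n. 0)"
    using pair_deg_add_mono[OF f(1) e ij(1), of "i + 1"] g by auto
  note props = pair_deg_props[OF f(1) eg(1) nz]
  have "g n = 0" if "n > M" for n using add_mono_above[OF f(1)] that ij above by (simp add: g)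
  then have "?M \<le> M" using props(1) above by (meson not_less)
  then have "nat (?M - (i + 1)) < nat (M - i)" using ij by simp
  then show ?thesis
    using rank_laurent[OF f(1) eg(1) f(2) eg(2) props] by (auto simp: rank_less_def)
qed

context
  fixes f :: "int \<Rightarrow> int" and e M :: int
  assumes e: "e \<in> digits" and f: "expansion f" "pole_le f 0" and above: "\<And>n. n > M \<Longrightarrow> f n = 0"
begin

lemma laurent_add_mono:
  assumes "0 \<le> j" "i + j \<le> M"
  shows "expansion (add_mono f c i j)" "pole_le (add_mono f c i j) 0" "n > M \<Longrightarrow> add_mono f c i j n = 0"
  using expansion_add f pole_le_add assms add_mono_above above by auto

text \<open>The edge climbs towards the diagonal \<open>i + j = M\<close>. Its side in column
  \<open>i + 1\<close> is always smaller. Its side in row \<open>j + 1\<close> may touch the leading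
  coefficient, which the two orders of the sides change from \<open>f M\<close> to
  \<open>f M + e\<close> or from \<open>f M - e\<close> to \<open>f M\<close>.\<close>

lemma rank_inner_laurent:
  assumes j: "0 \<le> j" "i + j < M" and nz: "f M \<noteq> 0"
  shows "cnorm (f M + e) \<le> cnorm (f M) \<Longrightarrow>
      rank f (add_mono f e i (j + 1)) i (j + 1) \<prec> rank f (add_mono f e i j) i j"
    and "rank (add_mono f e i (j + 1)) (add_mono (add_mono f e i (j + 1)) (md (- e)) (i + 1) j) (i + 1) j \<prec>
        rank f (add_mono f e i j) i j"
    and "rank f (add_mono f (md (- e)) (i + 1) j) (i + 1) j \<prec> rank f (add_mono f e i j) i j"
    and "cnorm (f M - e) \<le> cnorm (f M) \<Longrightarrow>
      rank (add_mono f (md (- e)) (i + 1) j) (add_mono f e i j) i (j + 1) \<prec> rank f (add_mono f e i j) i j"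
proof -
  let ?g = "add_mono f e i j"
  have gM: "?g M = f M" using add_mono_above[OF f(1)] j by simp
  have g: "expansion ?g" "pole_le ?g 0" "\<And>n. n > M \<Longrightarrow> ?g n = 0"
    using laurent_add_mono[where i = i and j = j] j by auto
  have rk: "rank f ?g i j = (0, nat (M - i), cnorm (f M), 2, nat (M - (i + j)))"
    using rank_laurent[OF f(1) g(1) f(2) g(2), of M i j] j above g(3) nz gM by simp
  let ?h = "add_mono f e i (j + 1)"
  have h: "expansion ?h" "pole_le ?h 0" "\<And>n. n > M \<Longrightarrow> ?h n = 0"
    using laurent_add_mono[where i = i and j = "j + 1"] j by auto
  have hM: "cnorm (?h M) \<le> cnorm (f M)" if "cnorm (f M + e) \<le> cnorm (f M)"
    using that add_mono_above[OF f(1), of i "j + 1" M] add_mono_top[of i "j + 1" M f e] j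
    by (cases "i + (j + 1) < M") auto
  show "rank f ?h i (j + 1) \<prec> rank f ?g i j" if "cnorm (f M + e) \<le> cnorm (f M)"
    using rank_laurent[OF f(1) h(1) f(2) h(2), of M i "j + 1"] nz above h(3) hM[OF that] j
    unfolding rk by (auto simp: rank_less_def)
  show "rank ?h (add_mono ?h (md (- e)) (i + 1) j) (i + 1) j \<prec> rank f ?g i j"
    unfolding rk by (rule rank_laurent_less_column[OF h(1,2) digit_neg[OF e] _ _ HOL.refl h(3)]) (use j in auto)
  show "rank f (add_mono f (md (- e)) (i + 1) j) (i + 1) j \<prec> rank f ?g i j"
    unfolding rk by (rule rank_laurent_less_column[OF f digit_neg[OF e] _ _ HOL.refl above]) (use j in auto)
  let ?h' = "add_mono f (md (- e)) (i + 1) j"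
  have h': "expansion ?h'" "pole_le ?h' 0" "\<And>n. n > M \<Longrightarrow> ?h' n = 0"
    using laurent_add_mono[where i = "i + 1" and j = j] j by auto
  have h'M: "cnorm (?h' M) \<le> cnorm (f M)" if "cnorm (f M - e) \<le> cnorm (f M)"
    using that add_mono_above[OF f(1), of "i + 1" j M] add_mono_top[of "i + 1" j M f "- e"] j
    by (cases "i + 1 + j < M") (auto simp: add_mono_md)
  show "rank ?h' ?g i (j + 1) \<prec> rank f ?g i j" if "cnorm (f M - e) \<le> cnorm (f M)"
    using rank_laurent[OF h'(1) g(1) h'(2) g(2), of M i "j + 1"] nz gM g(3) h'(3) h'M[OF that] j
    unfolding rk by (auto simp: rank_less_def)
qed

text \<open>The edge slides along the diagonal towards row 0. The side in column
  \<open>i + 1\<close> carries the change of the leading coefficient and comes first, so that the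
  side in column \<open>i\<close> already sees the reduced one.\<close>

lemma rank_down_laurent:
  assumes j: "0 < j" "i + j = M" and dn: "cnorm (f M + e) < cnorm (f M)"
  shows "rank f (add_mono f e (i + 1) (j - 1)) (i + 1) (j - 1) \<prec> rank f (add_mono f e i j) i j"
    and "rank (add_mono f e (i + 1) (j - 1)) (add_mono (add_mono f e (i + 1) (j - 1)) e i (j - 1)) i (j - 1) \<prec>
       rank f (add_mono f e i j) i j"
proof -
  let ?g = "add_mono f e i j"
  have gM: "?g M = md (f M + e)" using add_mono_top j by simp
  have nz: "f M \<noteq> 0" using dn by (auto simp: cnorm_def split: if_splits)
  have g: "expansion ?g" "pole_le ?g 0" "\<And>n. n > M \<Longrightarrow> ?g n = 0"
    using laurent_add_mono[where i = i and j = j] j by auto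
  have rk: "rank f ?g i j = (0, nat (M - i), cnorm (f M), 0, nat j)"
    using rank_laurent[OF f(1) g(1) f(2) g(2), of M i j] j above g(3) nz gM dn by simp
  let ?h = "add_mono f e (i + 1) (j - 1)"
  have h: "expansion ?h" "pole_le ?h 0" "\<And>n. n > M \<Longrightarrow> ?h n = 0"
    using laurent_add_mono[where i = "i + 1" and j = "j - 1"] j by auto
  have hM: "?h M = md (f M + e)" using add_mono_top[of "i + 1" "j - 1" M] j by simp
  show "rank f ?h (i + 1) (j - 1) \<prec> rank f ?g i j"
    unfolding rk by (rule rank_laurent_less_column[OF f e _ _ HOL.refl above]) (use j in auto)
  show "rank ?h (add_mono ?h e i (j - 1)) i (j - 1) \<prec> rank f ?g i j"
    unfolding rk by (rule rank_laurent_less_norm[OF h(1,2) e _ _ HOL.refl h(3)]) (use j hM dn in auto)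
qed

text \<open>The sides of the previous triangle in the other order: column \<open>i\<close> is passed
  while the leading coefficient is still small.\<close>

lemma rank_up_laurent:
  assumes j: "0 < j" "i + j = M" and up: "cnorm (f M) < cnorm (f M + e)"
  shows "rank f (add_mono f e i (j - 1)) i (j - 1) \<prec> rank f (add_mono f e i j) i j"
    and "rank (add_mono f e i (j - 1)) (add_mono (add_mono f e i (j - 1)) e (i + 1) (j - 1)) (i + 1) (j - 1) \<prec>
       rank f (add_mono f e i j) i j"
proof -
  let ?g = "add_mono f e i j"
  have gM: "?g M = md (f M + e)" using add_mono_top j by simp
  have nz: "?g M \<noteq> 0" using up gM by (metis cnorm_eq_0 less_nat_zero_code mod_mod_trivial)
  have g: "expansion ?g" "pole_le ?g 0" "\<And>n. n > M \<Longrightarrow> ?g n = 0"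
    using laurent_add_mono[where i = i and j = j] j by auto
  have rk: "rank f ?g i j = (0, nat (M - i), cnorm (f M + e), 0, nat j)"
    using rank_laurent[OF f(1) g(1) f(2) g(2), of M i j] j above g(3) nz gM up by simp
  let ?h = "add_mono f e i (j - 1)"
  have h: "expansion ?h" "pole_le ?h 0" "\<And>n. n > M \<Longrightarrow> ?h n = 0"
    using laurent_add_mono[where i = i and j = "j - 1"] j by auto
  show "rank f ?h i (j - 1) \<prec> rank f ?g i j"
    unfolding rk by (rule rank_laurent_less_norm[OF f e _ _ HOL.refl above]) (use j up in auto)
  show "rank ?h (add_mono ?h e (i + 1) (j - 1)) (i + 1) (j - 1) \<prec> rank f ?g i j"
    unfolding rk by (rule rank_laurent_less_column[OF h(1,2) e _ _ HOL.refl h(3)]) (use j in auto)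
qed

lemma rank_flat_laurent:
  assumes j: "0 \<le> j" "i + j = M" and p: "cnorm (f M) = 1" "cnorm (f M + e) = 1"
  shows "rank f (add_mono f (md (- f M)) i j) i j \<prec> rank f (add_mono f e i j) i j"
    "rank (add_mono f (md (- f M)) i j) (add_mono f e i j) i j \<prec> rank f (add_mono f e i j) i j"
proof -
  let ?g = "add_mono f e i j" and ?h = "add_mono f (md (- f M)) i j"
  have gM: "?g M = md (f M + e)" and hM: "?h M = 0"
    using add_mono_top[of i j M] j by (simp_all add: add_mono_md)
  have "cnorm 0 = 0" by (simp add: cnorm_def)
  have nz: "f M \<noteq> 0" "?g M \<noteq> 0"
    using p gM \<open>cnorm 0 = 0\<close> cnorm_eq_0[of "f M + e"] by auto
  have g: "expansion ?g" "pole_le ?g 0" "\<And>n. n > M \<Longrightarrow> ?g n = 0"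
    and h: "expansion ?h" "pole_le ?h 0" "\<And>n. n > M \<Longrightarrow> ?h n = 0"
    using laurent_add_mono[where i = i and j = j] j by auto
  show "rank f ?h i j \<prec> rank f ?g i j" "rank ?h ?g i j \<prec> rank f ?g i j"
    using rank_laurent[OF f(1) g(1) f(2) g(2), of M i j] rank_laurent[OF f(1) h(1) f(2) h(2), of M i j]
      rank_laurent[OF h(1) g(1) h(2) g(2), of M i j] nz g(3) h(3) above gM hM p j \<open>cnorm 0 = 0\<close>
    by (auto simp: rank_less_def)
qed

end

lemma add_mono_triangles:
  "add_mono (add_mono f e i (j + 1)) (md (- e)) (i + 1) j = add_mono f e i j"
  "add_mono (add_mono f (md (- e)) (i + 1) j) e i (j + 1) = add_mono f e i j"
  "add_mono (add_mono f e i (j - 1)) e (i + 1) (j - 1) = add_mono f e i j"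
  "add_mono (add_mono f e (i + 1) (j - 1)) e i (j - 1) = add_mono f e i j"
  "add_mono (add_mono f e (i - 1) (j + 1)) (md (- e)) (i - 1) j = add_mono f e i j"
  "add_mono (add_mono f (md (- e)) (i - 1) j) e (i - 1) (j + 1) = add_mono f e i j"
proof -
  have t: "mono_coeff i (j + 1) n = mono_coeff i j n + mono_coeff (i + 1) j n"
    and t': "mono_coeff i j n = mono_coeff i (j - 1) n + mono_coeff (i + 1) (j - 1) n"
    and t'': "mono_coeff (i - 1) (j + 1) n = mono_coeff (i - 1) j n + mono_coeff i j n" for n
    using mono_coeff_triangle[of i j n] mono_coeff_triangle[of i "j - 1" n]
      mono_coeff_triangle[of "i - 1" j n] by simp_all
  show "add_mono (add_mono f e i (j + 1)) (md (- e)) (i + 1) j = add_mono f e i j"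
    "add_mono (add_mono f (md (- e)) (i + 1) j) e i (j + 1) = add_mono f e i j"
    unfolding add_mono_md add_mono_add_mono unfolding add_mono_def t by (simp_all add: algebra_simps)
  show "add_mono (add_mono f e i (j - 1)) e (i + 1) (j - 1) = add_mono f e i j"
    "add_mono (add_mono f e (i + 1) (j - 1)) e i (j - 1) = add_mono f e i j"
    unfolding add_mono_md add_mono_add_mono unfolding add_mono_def t' by (simp_all add: algebra_simps)
  show "add_mono (add_mono f e (i - 1) (j + 1)) (md (- e)) (i - 1) j = add_mono f e i j"
    "add_mono (add_mono f (md (- e)) (i - 1) j) e (i - 1) (j + 1) = add_mono f e i j"
    unfolding add_mono_md add_mono_add_mono unfolding add_mono_def t'' by (simp_all add: algebra_simps)
qed

lemma add_mono_same:
  "md (c + d) = md e \<Longrightarrow> add_mono (add_mono f c i j) d i j = add_mono f e i j"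
  unfolding add_mono_add_mono
  by (rule ext) (simp add: add_mono_def, metis (no_types) add.assoc distrib_right mod_add_right_eq mod_mult_left_eq)

end

section \<open>States, tree letters and flow labels\<close>

text \<open>\<open>LA e\<close> is the letter \<open>a\<^sup>e\<close>, and \<open>LU\<close> is \<open>t\<^sup>-\<^sup>1 s\<close>; a prime marks the inverse letter.\<close>

lemma sgn_int_simps [simp]:
  fixes x :: int
  shows "sgn x = 0 \<longleftrightarrow> x = 0" "0 < sgn x \<longleftrightarrow> 0 < x" "sgn x < 0 \<longleftrightarrow> x < 0"
    "0 \<le> sgn x \<longleftrightarrow> 0 \<le> x" "sgn x \<le> 0 \<longleftrightarrow> x \<le> 0" "sgn x = 1 \<longleftrightarrow> 0 < x" "sgn x = -1 \<longleftrightarrow> x < 0"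
  by (simp_all add: sgn_if)

datatype letter = LA int | LT | LT' | LS | LS' | LU | LU'

type_synonym vertex = "(int \<Rightarrow> int) \<times> int \<times> int"
type_synonym state = "nat \<times> int \<times> int \<times> int"

context modulus begin

fun act :: "vertex \<Rightarrow> letter \<Rightarrow> vertex" where
  "act (f, i, j) (LA e) = (add_mono f e i j, i, j)"
| "act (f, i, j) LT = (f, i + 1, j)"
| "act (f, i, j) LT' = (f, i - 1, j)"
| "act (f, i, j) LS = (f, i, j + 1)"
| "act (f, i, j) LS' = (f, i, j - 1)"
| "act (f, i, j) LU = (f, i - 1, j + 1)"
| "act (f, i, j) LU' = (f, i + 1, j - 1)"

fun letter_inv :: "letter \<Rightarrow> letter" where
  "letter_inv (LA e) = LA (md (- e))"
| "letter_inv LT = LT'" | "letter_inv LT' = LT"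
| "letter_inv LS = LS'" | "letter_inv LS' = LS"
| "letter_inv LU = LU'" | "letter_inv LU' = LU"

definition letters :: "letter set" where
  "letters = {LT, LT', LS, LS', LU, LU'} \<union> LA ` digits"

text \<open>The normal form of \<open>(f, i, j)\<close> first reaches the expansion \<open>f\<close> at the position
  \<open>(fdeg f, - pole_order f)\<close> and then moves to \<open>(i, j)\<close> along \<open>t\<^sup>*u\<^sup>*\<close> or \<open>t\<^sup>*s\<^sup>-\<^sup>*\<close>. The state consists of
  the type of \<open>f\<close> (zero, Laurent polynomial, pole at \<open>-1\<close>), the digit of its leading coefficient
  (relative to the column \<open>i\<close> in case of a pole) and the signs of the two exponents of the last part.\<close>

fun state_of :: "vertex \<Rightarrow> state" where
  "state_of (f, i, j) =
    (if f = (\<lambda>n. 0) then 0 else if pole_order f = 0 then 1 else 2,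
     dig (if pole_order f = 0 then f (fdeg f) else polar_coeff f (pole_order f - 1) i),
     sgn (i - fdeg f + (if 0 \<le> j + int (pole_order f) then j + int (pole_order f) else 0)),
     sgn (j + int (pole_order f)))"

text \<open>A letter \<open>LA e\<close> is a child where the new function has its base at the
  current position: below the line in the column of the degree it creates a pole; on the line it
  creates a leading term of larger degree or, over the integers, repeats the letter
  \<open>k\<close>.\<close>

fun child :: "state \<Rightarrow> letter \<Rightarrow> bool" where
  "child (ph, k, h, v) (LA e) \<longleftrightarrow>
     (if v < 0 then ph \<noteq> 0 \<and> h = 0
      else v = 0 \<and> (ph = 0 \<or> ph = 1 \<and> 0 < h \<or> h = 0 \<and> torsion_free \<and> e = k))"
| "child (ph, k, h, v) LT \<longleftrightarrow> v = 0 \<and> 0 \<le> h"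
| "child (ph, k, h, v) LT' \<longleftrightarrow> v = 0 \<and> h \<le> 0"
| "child (ph, k, h, v) LS \<longleftrightarrow> False"
| "child (ph, k, h, v) LS' \<longleftrightarrow> v \<le> 0"
| "child (ph, k, h, v) LU \<longleftrightarrow> 0 \<le> v"
| "child (ph, k, h, v) LU' \<longleftrightarrow> False"

text \<open>Letters that change the column flip the digit of a pole, whereas \<open>LS'\<close>
  keeps the column. The last equation is meant for \<open>LS'\<close>; the other letters that it
  catches are never children.\<close>

fun step :: "state \<Rightarrow> letter \<Rightarrow> state" where
  "step (ph, k, h, v) (LA e) = (if v < 0 \<or> ph = 2 then 2 else 1, e, 0, 0)"
| "step (ph, k, h, v) LT = (ph, if ph = 2 then md (- k) else k, 1, 0)"
| "step (ph, k, h, v) LT' = (ph, if ph = 2 then md (- k) else k, -1, 0)"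
| "step (ph, k, h, v) LU = (ph, if ph = 2 then md (- k) else k, h, 1)"
| "step (ph, k, h, v) _ = (ph, k, h, -1)"

fun last_letter :: "state \<Rightarrow> letter" where
  "last_letter (ph, k, h, v) =
    (if 0 < v then LU else if v < 0 then LS' else if 0 < h then LT else if h < 0 then LT' else LA k)"

text \<open>Up to conjugation and commutation these are the words \<open>s a\<^sup>e s\<^sup>-\<^sup>1 \<cdot> t a\<^sup>-\<^sup>e t\<^sup>-\<^sup>1\<close>, \<open>a\<^sup>e \<cdot> t a\<^sup>e t\<^sup>-\<^sup>1\<close> and
  \<open>s a\<^sup>e s\<^sup>-\<^sup>1 \<cdot> a\<^sup>-\<^sup>e\<close>: the monomials at \<open>(i, j)\<close>, \<open>(i + 1, j)\<close> and \<open>(i, j + 1)\<close> form a triangle.\<close>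

definition up_right :: "int \<Rightarrow> letter list" where
  "up_right e = [LS, LA e, LS', LT, LA (md (- e)), LT']"
definition right_up :: "int \<Rightarrow> letter list" where
  "right_up e = [LT, LA (md (- e)), LT', LS, LA e, LS']"
definition down_right :: "int \<Rightarrow> letter list" where
  "down_right e = [LS', LA e, LT, LA e, LT', LS]"
definition right_down :: "int \<Rightarrow> letter list" where
  "right_down e = [LS', LT, LA e, LT', LA e, LS]"
definition up_left :: "int \<Rightarrow> letter list" where
  "up_left e = [LT', LS, LA e, LS', LA (md (- e)), LT]"
definition left_up :: "int \<Rightarrow> letter list" where
  "left_up e = [LT', LA (md (- e)), LS, LA e, LS', LT]"

lemmas label_defs = up_right_def right_up_def down_right_def right_down_def up_left_def left_up_def

text \<open>The cases follow \<open>rank\<close>. For \<open>v < 0\<close> the edge would create a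
  pole and moves towards the column of the degree; words of two letters pass through the coefficient
  0. Edges within a plane are pushed towards the line \<open>v = 0\<close>.\<close>

fun label :: "state \<Rightarrow> letter \<Rightarrow> letter list" where
  "label (ph, k, h, v) (LA e) =
    (if v < 0 then
       if ph = 0 \<or> 0 < h then up_left e else if h < 0 then up_right e else [LA e]
     else if ph = 2 then
       if 0 < v then if e = md (- k) then down_right e else right_down e
       else if e = md (- k) then
         if h = 0 then [LA e] else if h < 0 then right_up e else left_up e
       else if torsion_free then
         if h = 0 then [LA e] else if h < 0 then up_right e else up_left e
       else [LA (md (- k)), LA (md (e + k))]
     else if ph = 0 \<or> 0 < h then if v = 0 then [LA e] else down_right e
     else if h < 0 then if e = md (- k) then up_right e else right_up e
     else if e = md (- k) then if v = 0 then [LA e] else right_down e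
     else if torsion_free then if v = 0 then [LA e] else down_right e
     else [LA (md (- k)), LA (md (e + k))])"
| "label (ph, k, h, v) LT = (if 0 < v then [LU', LT, LU] else if v < 0 then [LS, LT, LS'] else [LT])"
| "label (ph, k, h, v) LT' = (if 0 < v then [LU', LT', LU] else if v < 0 then [LS, LT', LS'] else [LT'])"
| "label (ph, k, h, v) LS = (if v < 0 then [LS] else [LT, LU])"
| "label (ph, k, h, v) LS' = (if v \<le> 0 then [LS'] else [LU', LT'])"
| "label (ph, k, h, v) LU = (if 0 \<le> v then [LU] else [LS, LT'])"
| "label (ph, k, h, v) LU' = (if 0 < v then [LU'] else [LT, LS'])"

lemma last_letter_step: "child s x \<Longrightarrow> last_letter (step s x) = x"
  by (cases s; cases x) auto

lemma step_not_root: "child s x \<Longrightarrow> step s x \<noteq> (0, 0, 0, 0)"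
  by (cases s; cases x) auto

lemma label_child: "child s x \<Longrightarrow> label s x = [x]"
  by (cases s; cases x) (auto split: if_splits)

lemma label_step: "child s x \<Longrightarrow> label (step s x) (letter_inv x) = [letter_inv x]"
  by (cases s; cases x) (auto split: if_splits)

lemma letter_inv_letters: "x \<in> letters \<Longrightarrow> letter_inv x \<in> letters"
  by (auto simp: letters_def digit_neg)

lemma md_uminus_md: "md (- md c) = md (- c)"
  by (rule mod_minus_eq)

lemma letter_inv_inv: "x \<in> letters \<Longrightarrow> letter_inv (letter_inv x) = x"
  by (auto simp: letters_def md_uminus_md digit_md)

section \<open>The effect of a letter \<open>a\<^sup>e\<close> on the state\<close>

lemma has_deg_keep:
  "\<lbrakk>expansion f; has_deg f M; i + j < M\<rbrakk> \<Longrightarrow> has_deg (add_mono f e i j) M"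
  by (auto simp: has_deg_def add_mono_above)

lemma has_deg_line:
  "\<lbrakk>expansion f; \<And>n. n > M \<Longrightarrow> f n = 0; i + j = M; md (f M + e) \<noteq> 0\<rbrakk> \<Longrightarrow> has_deg (add_mono f e i j) M"
  by (auto simp: has_deg_def add_mono_above add_mono_top)

lemma fdeg_le:
  assumes "expansion f" "\<And>n. n > M \<Longrightarrow> f n = 0" "f \<noteq> (\<lambda>n. 0)"
  shows "fdeg f \<le> M"
  using has_deg_fdeg[OF assms(1,3)] assms(2) by (meson has_deg_def not_less)

lemma polar_nonzero: "polar f q i k \<Longrightarrow> md k \<noteq> 0 \<Longrightarrow> f \<noteq> (\<lambda>n. 0)"
  using pole_order_eqI pole_order_zero by fastforce

lemma dig_minus: "md (- dig c) = dig (md (- c))"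
  by (simp add: dig_def md_torsion_free sgn_minus)

lemma polar_coeff_neighbour:
  assumes "expansion f" "pole_order f = Suc q" "i' = i + 1 \<or> i' = i - 1"
  shows "dig (polar_coeff f q i') = md (- dig (polar_coeff f q i))"
proof -
  have "polar f q i (polar_coeff f q i)"
    using polar_polar_coeff(1) expansion_pole_le assms by metis
  then have "polar f q i' (- polar_coeff f q i)"
    using polar_column[of f q i "polar_coeff f q i" i'] assms(3) by (auto simp: alt_def)
  then show ?thesis by (simp add: dig_minus polar_coeff_eq)
qed

lemma state_of_pole:
  assumes "polar f q i k" "md k \<noteq> 0"
  shows "state_of (f, i, j) = (2, dig (md k), sgn (i - fdeg f + (if 0 \<le> j + int (Suc q) then j + int (Suc q) else 0)),
     sgn (j + int (Suc q)))"
  using pole_order_eqI[OF assms] polar_coeff_eq[OF assms(1)] polar_nonzero[OF assms] by simp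

lemma state_step_flat:
  assumes "expansion f" "child (state_of (f, i, j)) x" "x \<in> {LT, LT', LS, LS', LU, LU'}"
  shows "state_of (act (f, i, j) x) = step (state_of (f, i, j)) x"
proof -
  define ph :: nat where "ph = (if f = (\<lambda>n. 0) then 0 else if pole_order f = 0 then 1 else 2)"
  define K where "K i = dig (if pole_order f = 0 then f (fdeg f) else polar_coeff f (pole_order f - 1) i)" for i
  define o' where "o' = int (pole_order f)"
  define M where "M = fdeg f"
  have st: "state_of (f, i, j) = (ph, K i, sgn (i - M + (if 0 \<le> j + o' then j + o' else 0)), sgn (j + o'))" for i j
    by (simp add: ph_def K_def o'_def M_def)
  have K: "K (i + 1) = (if ph = 2 then md (- K i) else K i)" "K (i - 1) = (if ph = 2 then md (- K i) else K i)"
    using polar_coeff_neighbour[OF assms(1), of "pole_order f - 1" "i + 1" i]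
      polar_coeff_neighbour[OF assms(1), of "pole_order f - 1" "i - 1" i]
    by (auto simp: K_def ph_def pole_order_zero)
  show ?thesis
  proof (cases x)
    case LU
    then have "0 \<le> j + o'" using assms(2) by (simp add: st del: state_of.simps)
    then show ?thesis using LU by (simp add: st K algebra_simps del: state_of.simps)
  qed (use assms(2,3) in \<open>auto simp add: st K simp del: state_of.simps\<close>)
qed

lemma laurent_pole_order: "pole_le f 0 \<Longrightarrow> pole_order f = 0"
  using pole_order_le by fastforce

text \<open>For \<open>j < 0\<close> the monomial has degree \<open>i + j < i = fdeg f\<close>, so
  the degree survives and only the pole changes. For \<open>j = 0\<close> it has degree
  \<open>i\<close> and becomes or enlarges the leading term.\<close>

lemma state_step_LA:
  assumes f: "expansion f" and e: "e \<in> digits" and c: "child (state_of (f, i, j)) (LA e)"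
  shows "state_of (act (f, i, j) (LA e)) = step (state_of (f, i, j)) (LA e)"
proof -
  let ?g = "add_mono f e i j" and ?o = "pole_order f" and ?M = "fdeg f"
  have g: "expansion ?g" by (rule expansion_add[OF f])
  note de = digit_nonzero[OF e] digit_md[OF e] dig_digit[OF e]
  consider "j + int ?o < 0" | "j + int ?o = 0" using c by (auto split: if_splits)
  then show ?thesis
  proof cases
    case 1
    then have fM: "f \<noteq> (\<lambda>n. 0)" "i = ?M" using c by (auto split: if_splits)
    have "has_deg ?g ?M"
      by (rule has_deg_keep[OF f has_deg_fdeg[OF f fM(1)]]) (use fM 1 in simp)
    then have "fdeg ?g = i" using fdeg_eq fM by simp
    moreover have "polar f (nat (- j) - 1) i 0"
      using pole_le_mono[OF expansion_pole_le[OF f]] 1 by (simp add: polar_0)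
    then have "polar ?g (nat (- j) - 1) i e"
      using polar_add_line[of f "nat (- j) - 1" i 0 j e i] 1 by simp
    ultimately have "state_of (?g, i, j) = (2, e, 0, 0)"
      using state_of_pole[of ?g "nat (- j) - 1" i e j] de 1 by (simp del: state_of.simps)
    moreover have "step (state_of (f, i, j)) (LA e) = (2, e, 0, 0)" using 1 by simp
    ultimately show ?thesis by (simp del: state_of.simps)
  next
    case 2
    show ?thesis
    proof (cases ?o)
      case 0
      then have j: "j = 0" and fl: "pole_le f 0" using 2 expansion_pole_le[OF f] by simp_all
      have gl: "pole_order ?g = 0" using pole_le_add[OF fl] j laurent_pole_order by simp
      have "has_deg ?g i \<and> dig (?g i) = e"
      proof (cases "f = (\<lambda>n. 0)")
        case True
        then show ?thesis using has_deg_line[OF f, of i i j e] j de add_mono_top[of i j i f e] by simp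
      next
        case False
        note M = has_deg_fdeg[OF f False]
        consider "?M < i" | "i = ?M" "torsion_free" "e = dig (f ?M)"
          using c 0 j False by (auto split: if_splits)
        then show ?thesis
        proof cases
          case 1
          then have "\<And>n. n \<ge> i \<Longrightarrow> f n = 0" using M by (simp add: has_deg_def)
          then show ?thesis using has_deg_line[OF f, of i i j e] j de add_mono_top[of i j i f e] by simp
        next
          case 2
          have "f i + e \<noteq> 0" "dig (f i + e) = e"
            using 2 M by (auto simp: dig_def has_deg_def sgn_if)
          then show ?thesis
            using has_deg_line[OF f, of i i j e] M 2 j add_mono_top[of i j i f e]
            by (simp add: has_deg_def md_torsion_free)
        qed
      qed
      then have "has_deg ?g i" "fdeg ?g = i" "dig (?g i) = e" using fdeg_eq by auto
      moreover from this have "?g \<noteq> (\<lambda>n. 0)" by (metis has_deg_def)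
      ultimately show ?thesis using 0 gl j by simp
    next
      case (Suc q)
      let ?k = "polar_coeff f q i"
      have fn: "f \<noteq> (\<lambda>n. 0)" using Suc pole_order_zero by auto
      have j: "j = - int q - 1" and iM: "i = ?M" and p: "torsion_free" "e = dig ?k"
        using 2 Suc c fn by (auto split: if_splits)
      have "has_deg ?g ?M"
        by (rule has_deg_keep[OF f has_deg_fdeg[OF f fn]]) (use iM j in simp)
      then have deg: "fdeg ?g = i" using fdeg_eq iM by simp
      have k: "polar f q i ?k" "?k \<noteq> 0"
        using polar_polar_coeff(1) polar_coeff_nonzero expansion_pole_le[OF f] Suc by metis+
      have "polar ?g q i (?k + e)" using polar_add_line[OF k(1) j, of e i] by simp
      moreover have "?k + e \<noteq> 0" "dig (?k + e) = e"
        using p k(2) by (auto simp: dig_def sgn_if)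
      ultimately have "state_of (?g, i, j) = (2, e, 0, 0)"
        using state_of_pole[of ?g q i "?k + e" j] deg j p by (simp add: md_torsion_free del: state_of.simps)
      moreover have "step (state_of (f, i, j)) (LA e) = (2, e, 0, 0)" using Suc fn by simp
      ultimately show ?thesis by (simp del: state_of.simps)
    qed
  qed
qed

lemma state_step:
  assumes "expansion (fst v)" "x \<in> letters" "child (state_of v) x"
  shows "state_of (act v x) = step (state_of v) x"
proof -
  obtain f i j where v: "v = (f, i, j)" by (cases v) auto
  show ?thesis
  proof (cases x)
    case (LA e)
    then have "e \<in> digits" using assms(2) by (auto simp: letters_def)
    then show ?thesis
      using assms(1,3) state_step_LA[of f e i j] LA v
      by (simp del: state_of.simps act.simps child.simps step.simps)
  qed (use assms state_step_flat[of f i j x] v in \<open>simp_all del: state_of.simps act.simps\<close>)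
qed

lemma child_flat_simps [simp]:
  "child (state_of (f, i, j)) LU \<longleftrightarrow> 0 \<le> j + int (pole_order f)"
  "child (state_of (f, i, j)) LS' \<longleftrightarrow> j + int (pole_order f) \<le> 0"
  by (auto simp: sgn_if)

text \<open>The edge undoes the last letter of the normal form. Either the coefficient keeps its
  sign and the reverse edge repeats that letter, or it vanishes and the end lies below the line of a
  smaller pole, beyond a smaller degree, or in the plane of the zero function, where the reverse
  edge is a child.\<close>

lemma reverse_child_LA:
  assumes f: "expansion f" and e: "e \<in> digits" and st: "state_of (f, i, j) = (ph, k, 0, 0)"
    and ph: "ph \<noteq> 0" and dn: "e = md (- k)"
  shows "child (state_of (add_mono f e i j, i, j)) (LA (md (- e)))"
proof -
  let ?g = "add_mono f e i j" and ?M = "fdeg f"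
  have g: "expansion ?g" by (rule expansion_add[OF f])
  have fn: "f \<noteq> (\<lambda>n. 0)" using st ph by auto
  note M = has_deg_fdeg[OF f fn]
  have jo: "j + int (pole_order f) = 0" using st by (simp add: sgn_if split: if_splits)
  then have iM: "i = ?M" using st by (simp add: sgn_if split: if_splits)
  show ?thesis
  proof (cases "pole_order f")
    case 0
    then have j: "j = 0" and fl: "pole_le f 0" using jo expansion_pole_le[OF f] by simp_all
    have gl: "pole_order ?g = 0" using pole_le_add[OF fl] j laurent_pole_order by simp
    have k: "k = dig (f i)" using st 0 iM by simp
    have gi: "?g i = md (f i + e)" using add_mono_top[of i j i] j by simp
    have above: "n > i \<Longrightarrow> ?g n = 0" for n
      using M add_mono_above[OF f] j iM by (simp add: has_deg_def)
    have "f i \<noteq> 0" using M iM by (simp add: has_deg_def)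
    then consider "md (f i + e) = 0" | torsion_free "f i + e \<noteq> 0" "dig (f i + e) = dig (f i)"
      using down(2)[OF expansion_md[OF f] _ e, of i] dn k by blast
    then show ?thesis
    proof cases
      case 1
      show ?thesis
      proof (cases "?g = (\<lambda>n. 0)")
        case True
        then show ?thesis using j by (simp add: pole_order_zero)
      next
        case False
        have "fdeg ?g \<le> i" using fdeg_le[OF g above False] by simp
        moreover have "fdeg ?g \<noteq> i"
          using has_deg_fdeg[OF g False] gi 1 by (auto simp: has_deg_def)
        ultimately show ?thesis using False gl j by (simp add: sgn_if)
      qed
    next
      case 2
      have "has_deg ?g i" using gi above 2 by (simp add: has_deg_def md_torsion_free)
      moreover from this have "?g \<noteq> (\<lambda>n. 0)" by (metis has_deg_def)
      ultimately show ?thesis using 2 gl j gi k dn fdeg_eq[of ?g i] by (simp add: md_torsion_free)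
    qed
  next
    case (Suc q)
    let ?k = "polar_coeff f q i"
    have j: "j = - int q - 1" using jo Suc by simp
    have gM: "has_deg ?g ?M"
      by (rule has_deg_keep[OF f M]) (use iM j in simp)
    then have deg: "fdeg ?g = i" using fdeg_eq iM by simp
    have gn: "?g \<noteq> (\<lambda>n. 0)" using gM by (metis has_deg_def)
    have kk: "k = dig ?k" using st Suc by simp
    have k: "polar f q i ?k" "?k \<noteq> 0" "md ?k = ?k"
      using polar_polar_coeff polar_coeff_nonzero expansion_pole_le[OF f] Suc by metis+
    have gk: "polar ?g q i (?k + e)" using polar_add_line[OF k(1) j, of e i] by simp
    consider "md (?k + e) = 0" | torsion_free "?k + e \<noteq> 0" "dig (?k + e) = dig ?k"
      using down(2)[OF k(3,2) e] dn kk by blast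
    then show ?thesis
    proof cases
      case 1
      then have "pole_le ?g q" using polar_cong[OF _ gk, of 0] by (simp add: polar_0)
      then have "j + int (pole_order ?g) < 0" using pole_order_le j by fastforce
      then show ?thesis using deg gn by (simp add: sgn_if)
    next
      case 2
      have "state_of (?g, i, j) = (2, k, 0, 0)"
        using state_of_pole[OF gk, of j] deg j kk 2 by (simp add: md_torsion_free del: state_of.simps)
      then show ?thesis using dn 2 by (simp add: md_torsion_free del: state_of.simps)
    qed
  qed
qed

text \<open>Used in contrapositive form: an edge outside the tree has a label other than itself, as
  the descent of the flow requires.\<close>

lemma tree_edge_if_label:
  assumes "expansion (fst v)" "x \<in> letters" "label (state_of v) x = [x]"
  shows "child (state_of v) x \<or> child (state_of (act v x)) (letter_inv x)"
proof -
  obtain f i j where v: "v = (f, i, j)" by (cases v) auto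
  obtain ph k h u where st: "state_of (f, i, j) = (ph, k, h, u)" by (metis prod_cases4)
  show ?thesis
  proof (cases x)
    case (LA e)
    then have e: "e \<in> digits" using assms(2) by (auto simp: letters_def)
    have u: "u = -1 \<or> u = 0 \<or> u = 1" and h: "h = -1 \<or> h = 0 \<or> h = 1" and ph: "ph = 0 \<or> ph = 1 \<or> ph = 2"
      using st by (auto simp: sgn_if split: if_splits)
    \<comment> \<open>Over the integers the letters are 1 and -1, so \<open>e\<close> and
      \<open>k\<close> agree unless they cancel.\<close>
    have k: "e = k" if torsion_free "e \<noteq> md (- k)" "ph \<noteq> 0"
    proof -
      have fn: "f \<noteq> (\<lambda>n. 0)" using st that by auto
      have "\<exists>c. c \<noteq> 0 \<and> k = dig c"
      proof (cases "pole_order f")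
        case 0
        then show ?thesis using st has_deg_fdeg[OF _ fn] assms(1) v by (auto simp: has_deg_def)
      next
        case (Suc q)
        then show ?thesis
          using st polar_coeff_nonzero[OF expansion_pole_le Suc] assms(1) v by auto
      qed
      then show ?thesis
        using that e by (auto simp: dig_def digits_def sgn_if md_torsion_free split: if_splits)
    qed
    have "child (ph, k, h, u) (LA e) \<or> ph \<noteq> 0 \<and> h = 0 \<and> u = 0 \<and> e = md (- k)"
      using assms(3) LA st v u h ph k by (auto simp: label_defs split: if_splits)
    then show ?thesis
    proof
      assume "child (ph, k, h, u) (LA e)"
      then show ?thesis using st v LA by (simp del: state_of.simps child.simps)
    next
      assume "ph \<noteq> 0 \<and> h = 0 \<and> u = 0 \<and> e = md (- k)"
      then have "child (state_of (add_mono f e i j, i, j)) (LA (md (- e)))"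
        using reverse_child_LA[of f e i j ph k] assms(1) e st v
        by (simp del: state_of.simps child.simps)
      then show ?thesis using v LA by (simp del: state_of.simps child.simps)
    qed
  qed (use assms(3) v in \<open>auto simp: sgn_if split: if_splits\<close>)
qed

section \<open>The flow labels decrease the rank\<close>

primrec vertex_path :: "vertex \<Rightarrow> letter list \<Rightarrow> (vertex \<times> letter) list" where
  "vertex_path v [] = []"
| "vertex_path v (x # w) = (v, x) # vertex_path (act v x) w"

fun edge_rank :: "vertex \<Rightarrow> int \<Rightarrow> nat \<times> nat \<times> nat \<times> nat \<times> nat" where
  "edge_rank (f, i, j) e = rank f (add_mono f e i j) i j"

definition decreasing :: "vertex \<Rightarrow> int \<Rightarrow> letter list \<Rightarrow> bool" where
  "decreasing v e w \<longleftrightarrow>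
     (\<forall>u d. (u, LA d) \<in> set (vertex_path v w) \<longrightarrow> edge_rank u d \<prec> edge_rank v e)"

lemma decreasing_labels:
  "decreasing (f, i, j) e (up_right e) \<longleftrightarrow>
     rank f (add_mono f e i (j + 1)) i (j + 1) \<prec> rank f (add_mono f e i j) i j \<and>
     rank (add_mono f e i (j + 1)) (add_mono f e i j) (i + 1) j \<prec> rank f (add_mono f e i j) i j"
  "decreasing (f, i, j) e (right_up e) \<longleftrightarrow>
     rank f (add_mono f (md (- e)) (i + 1) j) (i + 1) j \<prec> rank f (add_mono f e i j) i j \<and>
     rank (add_mono f (md (- e)) (i + 1) j) (add_mono f e i j) i (j + 1) \<prec> rank f (add_mono f e i j) i j"
  "decreasing (f, i, j) e (down_right e) \<longleftrightarrow>
     rank f (add_mono f e i (j - 1)) i (j - 1) \<prec> rank f (add_mono f e i j) i j \<and>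
     rank (add_mono f e i (j - 1)) (add_mono f e i j) (i + 1) (j - 1) \<prec> rank f (add_mono f e i j) i j"
  "decreasing (f, i, j) e (right_down e) \<longleftrightarrow>
     rank f (add_mono f e (i + 1) (j - 1)) (i + 1) (j - 1) \<prec> rank f (add_mono f e i j) i j \<and>
     rank (add_mono f e (i + 1) (j - 1)) (add_mono f e i j) i (j - 1) \<prec> rank f (add_mono f e i j) i j"
  "decreasing (f, i, j) e (up_left e) \<longleftrightarrow>
     rank f (add_mono f e (i - 1) (j + 1)) (i - 1) (j + 1) \<prec> rank f (add_mono f e i j) i j \<and>
     rank (add_mono f e (i - 1) (j + 1)) (add_mono f e i j) (i - 1) j \<prec> rank f (add_mono f e i j) i j"
  "decreasing (f, i, j) e (left_up e) \<longleftrightarrow>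
     rank f (add_mono f (md (- e)) (i - 1) j) (i - 1) j \<prec> rank f (add_mono f e i j) i j \<and>
     rank (add_mono f (md (- e)) (i - 1) j) (add_mono f e i j) (i - 1) (j + 1) \<prec> rank f (add_mono f e i j) i j"
  using add_mono_triangles[of f e i j] by (auto simp: decreasing_def label_defs)

lemma decreasing_two:
  "md (c + d) = md e \<Longrightarrow> decreasing (f, i, j) e [LA c, LA d] \<longleftrightarrow>
     rank f (add_mono f c i j) i j \<prec> rank f (add_mono f e i j) i j \<and>
     rank (add_mono f c i j) (add_mono f e i j) i j \<prec> rank f (add_mono f e i j) i j"
  by (auto simp: decreasing_def add_mono_same)

lemma state_digit:
  assumes "expansion f" "f \<noteq> (\<lambda>n. 0)" "state_of (f, i, j) = (ph, k, h, u)"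
  shows "k \<in> digits"
proof (cases "pole_order f")
  case 0
  then show ?thesis
    using assms has_deg_fdeg[OF assms(1,2)] dig_in_digits[OF expansion_md[OF assms(1)]]
    by (auto simp: has_deg_def)
next
  case (Suc q)
  then show ?thesis
    using assms polar_coeff_nonzero[OF expansion_pole_le[OF assms(1)] Suc]
      polar_polar_coeff(2)[of f q i] expansion_pole_le[OF assms(1)] dig_in_digits by auto
qed

text \<open>Viewed at pole order \<open>- j\<close>, the coefficient grows from 0 to
  \<open>e\<close>, so \<open>rank_up_pole\<close> applies. The new monomial has degree below
  \<open>i\<close>, so for nonzero \<open>f\<close> the column \<open>i\<close> lies on the same
  side of the new degree as of \<open>fdeg f\<close>.\<close>

lemma decreasing_new_pole:
  assumes f: "expansion f" and e: "e \<in> digits" and j: "j + int (pole_order f) < 0"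
    and ne: "label (state_of (f, i, j)) (LA e) \<noteq> [LA e]"
  shows "decreasing (f, i, j) e (label (state_of (f, i, j)) (LA e))"
proof -
  define q where "q = nat (- j) - 1"
  have jq: "j = - int q - 1" using j by (simp add: q_def)
  let ?g = "add_mono f e i j" and ?M = "fdeg f"
  have p0: "polar f q i 0"
    using pole_le_mono[OF expansion_pole_le[OF f]] j by (simp add: polar_0 q_def)
  have up: "cnorm 0 < cnorm (0 + e)" using cnorm_digit[OF e] by (simp add: cnorm_def)
  have gn: "?g \<noteq> (\<lambda>n. 0)"
    using polar_nonzero[OF polar_add_line[OF p0 jq, of e i]] digit_nonzero[OF e] by simp
  show ?thesis
  proof (cases "f = (\<lambda>n. 0)")
    case True
    have "fdeg ?g \<le> i + j"
      by (rule fdeg_le[OF expansion_add[OF f] _ gn]) (simp add: True add_mono_def mono_coeff_above)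
    then have "fdeg ?g < i" using jq by simp
    then show ?thesis
      using rank_up_pole(2)[OF e p0 jq up] True j by (simp add: decreasing_labels)
  next
    case False
    note M = has_deg_fdeg[OF f False]
    have "i \<noteq> ?M"
    proof
      assume "i = ?M"
      then have "label (state_of (f, i, j)) (LA e) = [LA e]" using j False by simp
      then show False using ne by contradiction
    qed
    then consider "i < ?M" | "?M < i" by linarith
    then show ?thesis
    proof cases
      case 1
      have "fdeg ?g = ?M" using fdeg_eq[OF has_deg_keep[OF f M]] 1 jq by simp
      then show ?thesis
        using rank_up_pole(1)[OF e p0 jq up] 1 False j by (simp add: decreasing_labels sgn_if)
    next
      case 2
      have "fdeg ?g \<le> max ?M (i + j)"
        using M by (intro fdeg_le[OF expansion_add[OF f] _ gn]) (simp add: add_mono_above[OF f] has_deg_def)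
      then have "fdeg ?g < i" using 2 jq by simp
      then show ?thesis
        using rank_up_pole(2)[OF e p0 jq up] 2 False j by (simp add: decreasing_labels sgn_if)
    qed
  qed
qed

lemma decreasing_pole:
  assumes f: "expansion f" and e: "e \<in> digits" and q: "pole_order f = Suc q" and j: "0 \<le> j + int (Suc q)"
    and ne: "label (state_of (f, i, j)) (LA e) \<noteq> [LA e]"
  shows "decreasing (f, i, j) e (label (state_of (f, i, j)) (LA e))"
proof -
  let ?k = "polar_coeff f q i" and ?M = "fdeg f" and ?g = "add_mono f e i j"
  have fn: "f \<noteq> (\<lambda>n. 0)" using q pole_order_zero by auto
  note M = has_deg_fdeg[OF f fn]
  have k: "polar f q i ?k" "?k \<noteq> 0" "md ?k = ?k"
    using polar_polar_coeff polar_coeff_nonzero expansion_pole_le[OF f] q by metis+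
  then have mk: "md ?k \<noteq> 0" by simp
  note dn = down(1)[OF k(3,2) e] and ndn = not_down[OF k(3,2) e]
  show ?thesis
  proof (cases "j + int (Suc q) = 0")
    case False
    then have "- int q \<le> j" using j by simp
    note inner = rank_inner_pole[OF e k(1) this mk]
    show ?thesis
    proof (cases "e = md (- dig ?k)")
      case True
      then have "cnorm (?k + e) \<le> cnorm ?k" using dn by simp
      then show ?thesis using inner(1) True False fn q j by (simp add: decreasing_labels)
    next
      case ee: False
      then show ?thesis using inner(2) ndn(1) False fn q j by (simp add: decreasing_labels)
    qed
  next
    case True
    then have jq: "j = - int q - 1" by simp
    have st: "state_of (f, i, j) = (2, dig ?k, sgn (i - ?M), 0)" using fn q True by simp
    consider "e = md (- dig ?k)" | "e \<noteq> md (- dig ?k)" torsion_free | "e \<noteq> md (- dig ?k)" "\<not> torsion_free" by blast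
    then show ?thesis
    proof cases
      case 1
      then have iM: "i \<noteq> ?M" using ne st by auto
      show ?thesis
        using rank_down_pole[OF e k(1) jq dn[OF 1]] 1 iM unfolding st by (auto simp: decreasing_labels sgn_if)
    next
      case 2
      then have iM: "i \<noteq> ?M" using ne st by auto
      note up = rank_up_pole[OF e k(1) jq ndn(2)[OF 2(1,2), THEN conjunct1]]
      show ?thesis
      proof (cases "i < ?M")
        case True
        have "fdeg ?g = ?M" using fdeg_eq[OF has_deg_keep[OF f M]] True jq by simp
        then show ?thesis using up(1) 2 True unfolding st by (simp add: decreasing_labels)
      next
        case False
        have "polar ?g q i (?k + e)" using polar_add_line[OF k(1) jq, of e i] by simp
        then have gn: "?g \<noteq> (\<lambda>n. 0)" by (rule polar_nonzero) (use ndn(2)[OF 2(1,2)] md_torsion_free[OF 2(2)] in simp)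
        have "fdeg ?g \<le> max ?M (i + j)"
          using M by (intro fdeg_le[OF expansion_add[OF f] _ gn]) (simp add: add_mono_above[OF f] has_deg_def)
        then have "fdeg ?g < i" using False iM jq by simp
        then show ?thesis using up(2) 2 False iM unfolding st by (simp add: decreasing_labels)
      qed
    next
      case 3
      then have "dig ?k = ?k" by (simp add: dig_def)
      moreover have "md (md (- ?k) + md (e + ?k)) = md e" by (simp add: mod_simps)
      ultimately show ?thesis
        using rank_flat_pole[OF e k(1) jq] ndn(3)[OF 3] 3 unfolding st by (simp add: decreasing_two)
    qed
  qed
qed

lemma decreasing_laurent:
  assumes f: "expansion f" and e: "e \<in> digits" and q: "pole_order f = 0" and j: "0 \<le> j"
    and ne: "label (state_of (f, i, j)) (LA e) \<noteq> [LA e]"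
  shows "decreasing (f, i, j) e (label (state_of (f, i, j)) (LA e))"
proof -
  let ?M = "fdeg f"
  have fl: "pole_le f 0" using expansion_pole_le[OF f] q by simp
  show ?thesis
  proof (cases "f = (\<lambda>n. 0) \<or> ?M < i + j")
    case True
    have st: "\<exists>k h u. state_of (f, i, j) = (if f = (\<lambda>n. 0) then 0 else 1, k, h, sgn j) \<and> (f \<noteq> (\<lambda>n. 0) \<longrightarrow> 0 < h)"
      using True q j by auto
    \<comment> \<open>Beyond the degree the edge creates a leading term, so it counts as growth from
      0 at \<open>M = i + j\<close>.\<close>
    have zero: "f n = 0" if "n \<ge> i + j" for n
      using True has_deg_fdeg[OF f] that by (cases "f = (\<lambda>n. 0)") (auto simp: has_deg_def)
    have "0 < j"
      using ne st j by (auto simp: sgn_if split: if_splits)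
    moreover have "cnorm (f (i + j)) < cnorm (f (i + j) + e)"
      using zero cnorm_digit[OF e] by (simp add: cnorm_def)
    ultimately have "decreasing (f, i, j) e (down_right e)"
      using rank_up_laurent[OF e f fl zero, of "i + j" j i] add_mono_triangles[of f e i j]
      by (simp add: decreasing_labels)
    moreover have "label (state_of (f, i, j)) (LA e) = down_right e"
      using st \<open>0 < j\<close> by (auto split: if_splits)
    ultimately show ?thesis by simp
  next
    case False
    then have fn: "f \<noteq> (\<lambda>n. 0)" by simp
    note M = has_deg_fdeg[OF f fn]
    have c: "f ?M \<noteq> 0" "md (f ?M) = f ?M" and above: "\<And>n. n > ?M \<Longrightarrow> f n = 0"
      using M expansion_md[OF f] by (simp_all add: has_deg_def)
    note dn = down(1)[OF c(2,1) e] and ndn = not_down[OF c(2,1) e]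
    have st: "state_of (f, i, j) = (1, dig (f ?M), sgn (i - ?M + j), sgn j)" using fn q j by simp
    show ?thesis
    proof (cases "i + j < ?M")
      case True
      note inner = rank_inner_laurent[OF e f fl above j True c(1)]
      have h: "sgn (i - ?M + j) = -1" using True by (simp add: sgn_if)
      show ?thesis
      proof (cases "e = md (- dig (f ?M))")
        case True
        then show ?thesis
          using inner(1,2) dn j h unfolding st by (simp add: decreasing_labels add_mono_triangles)
      next
        case False
        then show ?thesis
          using inner(3,4) ndn(1) j h unfolding st by (simp add: decreasing_labels add_mono_triangles)
      qed
    next
      case eq: False
      then have ij: "i + j = ?M" using False by simp
      then have h: "sgn (i - ?M + j) = 0" by simp
      consider "e = md (- dig (f ?M))" | "e \<noteq> md (- dig (f ?M))" torsion_free
        | "e \<noteq> md (- dig (f ?M))" "\<not> torsion_free" by blast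
      then show ?thesis
      proof cases
        case 1
        then have "0 < j" using ne h j unfolding st by (auto simp: sgn_if split: if_splits)
        then show ?thesis
          using rank_down_laurent[OF e f fl above _ ij dn] 1 h j unfolding st
          by (simp add: decreasing_labels add_mono_triangles)
      next
        case 2
        then have "0 < j" using ne h j unfolding st by (auto simp: sgn_if split: if_splits)
        then show ?thesis
          using rank_up_laurent[OF e f fl above _ ij] ndn(2)[OF 2(1,2)] 2 h j unfolding st
          by (simp add: decreasing_labels add_mono_triangles)
      next
        case 3
        then have "dig (f ?M) = f ?M" by (simp add: dig_def)
        moreover have "md (md (- f ?M) + md (e + f ?M)) = md e" by (simp add: mod_simps)
        ultimately show ?thesis
          using rank_flat_laurent[OF e f fl above j ij] ndn(3)[OF 3] 3 h j unfolding st
          by (simp add: decreasing_two)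
      qed
    qed
  qed
qed

lemma decreasing_label:
  assumes "expansion f" "e \<in> digits" "label (state_of (f, i, j)) (LA e) \<noteq> [LA e]"
  shows "decreasing (f, i, j) e (label (state_of (f, i, j)) (LA e))"
  using decreasing_new_pole[OF assms(1,2) _ assms(3)] decreasing_pole[OF assms(1,2) _ _ assms(3)]
    decreasing_laurent[OF assms(1,2) _ _ assms(3)]
  by (cases "j + int (pole_order f) < 0"; cases "pole_order f") (auto simp: not_less)

text \<open>Edges within a plane come below all edges labelled by powers of \<open>a\<close>. They
  are ordered by the distance of their row from the line; the factor 2 leaves room to put
  \<open>LT\<close> and \<open>LT'\<close> below the other letters of the same row.\<close>

fun edge_key :: "vertex \<Rightarrow> letter \<Rightarrow> nat \<times> nat \<times> nat \<times> nat \<times> nat \<times> nat" where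
  "edge_key v (LA e) = (1, edge_rank v e)"
| "edge_key (f, i, j) x =
     (0, 2 * nat \<bar>j + int (pole_order f)\<bar> + (if x = LT \<or> x = LT' then 0 else 1), 0, 0, 0, 0)"

definition key_less :: "((nat \<times> nat \<times> nat \<times> nat \<times> nat \<times> nat) \<times> (nat \<times> nat \<times> nat \<times> nat \<times> nat \<times> nat)) set" where
  "key_less = less_than <*lex*> rank_less"

lemma wf_key_less: "wf key_less"
  using wf_rank_less by (auto simp: key_less_def)

lemma label_key_less:
  assumes f: "expansion (fst v)" and x: "x \<in> letters" and ne: "label (state_of v) x \<noteq> [x]"
    and path: "(u, y) \<in> set (vertex_path v (label (state_of v) x))"
  shows "(edge_key u y, edge_key v x) \<in> key_less \<or> child (state_of u) y \<or>
    child (state_of (act u y)) (letter_inv y)"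
proof -
  obtain f i j where v: "v = (f, i, j)" by (cases v) auto
  obtain ph k h s where st: "state_of (f, i, j) = (ph, k, h, s)" by (metis prod_cases4)
  have s: "s = sgn (j + int (pole_order f))" using st by simp
  show ?thesis
  proof (cases x)
    case (LA e)
    define w where "w = label (state_of v) x"
    have e: "e \<in> digits" using x LA by (auto simp: letters_def)
    have "expansion f" using f v by simp
    moreover have "label (state_of (f, i, j)) (LA e) \<noteq> [LA e]" using ne unfolding v LA .
    ultimately have d: "decreasing v e w" unfolding w_def v LA using e by (intro decreasing_label)
    have path': "(u, y) \<in> set (vertex_path v w)" using path unfolding w_def .
    show ?thesis
    proof (cases y)
      case y: (LA d')
      then have "edge_rank u d' \<prec> edge_rank v e" using d path' unfolding decreasing_def by blast
      then show ?thesis using LA y by (simp add: key_less_def)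
    qed (use LA in \<open>cases u, simp add: key_less_def\<close>)+
  qed (use path ne in \<open>auto simp: v st key_less_def rank_less_def s sgn_if simp del: state_of.simps split: if_splits\<close>)
qed

lemma label_letters:
  assumes f: "expansion (fst v)" and x: "x \<in> letters"
  shows "set (label (state_of v) x) \<subseteq> letters"
proof -
  obtain f i j where v: "v = (f, i, j)" by (cases v) auto
  obtain ph k h s where st: "state_of (f, i, j) = (ph, k, h, s)" by (metis prod_cases4)
  show ?thesis
  proof (cases x)
    case (LA e)
    then have e: "e \<in> digits" using x by (auto simp: letters_def)
    have "md (- k) \<in> digits \<and> (e \<noteq> md (- k) \<longrightarrow> \<not> torsion_free \<longrightarrow> md (e + k) \<in> digits)" if "ph \<noteq> 0"
    proof
      have "f \<noteq> (\<lambda>n. 0)" using st that by auto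
      then have k: "k \<in> digits" using state_digit st f v by auto
      then show "md (- k) \<in> digits" by (rule digit_neg)
      show "e \<noteq> md (- k) \<longrightarrow> \<not> torsion_free \<longrightarrow> md (e + k) \<in> digits"
      proof (intro impI)
        assume a: "e \<noteq> md (- k)" "\<not> torsion_free"
        have "md (e + k) \<noteq> 0"
        proof
          assume "md (e + k) = 0"
          then have "md e = md (- k)" by (metis add_diff_cancel_right' diff_0 mod_diff_left_eq)
          then show False using a digit_md[OF e] by simp
        qed
        then show "md (e + k) \<in> digits"
          using a(2) md_bounds[of "e + k"] by (auto simp: digits_def)
      qed
    qed
    then show ?thesis
      using e digit_neg[OF e] unfolding v st LA by (auto simp: letters_def label_defs)
  qed (auto simp: v st letters_def simp del: state_of.simps)
qed

lemma finite_digits: "finite digits"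
  by (simp add: digits_def)

lemma finite_states: "finite (state_of ` {v. expansion (fst v)})"
proof -
  let ?K = "insert 0 digits"
  have "state_of v \<in> {0, 1, 2} \<times> ?K \<times> {-1, 0, 1} \<times> {-1, 0, 1}" if "expansion (fst v)" for v
  proof -
    obtain f i j where v: "v = (f, i, j)" by (cases v) auto
    obtain ph k h s where st: "state_of (f, i, j) = (ph, k, h, s)" by (metis prod_cases4)
    have "k \<in> ?K"
    proof (cases "f = (\<lambda>n. 0)")
      case True
      then show ?thesis using st by (auto simp: pole_order_zero dig_def)
    next
      case False
      then show ?thesis using state_digit st that v by auto
    qed
    moreover have "ph \<in> {0, 1, 2}" "h \<in> {-1, 0, 1}" "s \<in> {-1, 0, 1}"
      using st by (auto simp: sgn_if split: if_splits)
    ultimately show ?thesis unfolding v st by (intro SigmaI)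
  qed
  then have "state_of ` {v. expansion (fst v)} \<subseteq> {0, 1, 2} \<times> ?K \<times> {-1, 0, 1} \<times> {-1, 0, 1}"
    by blast
  then show ?thesis by (rule finite_subset) (simp add: finite_digits)
qed

end

section \<open>The groups\<close>

definition letter_word :: "letter \<Rightarrow> gen gword" where
  "letter_word x = (case x of
     LA e \<Rightarrow> if 0 \<le> e then replicate (nat e) (gen_a, True) else replicate (nat (- e)) (gen_a, False)
   | LT \<Rightarrow> [(gen_t, True)] | LT' \<Rightarrow> [(gen_t, False)]
   | LS \<Rightarrow> [(gen_s, True)] | LS' \<Rightarrow> [(gen_s, False)]
   | LU \<Rightarrow> [(gen_t, False), (gen_s, True)] | LU' \<Rightarrow> [(gen_s, False), (gen_t, True)])"

context modulus begin

definition relations :: "(gen gword \<times> gen gword) set" where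
  "relations = (if p = 0 then {} else {(replicate p (gen_a, True), [])}) \<union> baumslag_relations"

abbreviation cls :: "gen gword \<Rightarrow> gen gword set" where
  "cls \<equiv> pres_class relations"

definition Gr :: "gen gword set monoid" where
  "Gr = presented_group relations"

fun gen_act :: "vertex \<Rightarrow> gen \<times> bool \<Rightarrow> vertex" where
  "gen_act (f, i, j) (gen_a, b) = (add_mono f (if b then 1 else -1) i j, i, j)"
| "gen_act (f, i, j) (gen_s, b) = (f, i, if b then j + 1 else j - 1)"
| "gen_act (f, i, j) (gen_t, b) = (f, if b then i + 1 else i - 1, j)"

abbreviation word_act :: "vertex \<Rightarrow> gen gword \<Rightarrow> vertex" where
  "word_act \<equiv> foldl gen_act"

lemma expansion_gen_act: "expansion (fst v) \<Longrightarrow> expansion (fst (gen_act v x))"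
  by (cases "(v, x)" rule: gen_act.cases) (auto simp: expansion_add)

lemma expansion_word_act: "expansion (fst v) \<Longrightarrow> expansion (fst (word_act v w))"
  by (induction w arbitrary: v) (simp_all add: expansion_gen_act)

lemma add_mono_zero: "expansion f \<Longrightarrow> add_mono f 0 i j = f"
  by (rule ext) (simp add: add_mono_def expansion_md)

lemma add_mono_sum: "add_mono (add_mono f c i j) d i j = add_mono f (c + d) i j"
  by (rule add_mono_same) simp

lemma add_mono_cong: "md c = md d \<Longrightarrow> add_mono f c i j = add_mono f d i j"
  by (metis add_mono_md)

lemma word_act_replicate:
  "expansion f \<Longrightarrow> word_act (f, i, j) (replicate n (gen_a, b)) =
     (add_mono f (if b then int n else - int n) i j, i, j)"
proof (induction n arbitrary: f)
  case (Suc n)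
  then show ?case by (simp add: expansion_add add_mono_sum)
qed (simp add: add_mono_zero)

lemma word_act_relation:
  assumes f: "expansion f" and lr: "(l, r) \<in> relations"
  shows "word_act (f, i, j) l = word_act (f, i, j) r"
proof -
  have tri: "mono_coeff i (j + 1) n = mono_coeff i j n + mono_coeff (i + 1) j n" for n
    by (simp add: mono_coeff_triangle)
  consider "p \<noteq> 0" "l = replicate p (gen_a, True)" "r = []" | "(l, r) \<in> baumslag_relations"
    using lr by (auto simp: relations_def split: if_splits)
  then show ?thesis
  proof cases
    case 1
    have "add_mono f (int p) i j = add_mono f 0 i j" by (rule add_mono_cong) simp
    then show ?thesis using word_act_replicate[OF f, of i j p True] add_mono_zero[OF f] 1 by simp
  next
    case 2
    have "add_mono f 1 i (j + 1) = add_mono (add_mono f 1 (i + 1) j) 1 i j"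
      unfolding add_mono_add_mono unfolding add_mono_def tri by (simp add: algebra_simps)
    moreover have "add_mono (add_mono (add_mono (add_mono f 1 (i + 1) j) 1 i j) (-1) (i + 1) j) (-1) i j = f"
      using expansion_md[OF f] by (intro ext) (simp add: add_mono_def mod_simps algebra_simps)
    ultimately show ?thesis
      using 2 by (auto simp: baumslag_relations_def gword_conj_def gword_comm_def gword_inv_def Let_def)
  qed
qed

lemma word_act_pres_eq:
  "pres_eq relations u w \<Longrightarrow> expansion (fst v) \<Longrightarrow> word_act v u = word_act v w"
proof (induction arbitrary: v rule: pres_eq.induct)
  case (cancel u x b w)
  obtain f i j where v: "word_act v u = (f, i, j)" by (cases "word_act v u") auto
  then have "expansion f" using expansion_word_act[OF cancel, of u] by simp
  then have "word_act (f, i, j) [(x, b), (x, \<not> b)] = (f, i, j)"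
    by (cases x; cases b) (simp_all add: add_mono_sum add_mono_zero)
  then show ?case using v by simp
next
  case (rel l r u w)
  obtain f i j where v: "word_act v u = (f, i, j)" by (cases "word_act v u") auto
  then have "expansion f" using expansion_word_act[OF rel(2), of u] by simp
  then show ?case using word_act_relation[OF _ rel(1), of f i j] v by simp
qed auto

definition root :: vertex where
  "root = (\<lambda>n. 0, 0, 0)"

definition vertex_of :: "gen gword set \<Rightarrow> vertex" where
  "vertex_of g = word_act root (SOME w. cls w = g)"

lemma expansion_root: "expansion (fst root)"
  by (simp add: root_def expansion_zero)

lemma vertex_of_cls: "vertex_of (cls w) = word_act root w"
proof -
  have "cls (SOME w'. cls w' = cls w) = cls w" by (rule someI) simp
  then show ?thesis
    unfolding vertex_of_def using word_act_pres_eq[OF _ expansion_root] by (simp add: pres_class_eq_iff)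
qed

abbreviation gr_mult :: "gen gword set \<Rightarrow> gen gword set \<Rightarrow> gen gword set" (infixl "\<bullet>" 70) where
  "g \<bullet> h \<equiv> g \<otimes>\<^bsub>Gr\<^esub> h"

abbreviation gr_inv :: "gen gword set \<Rightarrow> gen gword set" where
  "gr_inv g \<equiv> inv\<^bsub>Gr\<^esub> g"

lemma carrier_Gr: "carrier Gr = range cls"
  and one_Gr: "\<one>\<^bsub>Gr\<^esub> = cls []"
  by (simp_all add: Gr_def presented_group_def)

lemma mult_Gr: "cls u \<bullet> cls w = cls (u @ w)"
  unfolding Gr_def by (rule presented_group_mult)

lemma expansion_vertex_of: "g \<in> carrier Gr \<Longrightarrow> expansion (fst (vertex_of g))"
  using expansion_word_act[OF expansion_root] by (auto simp: carrier_Gr vertex_of_cls)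

sublocale Gr: group Gr
  unfolding Gr_def by (rule group_presented_group)

section \<open>The letters as elements of the group\<close>

definition gamma :: "letter \<Rightarrow> gen gword set" where
  "gamma x = cls (letter_word x)"

lemma gamma_carrier [simp]: "gamma x \<in> carrier Gr"
  by (simp add: gamma_def carrier_Gr)

lemma word_act_letter_word: "expansion (fst v) \<Longrightarrow> word_act v (letter_word x) = act v x"
  by (cases "(v, x)" rule: act.cases) (simp_all add: letter_word_def word_act_replicate)

lemma vertex_of_mult_gamma:
  assumes "g \<in> carrier Gr"
  shows "vertex_of (g \<bullet> gamma x) = act (vertex_of g) x"
proof -
  obtain w where w: "g = cls w" using assms by (auto simp: carrier_Gr)
  then show ?thesis
    using word_act_letter_word[OF expansion_word_act[OF expansion_root]]
    by (simp add: gamma_def mult_Gr vertex_of_cls)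
qed

lemma vertex_of_one: "vertex_of \<one>\<^bsub>Gr\<^esub> = root"
  by (simp add: one_Gr vertex_of_cls)

lemma vertex_of_gamma: "vertex_of (gamma x) = act root x"
  using vertex_of_mult_gamma[of "\<one>\<^bsub>Gr\<^esub>" x] by (simp add: vertex_of_one)

lemma act_root_LA: "e \<in> digits \<Longrightarrow> fst (act root (LA e)) 0 = e"
  using digit_md by (simp add: root_def add_mono_top)

text \<open>The letters move the root to different vertices, so the action separates them even
  though its faithfulness is unknown.\<close>

lemma inj_on_gamma: "inj_on gamma letters"
proof (rule inj_onI)
  fix x y assume xy: "x \<in> letters" "y \<in> letters" "gamma x = gamma y"
  then have "act root x = act root y" using vertex_of_gamma by metis
  then show "x = y"
  proof (cases "\<exists>e d. x = LA e \<and> y = LA d")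
    case True
    then show ?thesis using xy act_root_LA \<open>act root x = act root y\<close> by (metis imageE letters_def letter.inject UnE insertE empty_iff letter.distinct)
  next
    case False
    then show ?thesis using \<open>act root x = act root y\<close> by (cases x; cases y) (auto simp: root_def)
  qed
qed

lemma gamma_not_one: "x \<in> letters \<Longrightarrow> gamma x \<noteq> \<one>\<^bsub>Gr\<^esub>"
proof
  assume x: "x \<in> letters" "gamma x = \<one>\<^bsub>Gr\<^esub>"
  then have "act root x = root" using vertex_of_gamma vertex_of_one by metis
  moreover have "fst (act root x) 0 \<noteq> 0" if "x = LA e" for e
    using act_root_LA[of e] digit_nonzero[of e] x(1) that by (auto simp: letters_def)
  ultimately show False by (cases x) (auto simp: root_def)
qed

subsection \<open>Identities between the letters\<close>

abbreviation ga :: "gen gword set" where "ga \<equiv> cls [(gen_a, True)]"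
abbreviation gs :: "gen gword set" where "gs \<equiv> cls [(gen_s, True)]"
abbreviation gt :: "gen gword set" where "gt \<equiv> cls [(gen_t, True)]"

lemma gen_carrier [simp]: "cls w \<in> carrier Gr"
  by (simp add: carrier_Gr)

lemma inv_cls: "gr_inv (cls w) = cls (gword_inv w)"
  by (rule Gr.inv_equality)
    (simp_all add: mult_Gr one_Gr pres_class_eq_iff pres_eq_inv_left)

lemma gamma_LA: "gamma (LA e) = ga [^]\<^bsub>Gr\<^esub> e"
proof -
  have pow: "cls (replicate n (x, True)) = cls [(x, True)] [^]\<^bsub>Gr\<^esub> n" for n x
  proof (induction n)
    case 0
    then show ?case by (simp add: one_Gr)
  next
    case (Suc n)
    then show ?case by (simp flip: replicate_append_same mult_Gr)
  qed
  have "gword_inv (replicate n (gen_a, True)) = replicate n (gen_a, False)" for n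
    by (induction n) (simp_all add: gword_inv_def replicate_append_same)
  then have neg: "cls (replicate n (gen_a, False)) = gr_inv (ga [^]\<^bsub>Gr\<^esub> n)" for n
    using inv_cls[of "replicate n (gen_a, True)"] unfolding pow by metis
  show ?thesis
  proof (cases "0 \<le> e")
    case True
    then obtain n where "e = int n" using nonneg_int_cases by blast
    then show ?thesis unfolding gamma_def letter_word_def using pow by (simp add: int_pow_int)
  next
    case False
    then obtain n where n: "e = - int n" "n \<noteq> 0" by (metis int_cases2 neg_0_equal_iff_equal of_nat_0 of_nat_0_le_iff)
    then have "gamma (LA e) = cls (replicate n (gen_a, False))"
      using False by (simp add: gamma_def letter_word_def)
    then show ?thesis using neg n Gr.int_pow_neg_int[of ga n] by simp
  qed
qed

lemma gamma_flat:
  "gamma LT = gt" "gamma LS = gs" "gamma LT' = gr_inv gt" "gamma LS' = gr_inv gs"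
  "gamma LU = gr_inv gt \<bullet> gs" "gamma LU' = gr_inv gs \<bullet> gt"
  by (simp_all add: gamma_def letter_word_def inv_cls gword_inv_def mult_Gr)

lemma cls_relation: "(l, r) \<in> relations \<Longrightarrow> cls l = cls r"
  using pres_eq.rel[of l r relations "[]" "[]"] by (simp add: pres_class_eq_iff)

lemma pow_p: "ga [^]\<^bsub>Gr\<^esub> int p = \<one>\<^bsub>Gr\<^esub>"
proof (cases "p = 0")
  case False
  then have "cls (replicate p (gen_a, True)) = cls []"
    by (intro cls_relation) (simp add: relations_def)
  moreover have "cls (replicate p (gen_a, True)) = gamma (LA (int p))"
    by (simp add: gamma_def letter_word_def)
  ultimately show ?thesis by (simp add: gamma_LA one_Gr)
qed simp

lemma pow_md: "ga [^]\<^bsub>Gr\<^esub> md e = ga [^]\<^bsub>Gr\<^esub> (e :: int)"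
proof -
  have "ga [^]\<^bsub>Gr\<^esub> e = ga [^]\<^bsub>Gr\<^esub> (int p * (e div int p) + md e)" by simp
  also have "\<dots> = ga [^]\<^bsub>Gr\<^esub> (int p * (e div int p)) \<bullet> ga [^]\<^bsub>Gr\<^esub> md e"
    by (rule Gr.int_pow_mult) simp
  also have "ga [^]\<^bsub>Gr\<^esub> (int p * (e div int p)) = (ga [^]\<^bsub>Gr\<^esub> int p) [^]\<^bsub>Gr\<^esub> (e div int p)"
    by (rule Gr.int_pow_pow[symmetric]) simp
  finally show ?thesis by (simp add: pow_p)
qed

lemma gamma_inv: "gamma (letter_inv x) = gr_inv (gamma x)"
  by (cases x) (simp_all add: gamma_LA pow_md Gr.int_pow_neg gamma_flat Gr.inv_mult_group)

lemma baumslag_in_relations: "baumslag_relations \<subseteq> relations"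
  by (auto simp: relations_def)

lemma st_commute: "gs \<bullet> gt = gt \<bullet> gs"
proof -
  have "cls (gword_comm [(gen_s, True)] [(gen_t, True)]) = cls []"
    using baumslag_in_relations by (intro cls_relation) (auto simp: baumslag_relations_def Let_def)
  then have "gs \<bullet> gt \<bullet> gr_inv gs \<bullet> gr_inv gt = \<one>\<^bsub>Gr\<^esub>"
    by (simp add: gword_comm_def inv_cls mult_Gr one_Gr)
  then have "gs \<bullet> gt = gr_inv (gr_inv gs \<bullet> gr_inv gt)"
    by (intro Gr.inv_equality[symmetric]) (simp_all add: Gr.m_assoc)
  then show ?thesis by (simp add: Gr.inv_mult_group)
qed

lemma cancel_left:
  assumes "x \<in> carrier Gr" "y \<in> carrier Gr"
  shows "gr_inv x \<bullet> (x \<bullet> y) = y" "x \<bullet> (gr_inv x \<bullet> y) = y"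
  using assms by (simp_all flip: Gr.m_assoc)

definition conj_by :: "gen gword set \<Rightarrow> gen gword set \<Rightarrow> gen gword set" where
  "conj_by h g = h \<bullet> g \<bullet> gr_inv h"

lemma conj_by_carrier [simp]: "\<lbrakk>h \<in> carrier Gr; g \<in> carrier Gr\<rbrakk> \<Longrightarrow> conj_by h g \<in> carrier Gr"
  by (simp add: conj_by_def)

lemma conj_by_hom: "h \<in> carrier Gr \<Longrightarrow> conj_by h \<in> hom Gr Gr"
  by (rule homI) (simp_all add: conj_by_def Gr.m_assoc cancel_left)

lemma conj_by_pow:
  "\<lbrakk>h \<in> carrier Gr; g \<in> carrier Gr\<rbrakk> \<Longrightarrow> conj_by h (g [^]\<^bsub>Gr\<^esub> (e :: int)) = conj_by h g [^]\<^bsub>Gr\<^esub> e"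
  by (rule group_hom.hom_int_pow) (simp_all add: group_hom_def group_hom_axioms_def conj_by_hom Gr.is_group)
text \<open>Since \<open>a\<close> commutes with its conjugate by \<open>t\<close>, powers
  distribute over their product, and the defining relation passes from \<open>a\<close> to all its
  powers.\<close>

lemma conj_a:
  fixes e :: int
  defines "A \<equiv> ga [^]\<^bsub>Gr\<^esub> e"
  shows "conj_by gs A = conj_by gt A \<bullet> A" "conj_by gt A \<bullet> A = A \<bullet> conj_by gt A"
proof -
  have "cls (gword_comm (gword_conj [(gen_a, True)] [(gen_t, True)]) [(gen_a, True)]) = cls []"
    using baumslag_in_relations by (intro cls_relation) (auto simp: baumslag_relations_def Let_def)
  moreover have gt_conj: "cls (gword_conj [(gen_a, True)] [(gen_t, True)]) = conj_by gt ga"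
    and gs_conj: "cls (gword_conj [(gen_a, True)] [(gen_s, True)]) = conj_by gs ga"
    by (simp_all add: gword_conj_def conj_by_def inv_cls mult_Gr)
  ultimately have "conj_by gt ga \<bullet> ga \<bullet> gr_inv (conj_by gt ga) \<bullet> gr_inv ga = \<one>\<^bsub>Gr\<^esub>"
    by (simp add: gword_comm_def inv_cls mult_Gr one_Gr flip: gt_conj)
  then have "conj_by gt ga \<bullet> ga = gr_inv (gr_inv (conj_by gt ga) \<bullet> gr_inv ga)"
    by (intro Gr.inv_equality[symmetric]) (simp_all add: Gr.m_assoc)
  then have comm: "conj_by gt ga \<bullet> ga = ga \<bullet> conj_by gt ga"
    by (simp add: Gr.inv_mult_group)
  have "cls (gword_conj [(gen_a, True)] [(gen_s, True)]) =
      cls (gword_conj [(gen_a, True)] [(gen_t, True)] @ [(gen_a, True)])"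
    using baumslag_in_relations by (intro cls_relation) (auto simp: baumslag_relations_def Let_def)
  then have rel: "conj_by gs ga = conj_by gt ga \<bullet> ga"
    using gs_conj gt_conj mult_Gr[of "gword_conj [(gen_a, True)] [(gen_t, True)]" "[(gen_a, True)]"]
    by metis
  show "conj_by gs A = conj_by gt A \<bullet> A"
    unfolding A_def by (simp add: conj_by_pow rel Gr.int_pow_mult_distrib[OF comm])
  show "conj_by gt A \<bullet> A = A \<bullet> conj_by gt A"
    unfolding A_def using Gr.int_pow_mult_distrib[OF comm, of e] Gr.int_pow_mult_distrib[OF comm[symmetric], of e]
    by (simp add: conj_by_pow comm)
qed

definition letters_prod :: "letter list \<Rightarrow> gen gword set" where
  "letters_prod w = foldr (\<otimes>\<^bsub>Gr\<^esub>) (map gamma w) \<one>\<^bsub>Gr\<^esub>"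

lemma letters_prod_simps [simp]:
  "letters_prod [] = \<one>\<^bsub>Gr\<^esub>"
  "letters_prod (x # w) = gamma x \<bullet> letters_prod w"
  by (simp_all add: letters_prod_def)

lemma letters_prod_carrier [simp]: "letters_prod w \<in> carrier Gr"
  by (induction w) auto

lemma foldl_gamma:
  "g \<in> carrier Gr \<Longrightarrow> foldl (\<otimes>\<^bsub>Gr\<^esub>) g (map gamma w) = g \<bullet> letters_prod w"
  by (induction w arbitrary: g) (simp_all add: Gr.m_assoc)

text \<open>Up to conjugation each word is a product or quotient of two of \<open>A\<close>,
  \<open>C\<close> and \<open>D\<close>, and \<open>C = D A = A D\<close> yields the third.\<close>

lemma letters_prod_triangles:
  "letters_prod (up_right e) = gamma (LA e)" "letters_prod (right_up e) = gamma (LA e)"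
  "letters_prod (down_right e) = gamma (LA e)" "letters_prod (right_down e) = gamma (LA e)"
  "letters_prod (up_left e) = gamma (LA e)" "letters_prod (left_up e) = gamma (LA e)"
proof -
  define A where "A = ga [^]\<^bsub>Gr\<^esub> e"
  define C where "C = conj_by gs A"
  define D where "D = conj_by gt A"
  have [simp]: "A \<in> carrier Gr" "C \<in> carrier Gr" "D \<in> carrier Gr"
    by (simp_all add: A_def C_def D_def)
  have CD: "C = D \<bullet> A" "C = A \<bullet> D"
    using conj_a[of e] by (simp_all add: A_def C_def D_def)
  have gA: "gamma (LA e) = A" "gamma (LA (md (- e))) = gr_inv A"
    by (simp_all add: gamma_LA pow_md Gr.int_pow_neg A_def)
  note simps = gA gamma_flat label_defs conj_by_def Gr.m_assoc Gr.inv_mult_group cancel_left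
  have "letters_prod (up_right e) = C \<bullet> gr_inv D" by (simp add: C_def D_def simps)
  also have "\<dots> = A" unfolding CD(2) by (simp add: Gr.m_assoc)
  finally show "letters_prod (up_right e) = gamma (LA e)" by (simp add: gA)
  have "letters_prod (right_up e) = gr_inv D \<bullet> C" by (simp add: C_def D_def simps)
  also have "\<dots> = A" unfolding CD(1) by (simp add: cancel_left)
  finally show "letters_prod (right_up e) = gamma (LA e)" by (simp add: gA)
  have C': "gr_inv gs \<bullet> C \<bullet> gs = A" by (simp add: C_def simps)
  have "letters_prod (down_right e) = gr_inv gs \<bullet> (A \<bullet> D) \<bullet> gs" by (simp add: D_def simps)
  then show "letters_prod (down_right e) = gamma (LA e)" using C' CD(2) by (simp add: gA)
  have "letters_prod (right_down e) = gr_inv gs \<bullet> (D \<bullet> A) \<bullet> gs" by (simp add: D_def simps)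
  then show "letters_prod (right_down e) = gamma (LA e)" using C' CD(1) by (simp add: gA)
  have D': "gr_inv gt \<bullet> D \<bullet> gt = A" by (simp add: D_def simps)
  have "letters_prod (up_left e) = gr_inv gt \<bullet> (C \<bullet> gr_inv A) \<bullet> gt" by (simp add: C_def simps)
  also have "C \<bullet> gr_inv A = D" unfolding CD(1) by (simp add: Gr.m_assoc)
  finally show "letters_prod (up_left e) = gamma (LA e)" using D' by (simp add: gA)
  have "letters_prod (left_up e) = gr_inv gt \<bullet> (gr_inv A \<bullet> C) \<bullet> gt" by (simp add: C_def simps)
  also have "gr_inv A \<bullet> C = D" unfolding CD(2) by (simp add: cancel_left)
  finally show "letters_prod (left_up e) = gamma (LA e)" using D' by (simp add: gA)
qed

lemma letters_prod_two: "md (c + d) = md e \<Longrightarrow> letters_prod [LA c, LA d] = gamma (LA e)"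
proof -
  assume "md (c + d) = md e"
  then have "ga [^]\<^bsub>Gr\<^esub> (c + d) = ga [^]\<^bsub>Gr\<^esub> e" using pow_md by metis
  then show ?thesis by (simp add: gamma_LA Gr.int_pow_mult)
qed

lemma commute_inv:
  assumes "g \<bullet> h = h \<bullet> g" "g \<in> carrier Gr" "h \<in> carrier Gr"
  shows "gr_inv g \<bullet> h = h \<bullet> gr_inv g"
proof -
  have "gr_inv g \<bullet> h = gr_inv g \<bullet> (h \<bullet> g) \<bullet> gr_inv g"
    using assms(2,3) by (simp add: Gr.m_assoc)
  also have "\<dots> = h \<bullet> gr_inv g"
    using assms(2,3) by (simp add: cancel_left flip: assms(1))
  finally show ?thesis .
qed

lemma ts_commute:
  "gt \<bullet> gs = gs \<bullet> gt"
  "gr_inv gt \<bullet> gs = gs \<bullet> gr_inv gt"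
  "gt \<bullet> gr_inv gs = gr_inv gs \<bullet> gt"
  "gr_inv gt \<bullet> gr_inv gs = gr_inv gs \<bullet> gr_inv gt"
proof -
  show 1: "gt \<bullet> gs = gs \<bullet> gt" using st_commute by simp
  show "gr_inv gt \<bullet> gs = gs \<bullet> gr_inv gt" by (rule commute_inv[OF 1]) simp_all
  show 3: "gt \<bullet> gr_inv gs = gr_inv gs \<bullet> gt" using commute_inv[OF st_commute] by simp
  show "gr_inv gt \<bullet> gr_inv gs = gr_inv gs \<bullet> gr_inv gt" by (rule commute_inv[OF 3]) simp_all
qed

lemma ts_commute_left:
  assumes "y \<in> carrier Gr"
  shows "gt \<bullet> (gs \<bullet> y) = gs \<bullet> (gt \<bullet> y)"
    "gr_inv gt \<bullet> (gs \<bullet> y) = gs \<bullet> (gr_inv gt \<bullet> y)"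
    "gt \<bullet> (gr_inv gs \<bullet> y) = gr_inv gs \<bullet> (gt \<bullet> y)"
    "gr_inv gt \<bullet> (gr_inv gs \<bullet> y) = gr_inv gs \<bullet> (gr_inv gt \<bullet> y)"
  using assms ts_commute by (simp_all flip: Gr.m_assoc)

lemma letters_prod_label: "letters_prod (label s x) = gamma x"
proof -
  obtain ph k h v where s: "s = (ph, k, h, v)" by (metis prod_cases4)
  show ?thesis
  proof (cases x)
    case (LA e)
    have two: "letters_prod [LA (md (- k)), LA (md (e + k))] = gamma (LA e)"
      by (rule letters_prod_two) (simp add: mod_simps)
    have one: "letters_prod [LA d] = gamma (LA d)" for d by simp
    show ?thesis
      unfolding s LA by (simp add: letters_prod_triangles two one del: letters_prod_simps)
  qed (simp_all add: s gamma_flat Gr.m_assoc cancel_left ts_commute ts_commute_left Gr.inv_mult_group)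
qed

subsection \<open>The stacking\<close>

definition letter_of :: "gen gword set \<Rightarrow> letter" where
  "letter_of = inv_into letters gamma"

lemma letter_of_gamma: "x \<in> letters \<Longrightarrow> letter_of (gamma x) = x"
  by (simp add: letter_of_def inj_on_gamma)

lemma generate_gamma: "p \<noteq> 1 \<Longrightarrow> generate Gr (gamma ` letters) = carrier Gr"
proof
  assume p: "p \<noteq> 1"
  show "generate Gr (gamma ` letters) \<subseteq> carrier Gr"
    by (rule Gr.generate_incl) auto
  show "carrier Gr \<subseteq> generate Gr (gamma ` letters)"
  proof
    fix g assume "g \<in> carrier Gr"
    then obtain w where "g = cls w" by (auto simp: carrier_Gr)
    moreover have "cls w \<in> generate Gr (gamma ` letters)" for w
    proof (induction w)
      case Nil
      then show ?case using generate.one[of Gr] by (simp add: one_Gr)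
    next
      case (Cons z w)
      obtain x b where z: "z = (x, b)" by (cases z)
      \<comment> \<open>For \<open>p = 1\<close> the interval \<open>{1..<int p}\<close> would be
        empty and no power of \<open>a\<close> would be a letter.\<close>
      have "1 \<in> digits" using p by (auto simp: digits_def torsion_free_def)
      then have "LA 1 \<in> letters" "LA (md (- 1)) \<in> letters"
        using digit_neg[of 1] by (auto simp: letters_def)
      moreover have "cls [(gen_a, True)] = gamma (LA 1)" "cls [(gen_a, False)] = gamma (LA (md (- 1)))"
        using pow_md[of "-1"] by (simp_all add: gamma_def letter_word_def flip: gamma_LA)
      moreover have "cls [(gen_t, True)] = gamma LT" "cls [(gen_t, False)] = gamma LT'"
        "cls [(gen_s, True)] = gamma LS" "cls [(gen_s, False)] = gamma LS'"
        by (simp_all add: gamma_def letter_word_def)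
      moreover have "{LT, LT', LS, LS'} \<subseteq> letters" by (auto simp: letters_def)
      ultimately have "cls [(x, b)] \<in> gamma ` letters"
        by (cases x; cases b) auto
      then have "cls [(x, b)] \<bullet> cls w \<in> generate Gr (gamma ` letters)"
        using Cons generate.incl generate.eng by metis
      then show ?case by (simp add: mult_Gr z)
    qed
    ultimately show "g \<in> generate Gr (gamma ` letters)" by simp
  qed
qed

lemma finite_letters: "finite letters"
  by (simp add: letters_def finite_digits)

lemma inverse_closed_gens_gamma: "p \<noteq> 1 \<Longrightarrow> inverse_closed_gens Gr (gamma ` letters)"
  unfolding inverse_closed_gens_def
  using Gr.is_group generate_gamma gamma_not_one letter_inv_letters finite_letters
  by (auto simp flip: gamma_inv)

lemma edge_path_gamma:
  assumes "g \<in> carrier Gr" "set w \<subseteq> letters" "(h, y) \<in> set (edge_path Gr g (map gamma w))"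
  shows "h \<in> carrier Gr \<and> y \<in> gamma ` letters \<and> (vertex_of h, letter_of y) \<in> set (vertex_path (vertex_of g) w)"
  using assms
proof (induction w arbitrary: g)
  case (Cons x w)
  show ?case
  proof (cases "(h, y) = (g, gamma x)")
    case True
    then show ?thesis using Cons.prems by (auto simp: letter_of_gamma)
  next
    case False
    then show ?thesis
      using Cons.IH[of "g \<bullet> gamma x"] Cons.prems by (auto simp: vertex_of_mult_gamma)
  qed
qed simp

theorem cone_types_Gr:
  assumes "p \<noteq> 1"
  shows "cone_types Gr (gamma ` letters) (\<lambda>g. state_of (vertex_of g)) (\<lambda>s x. child s (letter_of x))
    (\<lambda>s x. step s (letter_of x)) (\<lambda>s. gamma (last_letter s))
    (\<lambda>s x. map gamma (label s (letter_of x)))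
    (inv_image key_less (\<lambda>(g, x). edge_key (vertex_of g) (letter_of x)))"
proof
  note ex = expansion_vertex_of
  have inv_letter: "letter_of (gr_inv (gamma x)) = letter_inv x" if "x \<in> letters" for x
    using that letter_of_gamma[OF letter_inv_letters[OF that]] by (simp add: gamma_inv)
  have root: "state_of (vertex_of \<one>\<^bsub>Gr\<^esub>) = (0, 0, 0, 0)"
    by (simp add: vertex_of_one root_def pole_order_zero fdeg_zero dig_def)
  show "inverse_closed_gens Gr (gamma ` letters)" by (rule inverse_closed_gens_gamma[OF assms])
  show "finite ((\<lambda>g. state_of (vertex_of g)) ` carrier Gr)"
    by (rule finite_subset[OF _ finite_states]) (auto intro: ex)
  show "wf (inv_image key_less (\<lambda>(g, x). edge_key (vertex_of g) (letter_of x)))"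
    by (rule wf_inv_image[OF wf_key_less])
  fix g y assume g: "g \<in> carrier Gr" and y: "y \<in> gamma ` letters"
  then obtain x where x: "x \<in> letters" "y = gamma x" by blast
  have lx: "letter_of y = x" using x by (simp add: letter_of_gamma)
  show "child (state_of (vertex_of g)) (letter_of y) \<Longrightarrow>
      state_of (vertex_of (g \<bullet> y)) = step (state_of (vertex_of g)) (letter_of y)"
    using state_step[OF ex[OF g] x(1)] g x lx by (simp add: vertex_of_mult_gamma)
  show "child (state_of (vertex_of g)) (letter_of y) \<Longrightarrow>
      gamma (last_letter (step (state_of (vertex_of g)) (letter_of y))) = y"
    using last_letter_step lx x by simp
  show "child (state_of (vertex_of g)) (letter_of y) \<Longrightarrow>
      step (state_of (vertex_of g)) (letter_of y) \<noteq> state_of (vertex_of \<one>\<^bsub>Gr\<^esub>)"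
    unfolding root by (rule step_not_root)
  have lab: "set (label (state_of (vertex_of g)) x) \<subseteq> letters"
    by (rule label_letters[OF ex[OF g] x(1)])
  then show "map gamma (label (state_of (vertex_of g)) (letter_of y)) \<in> lists (gamma ` letters)"
    by (simp add: lx lists_eq_set image_mono)
  show "foldl (\<otimes>\<^bsub>Gr\<^esub>) g (map gamma (label (state_of (vertex_of g)) (letter_of y))) = g \<bullet> y"
    using g lx x by (simp add: foldl_gamma letters_prod_label)
  have rev: "child (state_of (vertex_of (g \<bullet> y))) (letter_of (gr_inv y)) \<longleftrightarrow>
      child (state_of (act (vertex_of g) x)) (letter_inv x)"
    if "g \<in> carrier Gr" "x \<in> letters" "y = gamma x" for g x y
    using that inv_letter by (simp add: vertex_of_mult_gamma)
  show "map gamma (label (state_of (vertex_of g)) (letter_of y)) = [y]"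
    if tree: "child (state_of (vertex_of g)) (letter_of y) \<or>
      child (state_of (vertex_of (g \<bullet> y))) (letter_of (gr_inv y))"
  proof -
    consider "child (state_of (vertex_of g)) x" | "child (state_of (act (vertex_of g) x)) (letter_inv x)"
      using tree rev[OF g x] lx by auto
    then have "label (state_of (vertex_of g)) x = [x]"
    proof cases
      case 1
      then show ?thesis by (rule label_child)
    next
      case 2
      have gy: "g \<bullet> y \<in> carrier Gr" using g x by simp
      have v: "vertex_of (g \<bullet> y) = act (vertex_of g) x" using g x by (simp add: vertex_of_mult_gamma)
      \<comment> \<open>That the inverse letter leads back is computed in the group and then carried
        over to vertices.\<close>
      have "act (act (vertex_of g) x) (letter_inv x) = vertex_of (g \<bullet> y \<bullet> gamma (letter_inv x))"
        using gy by (simp add: vertex_of_mult_gamma v)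
      also have "g \<bullet> y \<bullet> gamma (letter_inv x) = g"
        using g x by (simp add: gamma_inv Gr.m_assoc)
      finally have "state_of (vertex_of g) = step (state_of (act (vertex_of g) x)) (letter_inv x)"
        using state_step[OF _ letter_inv_letters[OF x(1)] 2] ex[OF gy] v by simp
      then show ?thesis using label_step[OF 2] letter_inv_inv[OF x(1)] by simp
    qed
    then show ?thesis using lx x by simp
  qed
  show "((h, z), (g, y)) \<in> inv_image key_less (\<lambda>(g, x). edge_key (vertex_of g) (letter_of x))"
    if "\<not> child (state_of (vertex_of g)) (letter_of y)"
      "\<not> child (state_of (vertex_of (g \<bullet> y))) (letter_of (gr_inv y))"
      "(h, z) \<in> set (edge_path Gr g (map gamma (label (state_of (vertex_of g)) (letter_of y))))"
      "\<not> child (state_of (vertex_of h)) (letter_of z)"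
      "\<not> child (state_of (vertex_of (h \<bullet> z))) (letter_of (gr_inv z))"
    for h z
  proof -
    have hz: "h \<in> carrier Gr" "z \<in> gamma ` letters"
        "(vertex_of h, letter_of z) \<in> set (vertex_path (vertex_of g) (label (state_of (vertex_of g)) x))"
      using edge_path_gamma[OF g lab] that(3) lx by auto
    obtain x' where x': "x' \<in> letters" "z = gamma x'" using hz(2) by blast
    have "label (state_of (vertex_of g)) x \<noteq> [x]"
      using tree_edge_if_label[OF ex[OF g] x(1)] that(1,2) rev[OF g x] lx by auto
    from label_key_less[OF ex[OF g] x(1) this hz(3)]
    show ?thesis
      using that(4,5) rev[OF hz(1) x'] lx letter_of_gamma[OF x'(1)] x'(2) by auto
  qed
qed

corollary stackable_Gr:
  assumes "p \<noteq> 1"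
  shows "autostackable Gr" "algorithmically_stackable Gr"
  unfolding autostackable_def algorithmically_stackable_def
  using cone_types.stackable_over[OF cone_types_Gr[OF assms]] inverse_closed_gens_gamma[OF assms]
  by blast+

end

theorem theorem6p1:
  shows "algorithmically_stackable baumslag_group \<and>
    (\<forall>p::nat. p \<ge> 2 \<longrightarrow> autostackable (diestel_leader_group p))"
proof (intro conjI allI impI)
  have "baumslag_group = modulus.Gr 0"
    by (simp add: baumslag_group_def modulus.Gr_def modulus.relations_def)
  then show "algorithmically_stackable baumslag_group"
    using modulus.stackable_Gr(2)[of 0] by simp
next
  fix p :: nat assume p: "2 \<le> p"
  then have "diestel_leader_group p = modulus.Gr p"
    by (simp add: diestel_leader_group_def modulus.Gr_def modulus.relations_def)
  then show "autostackable (diestel_leader_group p)"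
    using modulus.stackable_Gr(1)[of p] p by simp
qed

end
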